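(* Let $0<\lambda\le 1$, let $C=C(\lambda,\lambda,-1)>0$ be a constant with the lower-bound property described in the context, and let $A>0$ be such that $AC<\pi$. Then there is $\gamma_0>0$ such that for every nontrivial zero $\rho=\beta+i\gamma$ of $L(\lambda,\lambda,s)$ with $\gamma\ge\gamma_0$ there exists a radius $r$ with $$\exp(-A\gamma/\log\gamma)\le r\le \exp(-A\gamma/\log\gamma)\log^2\gamma$$ such that the discs $$|s-\rho|<r\quad\text{and}\quad |s-(1-\overline{\rho})|<r$$ contain the same number of zeros of $L(\lambda,\lambda,s)$.
   Context: For $0<\lambda,\alpha\le 1$ the Lerch zeta-function is defined by $L(\lambda,\alpha,s)=\sum_{m=0}^\infty \frac{e^{2\pi i\lambda m}}{(m+\alpha)^s}$ for $\operatorname{Re}s>1$, and by analytic continuation to the whole complex plane except for a possible simple pole at $s=1$; here both parameters equal $\lambda$. A zero of $L(\lambda,\lambda,s)$ is called nontrivial if it lies in the strip $-1\le\operatorname{Re}s<1+\lambda$; it is written $\rho=\beta+i\gamma$ with $\beta,\gamma$ real. Zeros are counted with multiplicity. Lower-bound property of the constant $C=C(\lambda,\lambda,-1)$: there is $t_0>1$ such that for every $s=\sigma+it$ with $\sigma\ge -1$, $t\ge t_0$ and $L(\lambda,\lambda,s)\ne0$, $$\frac{1}{|L(\lambda,\lambda,s)|}<\exp\bigl(C(|\log d|+1)\log t\bigr),$$ where $d$ is the distance from $s$ to the nearest zero of $L(\lambda,\lambda,\cdot)$. (Such a positive constant exists for each $0<\lambda\le1$.) *)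

theory Defs
  imports "HOL-Complex_Analysis.Complex_Analysis"
begin

definition lerch_series :: "real \<Rightarrow> real \<Rightarrow> complex \<Rightarrow> complex" where
  "lerch_series l a s = (\<Sum>m. cis (2 * pi * l * real m) / complex_of_real (real m + a) powr s)"

text \<open>
  The last clause fixes the value at \<open>1\<close>: the removable singularity is removed, and if there is a
  simple pole then the (meaningless) value there is set to \<open>0\<close>, so that the continuation is
  unique as a total function.
\<close>

definition is_lerch_continuation :: "real \<Rightarrow> real \<Rightarrow> (complex \<Rightarrow> complex) \<Rightarrow> bool" where
  "is_lerch_continuation l a f \<longleftrightarrow>
     (\<forall>s. Re s > 1 \<longrightarrow> f s = lerch_series l a s) \<and>
     f holomorphic_on - {1} \<and>
     (f analytic_on {1} \<or> is_pole f 1 \<and> zorder f 1 = -1 \<and> f 1 = 0)"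

lemma is_lerch_continuation_unique:
  assumes f: "is_lerch_continuation l a f" and g: "is_lerch_continuation l a g"
  shows "f = g"
proof -
  have eq: "f s = g s" if "s \<noteq> 1" for s
  proof (rule analytic_continuation_open[of "{s. Re s > 1}" "- {1}" f g])
    show "open {s::complex. Re s > 1}"
      by (rule open_halfspace_Re_gt)
    show "{s::complex. Re s > 1} \<noteq> {}"
      by (auto intro!: exI[of _ 2])
    show "connected (- {1::complex})"
      by (intro connected_punctured_universe) auto
  qed (use f g that in \<open>auto simp: is_lerch_continuation_def\<close>)
  have ev: "eventually (\<lambda>s. f s = g s) (at 1)"
    using eq by (auto simp: eventually_at_filter)
  have pole: "is_pole f 1 \<longleftrightarrow> is_pole g 1"
    using ev by (intro is_pole_cong) auto
  have lim: "(h \<longlongrightarrow> h 1) (at 1)" if "h analytic_on {1}" for h :: "complex \<Rightarrow> complex"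
    using analytic_at_imp_isCont[OF that] by (simp add: isCont_def)
  have np: "\<not> is_pole h 1" if "h analytic_on {1}" for h :: "complex \<Rightarrow> complex"
    using lim[OF that] not_tendsto_and_filterlim_at_infinity[of "at (1::complex)" h "h 1"]
    by (auto simp: is_pole_def)
  have "f 1 = g 1"
  proof (cases "is_pole f 1")
    case True
    then show ?thesis using f g pole np by (auto simp: is_lerch_continuation_def)
  next
    case False
    then have "f analytic_on {1}" "g analytic_on {1}"
      using f g pole by (auto simp: is_lerch_continuation_def)
    then have "(f \<longlongrightarrow> f 1) (at 1)" "(g \<longlongrightarrow> g 1) (at 1)"
      by (auto intro: lim)
    moreover from this(1) have "(g \<longlongrightarrow> f 1) (at 1)"
      using ev by (rule Lim_transform_eventually)
    ultimately show ?thesis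
      by (intro tendsto_unique[of "at 1" g]) auto
  qed
  with eq show ?thesis by (intro ext) metis
qed

definition lerch :: "real \<Rightarrow> real \<Rightarrow> complex \<Rightarrow> complex" where
  "lerch l a = (THE f. is_lerch_continuation l a f)"

text \<open>Analyticity is required so that a pole with conventional value \<open>0\<close> is not counted as a zero.\<close>

definition zeros_of :: "(complex \<Rightarrow> complex) \<Rightarrow> complex set" where
  "zeros_of f = {s. f analytic_on {s} \<and> f s = 0}"

definition num_zeros_in :: "(complex \<Rightarrow> complex) \<Rightarrow> complex set \<Rightarrow> int" where
  "num_zeros_in f D = (\<Sum>s\<in>zeros_of f \<inter> D. zorder f s)"

definition nontrivial_zeros :: "real \<Rightarrow> complex set" where
  "nontrivial_zeros l = {s \<in> zeros_of (lerch l l). -1 \<le> Re s \<and> Re s < 1 + l}"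

text \<open>
  \<open>C\<close> is admissible as a constant \<open>C(l, a, \<sigma>\<^sub>0)\<close>. The zero set is closed, so
  \<open>infdist\<close> is the distance to the nearest zero (trivial or not).
\<close>

definition lerch_lower_bound_const :: "real \<Rightarrow> real \<Rightarrow> real \<Rightarrow> real \<Rightarrow> bool" where
  "lerch_lower_bound_const l a \<sigma>\<^sub>0 C \<longleftrightarrow>
     (\<exists>t\<^sub>0>1. \<forall>s. Re s \<ge> \<sigma>\<^sub>0 \<and> Im s \<ge> t\<^sub>0 \<and> lerch l a s \<noteq> 0 \<longrightarrow>
        1 / cmod (lerch l a s) <
          exp (C * (\<bar>ln (infdist s (zeros_of (lerch l a)))\<bar> + 1) * ln (Im s)))"

end

theory Submission
  imports Defs
begin

text \<open>
  Write \<open>f = L(l, l, \<cdot>)\<close> and \<open>g s = cnj (f (1 - cnj s))\<close>, whose zeros are the reflections of the zeros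
  of \<open>f\<close>. The functional equation of the Lerch zeta-function reads \<open>f = X (g + D)\<close> on the upper half
  plane, where in vertical strips \<open>X\<close> has no zeros and grows at most polynomially, and \<open>D\<close> is at most
  \<open>exp (- \<pi> Im s)\<close> times a power of \<open>Im s\<close>.
  On a circle about \<open>\<rho>\<close> of radius about \<open>exp (- A \<gamma> / log \<gamma>)\<close> that keeps away from all zeros, the
  lower-bound property gives \<open>|f| > exp (- (A C + o(1)) \<gamma>)\<close>, which beats \<open>|X D|\<close> because \<open>A C < \<pi>\<close>;
  so \<open>f\<close> and \<open>X g\<close> have equally many zeros inside by Rouche's theorem. Such a circle exists
  because a unit disc about \<open>\<rho>\<close> contains only polynomially many zeros (Jensen), and spacing the
  candidate radii within \<open>[R, 2 R]\<close> loses only a polynomial factor in the distance.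

  The analytic continuation, its growth and the functional equation all come from the representation
  of the Dirichlet series as an integral of \<open>(z + a) powr (- s) exp (2 \<pi> \<i> l z) / (1 - exp (2 \<pi> \<i> z))\<close>
  along a vertical line \<open>Re z = c\<close>, \<open>- 1 < c < 0\<close>: for \<open>0 < l < 1\<close> the integrand decays
  exponentially, so the integral is entire in \<open>s\<close>, and letting \<open>c\<close> tend to \<open>- a\<close> and expanding
  geometrically gives the functional equation. For \<open>l = 1\<close> the function is the Riemann zeta-function,
  whose functional equation is exact (\<open>D = 0\<close>); it is read off from the case \<open>l = 1/2\<close>, \<open>a = 1\<close>.
\<close>

subsection \<open>Integrals along vertical lines\<close>

text \<open>The shape of the radius comes from the lower bound: with d about exp (- A gamma / log
  gamma) the exponent C |log d| log t is about A C gamma, the quotient by log gamma offsetting the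
  factor log t. The error term competes with exp (- pi gamma), because the two phases of the
  functional equation have moduli exp (pi t / 2) and exp (- pi t / 2). Equal parameters matter: the
  functional equation of L(l, a, s) produces series with parameters (- a, l) and (a, 1 - l) at 1 -
  s, and for a = l the first is the conjugate of the original function at 1 - cnj s. The lower bound
  is available only for Re s >= -1, so high zeros must first be kept away from that edge, lest the
  circles leave its range. For l = 1 the kernel tends to -1 in one direction and the line integral
  converges only for Re s > 1. At parameters (1/2, 1) it decays both ways, and the series there are
  elementary multiples of zeta; hence the detour.\<close>

lemma integrable_halfline_imp_integrable_abs:
  fixes f :: "real \<Rightarrow> real"
  assumes meas: "f \<in> borel_measurable borel" and nonneg: "\<And>x. f x \<ge> 0"
    and int: "f integrable_on {a..}"
  shows "integrable lborel (\<lambda>y. f (a + \<bar>y\<bar>))"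
proof -
  define g where "g = (\<lambda>x. indicator {a..} x *\<^sub>R f x)"
  have "f absolutely_integrable_on {a..}"
    using nonneg int by (intro nonnegative_absolutely_integrable_1) auto
  hence "integrable lebesgue g"
    by (simp add: set_integrable_def g_def)
  moreover have "g \<in> borel_measurable lborel"
    using meas unfolding g_def by measurable
  ultimately have g: "integrable lborel g"
    by (simp add: integrable_completion)
  \<comment> \<open>The two half lines are covered by \<open>g\<close> and its mirror image. At
    \<open>y = 0\<close> both contribute, so the sum serves as a majorant.\<close>
  have "integrable lborel (\<lambda>y. g (a + 1 * y) + g (a + (-1) * y))"
    by (intro Bochner_Integration.integrable_add lborel_integrable_real_affine g) auto
  thus ?thesis
  proof (rule Bochner_Integration.integrable_bound)
    show "(\<lambda>y. f (a + \<bar>y\<bar>)) \<in> borel_measurable lborel"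
      using meas by measurable
    show "AE y in lborel. norm (f (a + \<bar>y\<bar>)) \<le> norm (g (a + 1 * y) + g (a + (-1) * y))"
      using nonneg by (intro AE_I2) (auto simp: g_def indicator_def abs_if)
  qed
qed

lemma integrable_exp_neg_abs:
  fixes k :: real
  assumes "k > 0"
  shows "integrable lborel (\<lambda>y. exp (- k * \<bar>y\<bar>))"
proof -
  have "integrable lborel (\<lambda>y. exp (- k * (0 + \<bar>y\<bar>)))"
    by (rule integrable_halfline_imp_integrable_abs)
       (use assms integrable_on_exp_minus_to_infinity[of k 0] in auto)
  thus ?thesis by simp
qed

lemma integrable_powr_abs:
  fixes a p :: real
  assumes "a > 0" "p > 1"
  shows "integrable lborel (\<lambda>y. (a + \<bar>y\<bar>) powr (-p))"
  by (rule integrable_halfline_imp_integrable_abs)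
     (use has_integral_powr_to_inf[of "-p" a] assms in \<open>auto simp: integrable_on_def\<close>)

lemma norm_Complex_ge:
  assumes "a \<ge> 0"
  shows "(a + \<bar>y\<bar>) / 2 \<le> norm (Complex a y)"
  using abs_Re_le_cmod[of "Complex a y"] abs_Im_le_cmod[of "Complex a y"] assms by simp

lemma norm_Complex_le: "norm (Complex a y) \<le> \<bar>a\<bar> + \<bar>y\<bar>"
  using cmod_le[of "Complex a y"] by simp

lemma measurable_Complex [measurable (raw)]:
  assumes "f \<in> borel_measurable M" "g \<in> borel_measurable M"
  shows "(\<lambda>x. Complex (f x) (g x)) \<in> borel_measurable M"
  using assms by (simp add: Complex_eq)

text \<open>The residue theorem for rectangles whose height tends to infinity; \<open>B\<close>
  kills the horizontal sides. Since dz = i dy on vertical lines, the usual factor 2 pi i becomes 2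
  pi.\<close>

lemma strip_residue:
  fixes h :: "complex \<Rightarrow> complex"
  assumes x: "x0 < x1" "x1 < Re p" "Re p < x2" "x2 < x3"
    and holo: "h holomorphic_on {z. x0 < Re z \<and> Re z < x3} - {p}"
    and int1: "integrable lborel (\<lambda>y. h (Complex x1 y))"
    and int2: "integrable lborel (\<lambda>y. h (Complex x2 y))"
    and bd: "\<And>x y. x1 \<le> x \<Longrightarrow> x \<le> x2 \<Longrightarrow> \<bar>y\<bar> \<ge> 1 \<Longrightarrow> norm (h (Complex x y)) \<le> B \<bar>y\<bar>"
    and B: "(B \<longlongrightarrow> 0) at_top"
  shows "(LINT y|lborel. h (Complex x2 y)) - (LINT y|lborel. h (Complex x1 y)) = 2 * pi * residue h p"
proof -
  define S where "S = {z. x0 < Re z \<and> Re z < x3}"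
  have conv: "convex S"
  proof -
    have "S = {z. Re z > x0} \<inter> {z. Re z < x3}" by (auto simp: S_def)
    thus ?thesis by (simp add: convex_Int convex_halfspace_Re_gt convex_halfspace_Re_lt)
  qed
  have op: "open S"
    unfolding S_def by (intro open_Collect_conj open_halfspace_Re_gt open_halfspace_Re_lt)
  have pS: "p \<in> S" using x by (auto simp: S_def)
  have contS: "continuous_on (S - {p}) h"
    using holo unfolding S_def by (rule holomorphic_on_imp_continuous_on)
  \<comment> \<open>Truncation to [-T, T], as a gauge integral, because contour integrals over
    vertical segments evaluate to that form.\<close>
  define W where "W = (\<lambda>x T. integral {-T..T} (\<lambda>y. h (Complex x y)))"
  have W_lim: "(W x \<longlongrightarrow> (LINT y|lborel. h (Complex x y))) at_top"
    if "integrable lborel (\<lambda>y. h (Complex x y))" for x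
  proof -
    have eq: "W x T = (LINT y|lborel. indicator {-T..T} y *\<^sub>R h (Complex x y))" for T
    proof -
      have "set_integrable lborel {-T..T} (\<lambda>y. h (Complex x y))"
        unfolding set_integrable_def using that by (intro integrable_mult_indicator) auto
      from set_borel_integral_eq_integral(2)[OF this] show ?thesis
        by (simp add: W_def set_lebesgue_integral_def)
    qed
    have "((\<lambda>T. LINT y|lborel. indicator {-T..T} y *\<^sub>R h (Complex x y)) \<longlongrightarrow> (LINT y|lborel. h (Complex x y))) at_top"
    proof (rule integral_dominated_convergence_at_top)
      show "integrable lborel (\<lambda>y. norm (h (Complex x y)))" using that by simp
      show m: "(\<lambda>y. h (Complex x y)) \<in> borel_measurable lborel"
        using that by simp
      show "(\<lambda>y. indicator {-T..T} y *\<^sub>R h (Complex x y)) \<in> borel_measurable lborel" for T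
        using m by measurable
      show "AE y in lborel. ((\<lambda>T. indicator {-T..T} y *\<^sub>R h (Complex x y)) \<longlongrightarrow> h (Complex x y)) at_top"
      proof (rule AE_I2)
        fix y :: real
        have "eventually (\<lambda>T. indicator {-T..T} y *\<^sub>R h (Complex x y) = h (Complex x y)) at_top"
          using eventually_ge_at_top[of "\<bar>y\<bar>"] by eventually_elim (auto simp: indicator_def)
        thus "((\<lambda>T. indicator {-T..T} y *\<^sub>R h (Complex x y)) \<longlongrightarrow> h (Complex x y)) at_top"
          by (rule tendsto_eventually)
      qed
      show "\<forall>\<^sub>F T in at_top. AE y in lborel. norm (indicator {-T..T} y *\<^sub>R h (Complex x y)) \<le> norm (h (Complex x y))"
        by (intro always_eventually allI AE_I2) (auto simp: indicator_def)
    qed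
    thus ?thesis by (simp add: eq[abs_def])
  qed
  \<comment> \<open>Up to a unit factor, \<open>D T\<close> is the contribution of the two
    horizontal sides.\<close>
  define D where "D = (\<lambda>T. W x2 T - W x1 T - 2 * pi * residue h p)"
  have main: "norm (D T) \<le> 2 * ((x2 - x1) * B T)" if T: "T > \<bar>Im p\<bar>" "T \<ge> 1" for T
  proof -
    define a b c d where "a = Complex x1 (-T)" and "b = Complex x2 (-T)"
      and "c = Complex x2 T" and "d = Complex x1 T"
    let ?g = "rectpath a c"
    have g: "?g = linepath a b +++ linepath b c +++ linepath c d +++ linepath d a"
      by (simp add: rectpath_def Let_def a_def b_def c_def d_def)
    have pbox: "p \<in> box a c"
      using x T by (auto simp: in_box_complex_iff a_def c_def)
    have cbS: "cbox a c \<subseteq> S"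
      using x by (auto simp: in_cbox_complex_iff a_def c_def S_def)
    have img: "path_image ?g \<subseteq> S - {p}"
      using cbS pbox x T by (subst path_image_rectpath_cbox_minus_box) (auto simp: a_def c_def)
    have res: "contour_integral ?g h = 2 * pi * \<i> * (\<Sum>q\<in>{p}. winding_number ?g q * residue h q)"
    proof (rule Residue_theorem[of S])
      show "\<forall>z. z \<notin> S \<longrightarrow> winding_number ?g z = 0"
        using cbS x T by (intro allI impI winding_number_rectpath_outside) (auto simp: a_def c_def)
    qed (use op conv holo img in \<open>auto simp: S_def[symmetric] convex_connected\<close>)
    have ci: "h contour_integrable_on (linepath u v)" if "closed_segment u v \<subseteq> path_image ?g" for u v
      using that img by (intro contour_integrable_continuous_linepath continuous_on_subset[OF contS]) auto
    have seg: "closed_segment a b \<subseteq> path_image ?g" "closed_segment b c \<subseteq> path_image ?g"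
       "closed_segment c d \<subseteq> path_image ?g" "closed_segment d a \<subseteq> path_image ?g"
      by (auto simp: g path_image_join)
    note cis = seg[THEN ci]
    have split: "contour_integral ?g h = contour_integral (linepath a b) h + contour_integral (linepath b c) h
      + contour_integral (linepath c d) h + contour_integral (linepath d a) h"
      unfolding g using cis by (simp add: contour_integrable_joinI)
    have v1: "contour_integral (linepath b c) h = \<i> * W x2 T"
      unfolding W_def using T by (intro contour_integral_linepath_same_Re) (auto simp: b_def c_def)
    have "contour_integral (linepath a d) h = \<i> * W x1 T"
      unfolding W_def using T by (intro contour_integral_linepath_same_Re) (auto simp: a_def d_def)
    hence v2: "contour_integral (linepath d a) h = - \<i> * W x1 T"
    proof -
      have "continuous_on (closed_segment a d) h"
        using seg(4) img by (intro continuous_on_subset[OF contS]) (auto simp: closed_segment_commute)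
      from contour_integral_reverse_linepath[OF this] show ?thesis
        using \<open>contour_integral (linepath a d) h = \<i> * W x1 T\<close> by simp
    qed
    have "B T \<ge> 0" using bd[of x1 T] x T norm_ge_zero[of "h (Complex x1 T)"] by linarith
    have h1: "norm (contour_integral (linepath a b) h) \<le> (x2 - x1) * B T"
    proof -
      have "norm (contour_integral (linepath a b) h) \<le> B T * norm (b - a)"
      proof (rule contour_integral_bound_linepath[OF cis(1) \<open>B T \<ge> 0\<close>])
        fix z assume "z \<in> closed_segment a b"
        hence "x1 \<le> Re z" "Re z \<le> x2" "Im z = -T"
          using x by (auto simp: a_def b_def closed_segment_same_Im closed_segment_eq_real_ivl)
        moreover have "z = Complex (Re z) (Im z)" by simp
        ultimately show "norm (h z) \<le> B T" using bd[of "Re z" "-T"] T by auto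
      qed
      also have "b - a = of_real (x2 - x1)" by (simp add: a_def b_def complex_eq_iff)
      finally show ?thesis using x by (simp add: mult.commute del: of_real_diff)
    qed
    have h2: "norm (contour_integral (linepath c d) h) \<le> (x2 - x1) * B T"
    proof -
      have "norm (contour_integral (linepath c d) h) \<le> B T * norm (d - c)"
      proof (rule contour_integral_bound_linepath[OF cis(3) \<open>B T \<ge> 0\<close>])
        fix z assume "z \<in> closed_segment c d"
        hence "x1 \<le> Re z" "Re z \<le> x2" "Im z = T"
          using x by (auto simp: c_def d_def closed_segment_same_Im closed_segment_eq_real_ivl)
        moreover have "z = Complex (Re z) (Im z)" by simp
        ultimately show "norm (h z) \<le> B T" using bd[of "Re z" "T"] T by auto
      qed
      also have "d - c = - of_real (x2 - x1)" by (simp add: c_def d_def complex_eq_iff)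
      finally show ?thesis using x by (simp add: mult.commute del: of_real_diff)
    qed
    have "\<i> * D T = - (contour_integral (linepath a b) h + contour_integral (linepath c d) h)"
      using res split v1 v2 winding_number_rectpath[OF pbox]
      by (simp add: D_def algebra_simps)
    hence "norm (D T) = norm (contour_integral (linepath a b) h + contour_integral (linepath c d) h)"
      by (metis mult_1 norm_ii norm_minus_cancel norm_mult)
    also have "\<dots> \<le> 2 * ((x2 - x1) * B T)"
      using norm_triangle_ineq[of "contour_integral (linepath a b) h" "contour_integral (linepath c d) h"] h1 h2 by linarith
    finally show ?thesis .
  qed
  have "(D \<longlongrightarrow> 0) at_top"
  proof (rule Lim_null_comparison)
    show "\<forall>\<^sub>F T in at_top. norm (D T) \<le> 2 * ((x2 - x1) * B T)"
      using eventually_gt_at_top[of "\<bar>Im p\<bar>"] eventually_ge_at_top[of 1]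
      by eventually_elim (rule main)
    show "((\<lambda>T. 2 * ((x2 - x1) * B T)) \<longlongrightarrow> 0) at_top"
      using tendsto_mult[OF tendsto_const[of 2] tendsto_mult[OF tendsto_const[of "x2-x1"] B]] by simp
  qed
  moreover have "(D \<longlongrightarrow> (LINT y|lborel. h (Complex x2 y)) - (LINT y|lborel. h (Complex x1 y)) - 2 * pi * residue h p) at_top"
    unfolding D_def by (intro tendsto_intros W_lim int1 int2)
  ultimately show ?thesis
    using tendsto_unique[OF trivial_limit_at_top_linorder] by fastforce
qed

text \<open>The mean value inequality on the disc of radius \<open>norm w\<close>; it bounds the
  difference quotients in the next lemma.\<close>

lemma norm_exp_minus_1_le:
  fixes w :: complex
  shows "norm (exp w - 1) \<le> norm w * exp (norm w)"
proof -
  have "norm (exp w - exp 0) \<le> exp (norm w) * norm (w - 0)"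
  proof (rule field_differentiable_bound[of "cball 0 (norm w)" exp exp])
    show "norm (exp z) \<le> exp (norm w)" if "z \<in> cball 0 (norm w)" for z :: complex
      using that complex_Re_le_cmod[of z] by simp
  qed (auto intro!: derivative_eq_intros)
  thus ?thesis by (simp add: mult.commute)
qed

text \<open>Differentiation under the integral by dominated convergence along arbitrary null
  sequences. The hypothesis covers every \<open>B\<close> because the majorant at \<open>s\<close>
  needs an exponent larger than \<open>norm s\<close>.\<close>

lemma holomorphic_integral_exp:
  fixes u k :: "'a \<Rightarrow> complex"
  assumes [measurable]: "u \<in> borel_measurable M" "k \<in> borel_measurable M"
    and int: "\<And>B. integrable M (\<lambda>y. exp (B * norm (u y)) * norm (k y))"
  shows "(\<lambda>s. LINT y|M. exp (s * u y) * k y) holomorphic_on UNIV"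
proof -
  let ?f = "\<lambda>s y. exp (s * u y) * k y"
  have Re_le: "Re (s * u y) \<le> norm s * norm (u y)" for s y
    using complex_Re_le_cmod[of "s * u y"] by (simp add: norm_mult)
  have intf: "integrable M (?f s)" for s
  proof (rule Bochner_Integration.integrable_bound[OF int[of "norm s"]])
    show "AE y in M. norm (?f s y) \<le> norm (exp (norm s * norm (u y)) * norm (k y))"
      using Re_le by (intro AE_I2) (auto simp: norm_mult intro!: mult_right_mono)
  qed auto
  have "((\<lambda>s. LINT y|M. ?f s y) has_field_derivative (LINT y|M. u y * ?f s y)) (at s)" for s
    unfolding DERIV_def tendsto_at_iff_sequentially comp_def
  proof (intro allI impI)
    fix X :: "nat \<Rightarrow> complex"
    assume X: "\<forall>i. X i \<in> UNIV - {0}" and lim: "X \<longlonglongrightarrow> 0"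
    have nz: "X n \<noteq> 0" for n using X by auto
    obtain K0 where K0: "\<And>n. norm (X n) \<le> K0" 
      using convergent_imp_bounded[OF lim] by (auto simp: bounded_iff)
    define q where "q = (\<lambda>n y. (?f (s + X n) y - ?f s y) / X n)"
    have eq: "(LINT y|M. ?f (s + X n) y) - (LINT y|M. ?f s y) = X n * (LINT y|M. q n y)" for n
    proof -
      have "X n * (LINT y|M. q n y) = (LINT y|M. X n * q n y)"
        by simp
      also have "\<dots> = (LINT y|M. ?f (s + X n) y - ?f s y)"
        using nz by (simp add: q_def)
      finally show ?thesis using intf by simp
    qed
    have "(\<lambda>n. LINT y|M. q n y) \<longlonglongrightarrow> (LINT y|M. u y * ?f s y)"
    proof (rule integral_dominated_convergence)
      \<comment> \<open>The three parts of the exponent pay for exp (s u), for the factor u of the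
        derivative (via x <= exp x), and for the increment \<open>X n\<close>.\<close>
      show "integrable M (\<lambda>y. exp ((norm s + 1 + K0) * norm (u y)) * norm (k y))"
        by (rule int)
      show "AE y in M. (\<lambda>n. q n y) \<longlonglongrightarrow> u y * ?f s y"
      proof (rule AE_I2)
        fix y
        have "((\<lambda>s. ?f s y) has_field_derivative u y * ?f s y) (at s)"
          by (auto intro!: derivative_eq_intros)
        thus "(\<lambda>n. q n y) \<longlonglongrightarrow> u y * ?f s y"
          using X lim unfolding DERIV_def tendsto_at_iff_sequentially comp_def q_def by blast
      qed
      show "AE y in M. norm (q n y) \<le> exp ((norm s + 1 + K0) * norm (u y)) * norm (k y)" for n
      proof (rule AE_I2)
        fix y
        have "q n y = exp (s * u y) * ((exp (X n * u y) - 1) / X n) * k y"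
          using nz[of n] by (simp add: q_def field_simps exp_add)
        hence "norm (q n y) = exp (Re (s * u y)) * (norm (exp (X n * u y) - 1) / norm (X n)) * norm (k y)"
          by (simp add: norm_mult norm_divide)
        also have "\<dots> \<le> exp (norm s * norm (u y)) * (exp (norm (u y)) * exp (K0 * norm (u y))) * norm (k y)"
        proof (intro mult_right_mono mult_mono)
          have "norm (exp (X n * u y) - 1) \<le> norm (X n * u y) * exp (norm (X n * u y))"
            by (rule norm_exp_minus_1_le)
          also have "\<dots> = norm (X n) * (norm (u y) * exp (norm (X n) * norm (u y)))"
            by (simp add: norm_mult)
          also have "\<dots> \<le> norm (X n) * (exp (norm (u y)) * exp (K0 * norm (u y)))"
          proof (intro mult_left_mono mult_mono)
            show "norm (u y) \<le> exp (norm (u y))" using exp_ge_add_one_self[of "norm (u y)"] by linarith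
          qed (use K0 in \<open>auto intro: mult_right_mono\<close>)
          finally show "norm (exp (X n * u y) - 1) / norm (X n) \<le> exp (norm (u y)) * exp (K0 * norm (u y))"
            using nz[of n] by (simp add: field_simps)
        qed (use Re_le in auto)
        also have "\<dots> = exp ((norm s + 1 + K0) * norm (u y)) * norm (k y)"
          by (simp add: algebra_simps exp_add)
        finally show "norm (q n y) \<le> exp ((norm s + 1 + K0) * norm (u y)) * norm (k y)" .
      qed
    qed (auto simp: q_def)
    thus "(\<lambda>n. ((LINT y|M. ?f (s + X n) y) - (LINT y|M. ?f s y)) / X n) \<longlonglongrightarrow> (LINT y|M. u y * ?f s y)"
      using nz by (simp add: eq)
  qed
  thus ?thesis by (auto simp: holomorphic_on_def field_differentiable_def intro: has_field_derivative_at_within)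
qed

subsection \<open>The Dirichlet series as a contour integral\<close>

text \<open>Its simple poles are the integers n, with residue - exp (2 pi i l n) / (2 pi i): up to a
  constant, the coefficients of the Dirichlet series.\<close>

definition lerch_kernel :: "real \<Rightarrow> complex \<Rightarrow> complex" where
  "lerch_kernel l z = exp (2 * pi * \<i> * l * z) / (1 - exp (2 * pi * \<i> * z))"

text \<open>The integral of (z + a) powr (- s) times the kernel along the upward line Re z = c; the
  factor \<open>\<i>\<close> is dz / dy. Closing the line to the right, hence clockwise, would
  collect the poles 0, 1, 2, ... with positive sign.\<close>

definition lerch_int :: "real \<Rightarrow> real \<Rightarrow> real \<Rightarrow> complex \<Rightarrow> complex" where
  "lerch_int c l a s = \<i> * (LINT y|lborel. Complex (a + c) y powr (-s) * lerch_kernel l (Complex c y))"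

section \<open>Periodicity and size of the kernel\<close>

lemma lerch_kernel_add_1:
  "lerch_kernel l (z + 1) = exp (2 * pi * \<i> * l) * lerch_kernel l z"
proof -
  have "exp (2 * pi * \<i> * (z + 1)) = exp (2 * pi * \<i> * z)"
    by (simp add: ring_distribs exp_add)
  thus ?thesis by (simp add: lerch_kernel_def ring_distribs exp_add)
qed

text \<open>With q = exp (- 2 pi y) the squared norm is sin^2 (pi x) (1 + q)^2 + cos^2 (pi x) (1 -
  q)^2. This is the bound for vertical lines that avoid the integers.\<close>

lemma norm_one_minus_exp_ge_sin:
  "norm (1 - exp (2 * pi * \<i> * Complex x y)) \<ge> \<bar>sin (pi * x)\<bar> * (1 + exp (- 2 * pi * y))"
proof (rule power2_le_imp_le)
  define q where "q = exp (- 2 * pi * y)"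
  define S where "S = (sin (pi * x))\<^sup>2"
  have "exp (2 * pi * \<i> * Complex x y) = of_real q * cis (2 * (pi * x))"
    by (simp add: q_def complex_eq_iff Re_exp Im_exp mult_ac)
  hence "(norm (1 - exp (2 * pi * \<i> * Complex x y)))\<^sup>2 = (1 - q * cos (2 * (pi * x)))\<^sup>2 + (q * sin (2 * (pi * x)))\<^sup>2"
    by (simp add: cmod_power2)
  also have "\<dots> = 1 - 2 * q * cos (2 * (pi * x)) + q\<^sup>2 * ((sin (2 * (pi * x)))\<^sup>2 + (cos (2 * (pi * x)))\<^sup>2)"
    unfolding power2_diff power_mult_distrib distrib_left by simp
  also have "\<dots> = 1 - 2 * q * cos (2 * (pi * x)) + q\<^sup>2"
    by (simp only: sin_cos_squared_add mult_1_right)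
  also have "\<dots> = 1 - 2 * q * (1 - 2 * S) + q\<^sup>2"
    by (simp add: cos_double_sin S_def)
  also have "\<dots> = S * (1 + q)\<^sup>2 + (1 - S) * (1 - q)\<^sup>2"
    by (simp add: power2_eq_square algebra_simps)
  also have "\<dots> \<ge> S * (1 + q)\<^sup>2"
    using abs_sin_le_one[of "pi * x"] by (simp add: S_def abs_square_le_1)
  also have "S * (1 + q)\<^sup>2 = (\<bar>sin (pi * x)\<bar> * (1 + q))\<^sup>2"
    by (simp add: S_def power_mult_distrib)
  finally show "(\<bar>sin (pi * x)\<bar> * (1 + exp (- 2 * pi * y)))\<^sup>2 \<le> (norm (1 - exp (2 * pi * \<i> * Complex x y)))\<^sup>2"
    by (simp add: q_def)
qed auto

text \<open>Unlike the sine bound this does not degenerate at integer \<open>x\<close>, so it serves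
  on paths that pass above or below a pole.\<close>

lemma norm_one_minus_exp_ge_abs:
  "norm (1 - exp (2 * pi * \<i> * Complex x y)) \<ge> \<bar>1 - exp (- 2 * pi * y)\<bar>"
  using norm_triangle_ineq3[of 1 "exp (2 * pi * \<i> * Complex x y)"] by (simp add: mult_ac)

lemma norm_lerch_kernel:
  "norm (lerch_kernel l (Complex x y)) = exp (- 2 * pi * l * y) / norm (1 - exp (2 * pi * \<i> * Complex x y))"
  by (simp add: lerch_kernel_def norm_divide mult_ac)

lemma norm_lerch_kernel_le:
  assumes "sin (pi * x) \<noteq> 0"
  shows "norm (lerch_kernel l (Complex x y)) \<le> exp (- 2 * pi * l * y) / (\<bar>sin (pi * x)\<bar> * (1 + exp (- 2 * pi * y)))"
proof -
  let ?d = "\<bar>sin (pi * x)\<bar> * (1 + exp (- 2 * pi * y))"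
  have "?d > 0" using assms by (intro mult_pos_pos add_pos_pos) auto
  moreover have "norm (1 - exp (2 * pi * \<i> * Complex x y)) \<ge> ?d"
    by (rule norm_one_minus_exp_ge_sin)
  ultimately show ?thesis
    unfolding norm_lerch_kernel
    by (intro divide_left_mono mult_pos_pos[of "norm _"]) (auto intro: order.strict_trans2)
qed

text \<open>For y >= 0 the left side decays by itself at rate l. For y < 0 it grows, but comparison
  with exp (- 2 pi y) leaves decay at rate 1 - l.\<close>

lemma exp_le_exp_abs_times:
  fixes l \<mu> y :: real
  assumes "\<mu> \<le> l" "\<mu> \<le> 1 - l"
  shows "exp (- 2 * pi * l * y) \<le> exp (- 2 * pi * \<mu> * \<bar>y\<bar>) * (1 + exp (- 2 * pi * y))"
proof (cases "y \<ge> 0")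
  case True
  have "exp (- 2 * pi * l * y) \<le> exp (- 2 * pi * \<mu> * \<bar>y\<bar>) * 1"
    using True assms by (simp add: mult_right_mono)
  also have "\<dots> \<le> exp (- 2 * pi * \<mu> * \<bar>y\<bar>) * (1 + exp (- 2 * pi * y))"
    by (intro mult_left_mono) auto
  finally show ?thesis .
next
  case False
  have "(1 - l - \<mu>) * y \<le> 0"
    using False assms(2) by (intro mult_nonneg_nonpos) linarith+
  from mult_nonneg_nonpos[OF _ this, of "2 * pi"]
  have "2 * pi * ((1 - l - \<mu>) * y) \<le> 0" by simp
  hence "- 2 * pi * l * y \<le> - 2 * pi * \<mu> * \<bar>y\<bar> + (- 2 * pi * y)"
    using False by (simp add: algebra_simps)
  hence "exp (- 2 * pi * l * y) \<le> exp (- 2 * pi * \<mu> * \<bar>y\<bar> + (- 2 * pi * y))"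
    by simp
  also have "\<dots> = exp (- 2 * pi * \<mu> * \<bar>y\<bar>) * exp (- 2 * pi * y)" by (rule exp_add)
  also have "\<dots> \<le> exp (- 2 * pi * \<mu> * \<bar>y\<bar>) * (1 + exp (- 2 * pi * y))"
    by (intro mult_left_mono) auto
  finally show ?thesis .
qed

text \<open>For 0 < l < 1 a positive \<open>\<mu>\<close> is admissible and gives decay in both
  directions; \<open>\<mu> = 0\<close> gives the boundedness that remains at l = 1.\<close>

lemma norm_lerch_kernel_le_exp:
  assumes "sin (pi * x) \<noteq> 0" "\<mu> \<le> l" "\<mu> \<le> 1 - l"
  shows "norm (lerch_kernel l (Complex x y)) \<le> exp (- 2 * pi * \<mu> * \<bar>y\<bar>) / \<bar>sin (pi * x)\<bar>"
proof -
  have "exp (- 2 * pi * l * y) \<le> exp (- 2 * pi * \<mu> * \<bar>y\<bar>) * (1 + exp (- 2 * pi * y))"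
    by (rule exp_le_exp_abs_times[OF assms(2,3)])
  hence "exp (- 2 * pi * l * y) / (\<bar>sin (pi * x)\<bar> * (1 + exp (- 2 * pi * y))) \<le>
         exp (- 2 * pi * \<mu> * \<bar>y\<bar>) * (1 + exp (- 2 * pi * y)) / (\<bar>sin (pi * x)\<bar> * (1 + exp (- 2 * pi * y)))"
    by (intro divide_right_mono) (auto simp: add_nonneg_nonneg)
  also have "\<dots> = exp (- 2 * pi * \<mu> * \<bar>y\<bar>) / \<bar>sin (pi * x)\<bar>"
    using exp_gt_zero[of "- 2 * pi * y"] by (simp add: add_pos_pos order_less_imp_not_eq2)
  finally show ?thesis using norm_lerch_kernel_le[OF assms(1), of l y] by linarith
qed

lemma norm_lerch_kernel_le_const:
  assumes "sin (pi * x) \<noteq> 0" "0 \<le> l" "l \<le> 1"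
  shows "norm (lerch_kernel l (Complex x y)) \<le> 1 / \<bar>sin (pi * x)\<bar>"
  using norm_lerch_kernel_le_exp[of x 0 l y] assms by simp

text \<open>For the horizontal sides of the rectangles, which pass the pole at 0 at height at least
  1.\<close>

lemma norm_lerch_kernel_le_2:
  assumes "0 \<le> l" "l \<le> 1" "\<bar>y\<bar> \<ge> 1"
  shows "norm (lerch_kernel l (Complex x y)) \<le> 2"
proof -
  define q where "q = exp (- 2 * pi * y)"
  have "q > 0" by (simp add: q_def)
  have half: "exp (-2 * pi * t) \<le> 1 / 2" if "t \<ge> 1" for t
  proof -
    have "2 * pi * 1 \<le> 2 * pi * t" using that by (intro mult_left_mono) auto
    hence "2 \<le> 1 + 2 * pi * t" using pi_gt3 by linarith
    also have "\<dots> \<le> exp (2 * pi * t)" using exp_ge_add_one_self by simp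
    finally show ?thesis by (simp add: exp_minus field_simps)
  qed
  have "exp (- 2 * pi * l * y) \<le> 2 * \<bar>1 - q\<bar>" 
  proof (cases "y \<ge> 0")
    case True
    hence "q \<le> 1 / 2" using assms half[of y] by (simp add: q_def)
    hence "1 \<le> 2 * \<bar>1 - q\<bar>" by simp
    moreover have "exp (- 2 * pi * l * y) \<le> 1" using True assms by simp
    ultimately show ?thesis by (rule order.trans[rotated])
  next
    case False
    have "exp (- 2 * pi * l * y) \<le> q"
    proof -
      have "(1 - l) * y \<le> 0"
        using False assms by (intro mult_nonneg_nonpos) auto
      from mult_nonneg_nonpos[OF _ this, of "2 * pi"]
      have "2 * pi * ((1 - l) * y) \<le> 0" by simp
      thus ?thesis by (simp add: q_def algebra_simps)
    qed
    moreover have "q \<ge> 2"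
      using half[of "-y"] False assms by (simp add: q_def exp_minus field_simps)
    ultimately have "exp (- 2 * pi * l * y) \<le> q" "q \<le> 2 * \<bar>1 - q\<bar>" by auto
    thus ?thesis by (rule order.trans)
  qed
  moreover have "\<bar>1 - q\<bar> > 0" using assms by (auto simp: q_def)
  ultimately have "exp (- 2 * pi * l * y) / \<bar>1 - q\<bar> \<le> 2"
    by (simp add: field_simps)
  moreover have "norm (lerch_kernel l (Complex x y)) \<le> exp (- 2 * pi * l * y) / \<bar>1 - q\<bar>"
    unfolding norm_lerch_kernel using norm_one_minus_exp_ge_abs[of y x] \<open>\<bar>1 - q\<bar> > 0\<close>
    by (intro divide_left_mono) (auto simp: q_def intro!: mult_pos_pos intro: order.strict_trans2)
  ultimately show ?thesis by linarith
qed

lemma abs_Arg_less_pi_half: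
  assumes "Re w > 0"
  shows "\<bar>Arg w\<bar> < pi / 2"
  using Re_Ln_pos_lt[of w] assms by (cases "w = 0") (auto simp: Arg_eq_Im_Ln)

text \<open>The argument stays below pi / 2 in modulus, so the imaginary part of the exponent costs
  a constant factor only.\<close>

lemma norm_powr_le_half_plane:
  assumes "Re w > 0"
  shows "norm (w powr (-s)) \<le> norm w powr (- Re s) * exp (pi / 2 * \<bar>Im s\<bar>)"
proof -
  have "Im s * Arg w \<le> \<bar>Im s\<bar> * \<bar>Arg w\<bar>"
    by (metis abs_ge_self abs_mult)
  also have "\<dots> \<le> \<bar>Im s\<bar> * (pi / 2)"
    using abs_Arg_less_pi_half[OF assms] by (intro mult_left_mono) auto
  finally show ?thesis
    unfolding norm_powr_complex by (intro mult_mono) (auto simp: mult.commute)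
qed

lemma measurable_lerch_kernel [measurable]: "lerch_kernel l \<in> borel_measurable borel"
  unfolding lerch_kernel_def by measurable

lemma measurable_powr_right_half_plane [measurable]:
  "(\<lambda>y. Complex x y powr s) \<in> borel_measurable borel"
  unfolding powr_def by measurable

lemma sin_pi_nonzero:
  assumes "-1 < c" "c < 0"
  shows "sin (pi * c) \<noteq> 0"
proof -
  have "sin (pi * (-c)) > 0"
    using assms mult_strict_left_mono[of "-c" 1 pi] by (intro sin_gt_zero mult_pos_pos) auto
  thus ?thesis by simp
qed

section \<open>Recursion in the shift, and recovery of the Dirichlet series\<close>

context
  fixes c l :: real and s :: complex
  assumes c: "-1 < c" "c < 0" and l: "0 < l" "l \<le> 1" and s: "Re s > 1"
begin


definition lerch_dom :: "real \<Rightarrow> real \<Rightarrow> real" where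
  "lerch_dom b y = ((b + \<bar>y\<bar>) / 2) powr (- Re s) * exp (pi / 2 * \<bar>Im s\<bar>) / \<bar>sin (pi * c)\<bar>"

text \<open>Allowing \<open>b'\<close> above \<open>b\<close> gives one majorant for all shifts at
  once, as the limit over growing shifts requires.\<close>

lemma norm_lerch_integrand_le:
  assumes "b > 0" "b \<le> b'"
  shows "norm (Complex b' y powr (-s) * lerch_kernel l (Complex c y)) \<le> lerch_dom b y"
proof -
  have "norm (Complex b' y powr (-s)) \<le> norm (Complex b' y) powr (- Re s) * exp (pi / 2 * \<bar>Im s\<bar>)"
    using assms by (intro norm_powr_le_half_plane) auto
  also have "\<dots> \<le> ((b + \<bar>y\<bar>) / 2) powr (- Re s) * exp (pi / 2 * \<bar>Im s\<bar>)"
    using assms s norm_Complex_ge[of b' y] by (intro mult_right_mono powr_mono2') auto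
  finally have "norm (Complex b' y powr (-s)) * norm (lerch_kernel l (Complex c y)) \<le> 
      (((b + \<bar>y\<bar>) / 2) powr (- Re s) * exp (pi / 2 * \<bar>Im s\<bar>)) * (1 / \<bar>sin (pi * c)\<bar>)"
    using norm_lerch_kernel_le_const[OF sin_pi_nonzero[OF c], of l y] l by (intro mult_mono) auto
  thus ?thesis by (simp add: norm_mult lerch_dom_def)
qed

lemma integrable_lerch_dom: "b > 0 \<Longrightarrow> integrable lborel (lerch_dom b)"
proof -
  assume b: "b > 0"
  have "lerch_dom b = (\<lambda>y. (b + \<bar>y\<bar>) powr (- Re s) * (exp (pi / 2 * \<bar>Im s\<bar>) / \<bar>sin (pi * c)\<bar> / 2 powr (- Re s)))"
    using b by (intro ext) (simp add: lerch_dom_def powr_divide)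
  thus ?thesis using integrable_powr_abs[OF b s] by simp
qed

lemma integrable_lerch_integrand:
  assumes "b > 0"
  shows "integrable lborel (\<lambda>y. Complex b y powr (-s) * lerch_kernel l (Complex c y))"
proof (rule Bochner_Integration.integrable_bound[OF integrable_lerch_dom[OF assms]])
  show "(\<lambda>y. Complex b y powr (-s) * lerch_kernel l (Complex c y)) \<in> borel_measurable lborel"
    by measurable
  have "norm (Complex b y powr (-s) * lerch_kernel l (Complex c y)) \<le> \<bar>lerch_dom b y\<bar>" for y
    using norm_lerch_integrand_le[OF assms order.refl, of y] by linarith
  thus "AE y in lborel. norm (Complex b y powr (-s) * lerch_kernel l (Complex c y)) \<le> norm (lerch_dom b y)"
    by simp
qed

text \<open>Moving the line from c to c + 1 crosses the pole at 0, which yields the first term of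
  the series. Since the kernel is periodic up to a phase, the integral on the new line is the one
  with shift a + 1 on the old line.\<close>

lemma lerch_int_rec:
  assumes a: "a + c > 0"
  shows "lerch_int c l a s = of_real a powr (-s) + exp (2 * pi * \<i> * l) * lerch_int c l (a + 1) s"
proof -
  define h where "h = (\<lambda>z. (z + of_real a) powr (-s) * lerch_kernel l z)"
  have shift: "h (Complex (c + 1) y) = exp (2 * pi * \<i> * l) * (Complex (a + 1 + c) y powr (-s) * lerch_kernel l (Complex c y))" for y
  proof -
    have "Complex (c + 1) y = Complex c y + 1" "Complex (c + 1) y + of_real a = Complex (a + 1 + c) y"
      by (auto simp: complex_eq_iff)
    thus ?thesis by (simp add: h_def lerch_kernel_add_1)
  qed
  have noshift: "h (Complex c y) = Complex (a + c) y powr (-s) * lerch_kernel l (Complex c y)" for y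
    by (simp add: h_def Complex_eq algebra_simps)
  \<comment> \<open>To the right of - a the power is holomorphic, and between -1 and 1 the kernel
    has no pole but 0.\<close>
  define S where "S = {z. max (-1) (-a) < Re z \<and> Re z < 1}"
  have S_eq: "S = {z. Re z > max (-1) (-a)} \<inter> {z. Re z < 1}" by (auto simp: S_def)
  have S: "open S" "connected S" "0 \<in> S"
  proof -
    show "open S" unfolding S_eq by (intro open_Int open_halfspace_Re_gt open_halfspace_Re_lt)
    show "connected S" unfolding S_eq
      by (intro convex_connected convex_Int convex_halfspace_Re_gt convex_halfspace_Re_lt)
    show "0 \<in> S" using a c by (simp add: S_def)
  qed
  have nz: "1 - exp (2 * pi * \<i> * z) \<noteq> 0" if "z \<in> S - {0}" for z
  proof
    assume "1 - exp (2 * pi * \<i> * z) = 0"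
    then obtain n :: int where n: "Re (2 * pi * \<i> * z) = 0" "Im (2 * pi * \<i> * z) = of_int (2 * n) * pi"
      by (auto simp: exp_eq_1)
    hence "Im z = 0" "Re z = of_int n" by auto
    moreover from this that have "-1 < real_of_int n" "real_of_int n < 1" by (auto simp: S_def)
    hence "n = 0" by linarith
    ultimately show False using that by (auto simp: complex_eq_iff)
  qed
  have fholo: "(\<lambda>z. (z + of_real a) powr (-s) * exp (2 * pi * \<i> * l * z)) holomorphic_on S"
    by (intro holomorphic_intros) (auto simp: S_def complex_nonpos_Reals_iff)
  have gholo: "(\<lambda>z. 1 - exp (2 * pi * \<i> * z)) holomorphic_on A" for A
    by (intro holomorphic_intros)
  have h_eq: "h = (\<lambda>z. (z + of_real a) powr (-s) * exp (2 * pi * \<i> * l * z) / (1 - exp (2 * pi * \<i> * z)))"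
    by (simp add: h_def lerch_kernel_def fun_eq_iff)
  have a0: "a > 0" using a c by linarith
  have res: "residue h 0 = of_real a powr (-s) / (- (2 * pi * \<i>))"
  proof -
    have d: "((\<lambda>z. 1 - exp (2 * pi * \<i> * z)) has_field_derivative - (2 * pi * \<i>)) (at 0)"
      by (auto intro!: derivative_eq_intros)
    show ?thesis
      unfolding h_eq using residue_simple_pole_deriv[OF fholo gholo S d] a0 by simp
  qed
  have "(LINT y|lborel. h (Complex (c + 1) y)) - (LINT y|lborel. h (Complex c y)) = 2 * pi * residue h 0"
  proof (rule strip_residue)
    show "max (-1) (-a) < c" "c < Re 0" "Re 0 < c + 1" "c + 1 < 1" using a c by auto
    show "h holomorphic_on {z. max (-1) (-a) < Re z \<and> Re z < 1} - {0}"
      unfolding S_def[symmetric] h_eq using nz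
      by (intro holomorphic_on_divide gholo holomorphic_on_subset[OF fholo]) auto
    show "integrable lborel (\<lambda>y. h (Complex c y))"
      unfolding noshift using a by (intro integrable_lerch_integrand)
    show "integrable lborel (\<lambda>y. h (Complex (c + 1) y))"
      unfolding shift using a by (intro integrable_mult_right integrable_lerch_integrand) auto
    show "norm (h (Complex x y)) \<le> (\<lambda>T. 2 * exp (pi / 2 * \<bar>Im s\<bar>) * T powr (- Re s)) \<bar>y\<bar>"
      if "c \<le> x" "x \<le> c + 1" "\<bar>y\<bar> \<ge> 1" for x y
    proof -
      let ?w = "Complex x y + of_real a"
      have "\<bar>y\<bar> \<le> norm ?w" using abs_Im_le_cmod[of ?w] by simp
      have "norm (?w powr (-s)) \<le> norm ?w powr (- Re s) * exp (pi / 2 * \<bar>Im s\<bar>)"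
        using a that by (intro norm_powr_le_half_plane) auto
      also have "\<dots> \<le> \<bar>y\<bar> powr (- Re s) * exp (pi / 2 * \<bar>Im s\<bar>)"
        using that s \<open>\<bar>y\<bar> \<le> norm ?w\<close> by (intro mult_right_mono powr_mono2') auto
      finally have "norm (?w powr (-s)) * norm (lerch_kernel l (Complex x y)) \<le> \<bar>y\<bar> powr (- Re s) * exp (pi / 2 * \<bar>Im s\<bar>) * 2"
        using that l by (intro mult_mono norm_lerch_kernel_le_2) auto
      thus ?thesis by (simp add: h_def norm_mult mult_ac)
    qed
    show "((\<lambda>T. 2 * exp (pi / 2 * \<bar>Im s\<bar>) * T powr (- Re s)) \<longlongrightarrow> 0) at_top"
      using s by real_asymp
  qed
  hence "\<i> * ((LINT y|lborel. h (Complex (c + 1) y)) - (LINT y|lborel. h (Complex c y))) = \<i> * (2 * pi * residue h 0)"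
    by simp
  hence "exp (2 * pi * \<i> * l) * lerch_int c l (a + 1) s - lerch_int c l a s = \<i> * (2 * pi * residue h 0)"
    unfolding shift noshift lerch_int_def integral_mult_right_zero right_diff_distrib
    by (simp only: mult.left_commute)
  also have "\<dots> = - (of_real a powr (-s))"
    by (simp add: res)
  finally show ?thesis by (simp add: algebra_simps)
qed

lemma lerch_int_tail: 
  assumes a: "a + c > 0"
  shows "(\<lambda>N. lerch_int c l (a + real N) s) \<longlonglongrightarrow> 0"
proof -
  have "(\<lambda>N. LINT y|lborel. Complex (a + real N + c) y powr (-s) * lerch_kernel l (Complex c y)) 
        \<longlonglongrightarrow> integral\<^sup>L lborel (\<lambda>y::real. 0::complex)"
  proof (rule integral_dominated_convergence[where w = "lerch_dom (a + c)"])
    show "integrable lborel (lerch_dom (a + c))"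
      using a by (rule integrable_lerch_dom)
    show "AE y in lborel. norm (Complex (a + real N + c) y powr (-s) * lerch_kernel l (Complex c y)) \<le> lerch_dom (a + c) y" for N
      using a by (intro AE_I2 norm_lerch_integrand_le) auto
    show "AE y in lborel. (\<lambda>N. Complex (a + real N + c) y powr (-s) * lerch_kernel l (Complex c y)) \<longlonglongrightarrow> 0"
    proof (rule AE_I2, rule Lim_null_comparison)
      fix y
      show "\<forall>\<^sub>F N in sequentially. norm (Complex (a + real N + c) y powr (-s) * lerch_kernel l (Complex c y)) \<le> lerch_dom (a + c + real N) y"
        using a by (intro always_eventually allI norm_lerch_integrand_le) auto
      have "(\<lambda>N. ((a + c + real N + \<bar>y\<bar>) / 2) powr (- Re s)) \<longlonglongrightarrow> 0"
        using s by real_asymp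
      from tendsto_mult_left_zero[OF this, of "exp (pi / 2 * \<bar>Im s\<bar>) / \<bar>sin (pi * c)\<bar>"]
      show "(\<lambda>N. lerch_dom (a + c + real N) y) \<longlonglongrightarrow> 0"
        by (simp add: lerch_dom_def)
    qed
    show "(\<lambda>y. Complex (a + real N + c) y powr (-s) * lerch_kernel l (Complex c y)) \<in> borel_measurable lborel" for N
      by measurable
  qed simp
  from tendsto_mult[OF tendsto_const[of \<i>] this] show ?thesis
    by (simp add: lerch_int_def)
qed

lemma lerch_int_rec_iter:
  assumes a: "a + c > 0"
  shows "lerch_int c l a s = (\<Sum>m<N. cis (2 * pi * l * real m) / complex_of_real (real m + a) powr s)
    + cis (2 * pi * l * real N) * lerch_int c l (a + real N) s"
proof (induction N)
  case (Suc N)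
  have "a + real N + c > 0" using a by simp
  from lerch_int_rec[OF this] have "lerch_int c l (a + real N) s = 1 / of_real (real N + a) powr s 
     + cis (2 * pi * l) * lerch_int c l (a + real (Suc N)) s"
    by (simp add: powr_minus divide_inverse add_ac cis_conv_exp mult_ac)
  hence "lerch_int c l a s = (\<Sum>m<Suc N. cis (2 * pi * l * real m) / complex_of_real (real m + a) powr s) + cis (2 * pi * l * real N) * cis (2 * pi * l) * lerch_int c l (a + real (Suc N)) s"
    using Suc by (simp add: algebra_simps)
  also have "cis (2 * pi * l * real N) * cis (2 * pi * l) = cis (2 * pi * l * real (Suc N))"
    by (simp add: cis_mult algebra_simps)
  finally show ?case .
qed auto

text \<open>Includes l = 1, where convergence of the integral rests on \<open>Re s > 1\<close> and
  not on decay of the kernel.\<close>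

lemma lerch_sums_lerch_int:
  assumes a: "a + c > 0"
  shows "(\<lambda>m. cis (2 * pi * l * real m) / complex_of_real (real m + a) powr s) sums lerch_int c l a s"
proof -
  let ?t = "\<lambda>m. cis (2 * pi * l * real m) / complex_of_real (real m + a) powr s"
  have "(\<lambda>N. cis (2 * pi * l * real N) * lerch_int c l (a + real N) s) \<longlonglongrightarrow> 0"
    by (rule tendsto_norm_zero_cancel) (use tendsto_norm_zero[OF lerch_int_tail[OF a]] in \<open>simp add: norm_mult\<close>)
  from tendsto_diff[OF tendsto_const this]
  have "(\<lambda>N. lerch_int c l a s - cis (2 * pi * l * real N) * lerch_int c l (a + real N) s) \<longlonglongrightarrow> lerch_int c l a s"
    by simp
  moreover have "(\<Sum>m<N. ?t m) = lerch_int c l a s - cis (2 * pi * l * real N) * lerch_int c l (a + real N) s" for N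
    using lerch_int_rec_iter[OF a, of N] by (simp only: add_diff_cancel)
  ultimately show ?thesis unfolding sums_def by (simp only:)
qed

lemma lerch_int_eq_series:
  assumes a: "a + c > 0"
  shows "lerch_int c l a s = lerch_series l a s"
  using sums_unique[OF lerch_sums_lerch_int[OF a]] by (simp add: lerch_series_def)

end

subsection \<open>Analytic continuation and growth\<close>

lemma one_plus_powr_le_exp:
  fixes B \<epsilon> :: real
  assumes "B \<ge> 0" "\<epsilon> > 0"
  obtains K where "K > 0" "\<And>x. x \<ge> 0 \<Longrightarrow> (1 + x) powr B \<le> K * exp (\<epsilon> * x)"
proof -
  \<comment> \<open>The estimate divides by the exponent and takes its logarithm, while
    \<open>B = 0\<close> is allowed; hence the increase by 1.\<close>
  define D where "D = B + 1"
  have D: "D > 0" "B \<le> D" using assms by (auto simp: D_def)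
  define K where "K = exp (D * ln (D / \<epsilon>) + \<epsilon>)"
  have "(1 + x) powr B \<le> K * exp (\<epsilon> * x)" if "x \<ge> 0" for x
  proof -
    have "(1 + x) powr B \<le> (1 + x) powr D" using that D by (intro powr_mono) auto
    also have "\<dots> = exp (D * ln (1 + x))" using that by (simp add: powr_def)
    also have "ln (1 + x) = ln (\<epsilon> * (1 + x) / D) + ln (D / \<epsilon>)"
      using that D assms by (simp add: ln_div ln_mult)
    also have "ln (\<epsilon> * (1 + x) / D) \<le> \<epsilon> * (1 + x) / D"
      using that D assms by (intro ln_bound) auto
    also have "D * (\<epsilon> * (1 + x) / D + ln (D / \<epsilon>)) = (D * ln (D / \<epsilon>) + \<epsilon>) + \<epsilon> * x"
      using D by (simp add: field_simps)
    finally show ?thesis using D by (simp add: K_def exp_add)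
  qed
  thus ?thesis using that[of K] by (simp add: K_def)
qed

text \<open>Logarithmic growth of Ln makes exp (B |Ln w|) polynomial in \<open>y\<close>, so the
  exponential decay of the kernel absorbs it for every B.\<close>

lemma norm_Ln_Complex_le:
  assumes "b > 0"
  shows "norm (Ln (Complex b y)) \<le> \<bar>ln b\<bar> + ln (1 + b) + pi / 2 + ln (1 + \<bar>y\<bar>)"
proof -
  let ?w = "Complex b y"
  have w: "norm ?w \<ge> b" "norm ?w \<le> b + \<bar>y\<bar>" "?w \<noteq> 0"
    using abs_Re_le_cmod[of ?w] norm_Complex_le[of b y] assms by (auto simp: complex_eq_iff)
  have "\<bar>ln (norm ?w)\<bar> \<le> \<bar>ln b\<bar> + ln (1 + b) + ln (1 + \<bar>y\<bar>)"
  proof (cases "norm ?w \<ge> 1")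
    case True
    have "ln (norm ?w) \<le> ln ((1 + b) * (1 + \<bar>y\<bar>))"
    proof (subst ln_le_cancel_iff)
      have "b + \<bar>y\<bar> \<le> (1 + b) * (1 + \<bar>y\<bar>)" using assms by (simp add: algebra_simps)
      thus "norm ?w \<le> (1 + b) * (1 + \<bar>y\<bar>)" using w by linarith
    qed (use w assms in \<open>auto intro!: mult_pos_pos add_pos_nonneg\<close>)
    also have "\<dots> = ln (1 + b) + ln (1 + \<bar>y\<bar>)" using assms by (simp add: ln_mult add_pos_nonneg)
    finally show ?thesis using True by simp
  next
    case False
    have "ln b \<le> ln (norm ?w)" using w assms by simp
    moreover have "ln (norm ?w) < 0" using False w by simp
    moreover have "ln (1 + b) \<ge> 0" "ln (1 + \<bar>y\<bar>) \<ge> 0" using assms by auto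
    ultimately show ?thesis by linarith
  qed
  moreover have "\<bar>Im (Ln ?w)\<bar> < pi / 2" using assms by (intro Re_Ln_pos_lt_imp) auto
  moreover have "norm (Ln ?w) \<le> \<bar>Re (Ln ?w)\<bar> + \<bar>Im (Ln ?w)\<bar>" by (rule cmod_le)
  ultimately show ?thesis using w by simp
qed

lemma powr_Complex_eq_exp:
  assumes "b > 0"
  shows "Complex b y powr (-s) = exp (s * (- Ln (Complex b y)))"
  using assms by (auto simp: powr_def complex_eq_iff)

lemma lerch_int_holomorphic:
  assumes c: "-1 < c" "c < 0" and l: "0 < l" "l < 1" and a: "a + c > 0"
  shows "lerch_int c l a holomorphic_on A"
proof -
  define \<mu> where "\<mu> = min l (1 - l)"
  have \<mu>: "\<mu> > 0" "\<mu> \<le> l" "\<mu> \<le> 1 - l" using l by (auto simp: \<mu>_def)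
  have "(\<lambda>s. LINT y|lborel. exp (s * (- Ln (Complex (a + c) y))) * lerch_kernel l (Complex c y)) holomorphic_on UNIV"
  proof (rule holomorphic_integral_exp)
    fix B :: real
    \<comment> \<open>The rate pi mu is half of the decay rate 2 pi mu of the kernel; the other half
      is left for integrability.\<close>
    obtain K where K: "K > 0" "\<And>x. x \<ge> 0 \<Longrightarrow> (1 + x) powr \<bar>B\<bar> \<le> K * exp (pi * \<mu> * x)"
      using one_plus_powr_le_exp[of "\<bar>B\<bar>" "pi * \<mu>"] \<mu> by auto
    define E where "E = exp (\<bar>B\<bar> * (\<bar>ln (a + c)\<bar> + ln (1 + (a + c)) + pi / 2))"
    show "integrable lborel (\<lambda>y. exp (B * norm (- Ln (Complex (a + c) y))) * norm (lerch_kernel l (Complex c y)))"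
    proof (rule Bochner_Integration.integrable_bound)
      show "integrable lborel (\<lambda>y. E * K / \<bar>sin (pi * c)\<bar> * exp (- (pi * \<mu>) * \<bar>y\<bar>))"
        using \<mu> by (intro integrable_mult_right integrable_exp_neg_abs) auto
      show "AE y in lborel. norm (exp (B * norm (- Ln (Complex (a + c) y))) * norm (lerch_kernel l (Complex c y)))
         \<le> norm (E * K / \<bar>sin (pi * c)\<bar> * exp (- (pi * \<mu>) * \<bar>y\<bar>))"
      proof (rule AE_I2)
        fix y :: real
        have "B * norm (- Ln (Complex (a + c) y)) \<le> \<bar>B\<bar> * norm (Ln (Complex (a + c) y))"
          by (simp add: mult_right_mono)
        also have "\<dots> \<le> \<bar>B\<bar> * (\<bar>ln (a + c)\<bar> + ln (1 + (a + c)) + pi / 2 + ln (1 + \<bar>y\<bar>))"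
          using norm_Ln_Complex_le[OF a] by (intro mult_left_mono) auto
        finally have "exp (B * norm (- Ln (Complex (a + c) y))) \<le> exp (\<bar>B\<bar> * (\<bar>ln (a + c)\<bar> + ln (1 + (a + c)) + pi / 2 + ln (1 + \<bar>y\<bar>)))"
          by simp
        also have "\<dots> = E * (1 + \<bar>y\<bar>) powr \<bar>B\<bar>"
          by (simp add: E_def powr_def exp_add distrib_left)
        also have "\<dots> \<le> E * (K * exp (pi * \<mu> * \<bar>y\<bar>))"
          using K(2)[of "\<bar>y\<bar>"] by (intro mult_left_mono) (auto simp: E_def)
        finally have "exp (B * norm (- Ln (Complex (a + c) y))) * norm (lerch_kernel l (Complex c y)) \<le> 
            E * (K * exp (pi * \<mu> * \<bar>y\<bar>)) * (exp (- 2 * pi * \<mu> * \<bar>y\<bar>) / \<bar>sin (pi * c)\<bar>)"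
          using norm_lerch_kernel_le_exp[OF sin_pi_nonzero[OF c] \<mu>(2,3), of y] K
          by (intro mult_mono) (auto simp: E_def)
        also have "\<dots> = E * K / \<bar>sin (pi * c)\<bar> * (exp (pi * \<mu> * \<bar>y\<bar>) * exp (- 2 * pi * \<mu> * \<bar>y\<bar>))"
          by simp
        also have "exp (pi * \<mu> * \<bar>y\<bar>) * exp (- 2 * pi * \<mu> * \<bar>y\<bar>) = exp (- (pi * \<mu>) * \<bar>y\<bar>)"
          by (simp flip: exp_add)
        finally show "norm (exp (B * norm (- Ln (Complex (a + c) y))) * norm (lerch_kernel l (Complex c y)))
           \<le> norm (E * K / \<bar>sin (pi * c)\<bar> * exp (- (pi * \<mu>) * \<bar>y\<bar>))"
          using K by (simp add: E_def abs_mult)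
      qed
    qed measurable
  qed measurable
  hence "(\<lambda>s. \<i> * (LINT y|lborel. exp (s * (- Ln (Complex (a + c) y))) * lerch_kernel l (Complex c y))) holomorphic_on UNIV"
    by (intro holomorphic_intros)
  hence "lerch_int c l a holomorphic_on UNIV"
    using a by (simp add: lerch_int_def[abs_def] powr_Complex_eq_exp)
  thus ?thesis by (rule holomorphic_on_subset) auto
qed

lemma eq_of_eq_on_right_half_plane:
  assumes "f holomorphic_on UNIV" "g holomorphic_on UNIV" "\<And>s. Re s > 1 \<Longrightarrow> f s = g s"
  shows "f s = g s"
proof (rule analytic_continuation_open[of "{s. Re s > 1}" UNIV f g])
  show "open {s::complex. Re s > 1}" by (rule open_halfspace_Re_gt)
  show "{s::complex. Re s > 1} \<noteq> {}" by (auto intro!: exI[of _ 2])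
qed (use assms in auto)

text \<open>Both sides are entire and agree for Re s > 1. Outside the half plane of convergence this
  still expresses the continuation by a finite sum and an integral whose shift is at choice.\<close>

lemma lerch_int_rec_iter_everywhere:
  assumes c: "-1 < c" "c < 0" and l: "0 < l" "l < 1" and a: "a + c > 0"
  shows "lerch_int c l a s = (\<Sum>m<N. cis (2 * pi * l * real m) / complex_of_real (real m + a) powr s)
    + cis (2 * pi * l * real N) * lerch_int c l (a + real N) s"
proof -
  let ?g = "\<lambda>s. (\<Sum>m<N. cis (2 * pi * l * real m) / complex_of_real (real m + a) powr s)
    + cis (2 * pi * l * real N) * lerch_int c l (a + real N) s"
  have nz: "complex_of_real (real m + a) \<noteq> 0" for m
    using a c by (simp only: of_real_eq_0_iff)
  have "?g holomorphic_on UNIV"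
    by (intro holomorphic_intros lerch_int_holomorphic) (use a c l nz in \<open>auto simp del: of_real_add\<close>)
  from eq_of_eq_on_right_half_plane[OF lerch_int_holomorphic[OF assms] this]
  show ?thesis using lerch_int_rec_iter[OF c _ _ _ a] l by simp
qed

lemma is_lerch_continuation_lerch_int:
  assumes c: "-1 < c" "c < 0" and l: "0 < l" "l < 1" and a: "a + c > 0"
  shows "is_lerch_continuation l a (lerch_int c l a)"
proof -
  have "lerch_int c l a analytic_on UNIV"
    using lerch_int_holomorphic[OF assms] by (simp add: analytic_on_open)
  hence "lerch_int c l a analytic_on {1}" by (rule analytic_on_subset) auto
  thus ?thesis
    using lerch_int_holomorphic[OF assms] lerch_int_eq_series[OF c _ _ _ a] l
    by (simp add: is_lerch_continuation_def)
qed

lemma lerch_eqI: "is_lerch_continuation l a f \<Longrightarrow> lerch l a = f"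
  unfolding lerch_def using is_lerch_continuation_unique by (intro the_equality) auto

text \<open>The left side does not mention \<open>c\<close>, so the line may be moved freely within
  (-1, 0) to the right of - a.\<close>

lemma lerch_eq_lerch_int:
  assumes c: "-1 < c" "c < 0" and l: "0 < l" "l < 1" and a: "a + c > 0"
  shows "lerch l a = lerch_int c l a"
  by (intro lerch_eqI is_lerch_continuation_lerch_int assms)

lemma lerch_holomorphic:
  assumes "0 < l" "l < 1" "0 < a" 
  shows "lerch l a holomorphic_on A"
proof -
  define c where "c = - min a 1 / 2"
  have c: "-1 < c" "c < 0" "a + c > 0" using assms by (auto simp: c_def)
  show ?thesis using assms c by (simp add: lerch_eq_lerch_int[of c] lerch_int_holomorphic)
qed

lemma lerch_eq_series:
  assumes "0 < l" "l < 1" "0 < a" "Re s > 1"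
  shows "lerch l a s = lerch_series l a s"
proof -
  define c where "c = - min a 1 / 2"
  have c: "-1 < c" "c < 0" "a + c > 0" using assms by (auto simp: c_def)
  show ?thesis using assms c by (simp add: lerch_eq_lerch_int[of c] lerch_int_eq_series)
qed

section \<open>Polynomial growth in vertical strips\<close>

lemma abs_Arg_le:
  assumes "b > 0"
  shows "\<bar>Arg (Complex b y)\<bar> \<le> \<bar>y\<bar> / b"
  using assms arctan_le_self[of "\<bar>y / b\<bar>"] by (simp add: arg_conv_arctan abs_arctan)

text \<open>In general the argument costs a factor exponential in |Im s|. Once a + c is of the order
  of |Im s|, the bound |Arg| <= |y| / (a + c) turns it into exp (pi mu |y| / 2), which the kernel
  absorbs.\<close>

lemma lerch_int_tail_bound:
  assumes c: "-1 < c" "c < 0" and l: "0 < l" "l < 1" and B: "B \<ge> 0"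
  defines "\<mu> \<equiv> min l (1 - l)"
  obtains K where "K > 0" "\<And>a s. a + c \<ge> 1 \<Longrightarrow> 2 * \<bar>Im s\<bar> \<le> pi * \<mu> * (a + c) \<Longrightarrow> \<bar>Re s\<bar> \<le> B \<Longrightarrow>
     norm (lerch_int c l a s) \<le> K * (a + c) powr B"
proof -
  have \<mu>: "\<mu> > 0" "\<mu> \<le> l" "\<mu> \<le> 1 - l" using l by (auto simp: \<mu>_def)
  \<comment> \<open>Of the decay rate 2 pi mu, pi mu / 2 is spent here on the power and pi mu / 2
    below on the argument; pi mu is left for \<open>J\<close>.\<close>
  obtain C where C: "C > 0" "\<And>x. x \<ge> 0 \<Longrightarrow> (1 + x) powr B \<le> C * exp (pi * \<mu> / 2 * x)"
    using one_plus_powr_le_exp[of B "pi * \<mu> / 2"] \<mu> B by auto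
  define J where "J = (LINT y|lborel. exp (- (pi * \<mu>) * \<bar>y\<bar>))"
  have J: "J \<ge> 0" unfolding J_def by (intro integral_nonneg_AE) auto
  have sp: "\<bar>sin (pi * c)\<bar> > 0" using sin_pi_nonzero[OF c] by simp
  have "norm (lerch_int c l a s) \<le> (C / \<bar>sin (pi * c)\<bar> * (J + 1)) * (a + c) powr B"
    if as: "a + c \<ge> 1" "2 * \<bar>Im s\<bar> \<le> pi * \<mu> * (a + c)" "\<bar>Re s\<bar> \<le> B" for a s
  proof -
    define b where "b = a + c"
    have b: "b \<ge> 1" "b > 0" using as by (auto simp: b_def)
    have bd: "norm (Complex b y powr (-s) * lerch_kernel l (Complex c y)) \<le> 
       b powr B * C / \<bar>sin (pi * c)\<bar> * exp (- (pi * \<mu>) * \<bar>y\<bar>)" for y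
    proof -
      let ?w = "Complex b y"
      have w: "norm ?w \<ge> 1" "norm ?w \<le> b * (1 + \<bar>y\<bar>)"
      proof -
        show "norm ?w \<ge> 1" using abs_Re_le_cmod[of ?w] b by simp
        have "b + \<bar>y\<bar> \<le> b * (1 + \<bar>y\<bar>)" using b by (simp add: algebra_simps mult_le_cancel_right1)
        thus "norm ?w \<le> b * (1 + \<bar>y\<bar>)" using norm_Complex_le[of b y] b by linarith
      qed
      have "norm ?w powr (- Re s) \<le> norm ?w powr B"
        using w as by (intro powr_mono) auto
      also have "\<dots> \<le> (b * (1 + \<bar>y\<bar>)) powr B"
        using w B by (intro powr_mono2) auto
      also have "\<dots> = b powr B * (1 + \<bar>y\<bar>) powr B"
        using b by (simp add: powr_mult)
      also have "\<dots> \<le> b powr B * (C * exp (pi * \<mu> / 2 * \<bar>y\<bar>))"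
        using C by (intro mult_left_mono) auto
      finally have 1: "norm ?w powr (- Re s) \<le> b powr B * (C * exp (pi * \<mu> / 2 * \<bar>y\<bar>))" .
      have "Im s * Arg ?w \<le> \<bar>Im s\<bar> * \<bar>Arg ?w\<bar>"
        by (metis abs_ge_self abs_mult)
      also have "\<dots> \<le> (pi * \<mu> * b / 2) * (\<bar>y\<bar> / b)"
        using abs_Arg_le[OF b(2), of y] as b \<mu> by (intro mult_mono) (auto simp: b_def)
      also have "\<dots> = pi * \<mu> / 2 * \<bar>y\<bar>" using b by simp
      finally have 2: "exp (Im s * Arg ?w) \<le> exp (pi * \<mu> / 2 * \<bar>y\<bar>)" by simp
      have "norm (?w powr (-s) * lerch_kernel l (Complex c y)) = norm ?w powr (- Re s) * exp (Im s * Arg ?w) * norm (lerch_kernel l (Complex c y))"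
        by (simp add: norm_mult norm_powr_complex)
      also have "\<dots> \<le> (b powr B * (C * exp (pi * \<mu> / 2 * \<bar>y\<bar>))) * exp (pi * \<mu> / 2 * \<bar>y\<bar>) * (exp (- 2 * pi * \<mu> * \<bar>y\<bar>) / \<bar>sin (pi * c)\<bar>)"
        using C by (intro mult_mono 1 2 norm_lerch_kernel_le_exp sin_pi_nonzero c \<mu>) auto
      also have "\<dots> = b powr B * C / \<bar>sin (pi * c)\<bar> * (exp (pi * \<mu> / 2 * \<bar>y\<bar>) * exp (pi * \<mu> / 2 * \<bar>y\<bar>) * exp (- 2 * pi * \<mu> * \<bar>y\<bar>))"
        by simp
      also have "exp (pi * \<mu> / 2 * \<bar>y\<bar>) * exp (pi * \<mu> / 2 * \<bar>y\<bar>) * exp (- 2 * pi * \<mu> * \<bar>y\<bar>) = exp (- (pi * \<mu>) * \<bar>y\<bar>)"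
        by (simp flip: exp_add add: field_simps)
      finally show ?thesis .
    qed
    have "norm (lerch_int c l a s) = norm (LINT y|lborel. Complex b y powr (-s) * lerch_kernel l (Complex c y))"
      by (simp add: lerch_int_def norm_mult b_def)
    also have "\<dots> \<le> (LINT y|lborel. b powr B * C / \<bar>sin (pi * c)\<bar> * exp (- (pi * \<mu>) * \<bar>y\<bar>))"
    proof (rule Bochner_Integration.integral_norm_bound_integral)
      show int: "integrable lborel (\<lambda>y. b powr B * C / \<bar>sin (pi * c)\<bar> * exp (- (pi * \<mu>) * \<bar>y\<bar>))"
        using \<mu> by (intro integrable_mult_right integrable_exp_neg_abs) auto
      show "integrable lborel (\<lambda>y. Complex b y powr (-s) * lerch_kernel l (Complex c y))"
      proof (rule Bochner_Integration.integrable_bound[OF int])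
        show "(\<lambda>y. Complex b y powr (-s) * lerch_kernel l (Complex c y)) \<in> borel_measurable lborel" by measurable
        show "AE y in lborel. norm (Complex b y powr (-s) * lerch_kernel l (Complex c y)) \<le> norm (b powr B * C / \<bar>sin (pi * c)\<bar> * exp (- (pi * \<mu>) * \<bar>y\<bar>))"
          using bd C sp by (intro AE_I2) (simp add: abs_mult)
      qed
    qed (rule bd)
    also have "\<dots> = b powr B * C / \<bar>sin (pi * c)\<bar> * J" by (simp add: J_def)
    also have "\<dots> \<le> b powr B * C / \<bar>sin (pi * c)\<bar> * (J + 1)"
      using C sp by (intro mult_left_mono) auto
    finally show ?thesis by (simp add: b_def mult_ac)
  qed
  moreover have "C / \<bar>sin (pi * c)\<bar> * (J + 1) > 0"
    using C sp J by (intro mult_pos_pos divide_pos_pos) auto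
  ultimately show ?thesis using that by blast
qed

text \<open>Splitting off a number of terms proportional to |Im s| makes the remaining shift large
  enough for the tail bound. Each term is of order at most |Im s| powr B, whence the exponent B +
  1.\<close>

lemma lerch_growth:
  assumes l: "0 < l" "l < 1" and a: "0 < a" and B: "B \<ge> 0"
  obtains K where "K > 0" "\<And>s. \<bar>Re s\<bar> \<le> B \<Longrightarrow> \<bar>Im s\<bar> \<ge> 1 \<Longrightarrow> norm (lerch l a s) \<le> K * \<bar>Im s\<bar> powr (B + 1)"
proof -
  define c where "c = - min a 1 / 2"
  have c: "-1 < c" "c < 0" and ac: "a + c > 0" using a by (auto simp: c_def)
  define \<mu> where "\<mu> = min l (1 - l)"
  have \<mu>: "\<mu> > 0" using l by (auto simp: \<mu>_def)
  obtain K0 where K0: "K0 > 0" "\<And>a s. a + c \<ge> 1 \<Longrightarrow> 2 * \<bar>Im s\<bar> \<le> pi * \<mu> * (a + c) \<Longrightarrow> \<bar>Re s\<bar> \<le> B \<Longrightarrow>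
     norm (lerch_int c l a s) \<le> K0 * (a + c) powr B"
    using lerch_int_tail_bound[OF c l B] unfolding \<mu>_def by metis
  define D where "D = 2 / (pi * \<mu>) + 3 + a"
  have D: "D > 0" "D \<ge> a" "D \<ge> 1" using a \<mu> by (auto simp: D_def intro!: add_pos_pos add_nonneg_nonneg)
  define K where "K = D * (D powr B + a powr (-B)) + K0 * D powr B"
  have "norm (lerch l a s) \<le> K * \<bar>Im s\<bar> powr (B + 1)" if s: "\<bar>Re s\<bar> \<le> B" "\<bar>Im s\<bar> \<ge> 1" for s
  proof -
    define t where "t = \<bar>Im s\<bar>"
    have t: "t \<ge> 1" using s by (simp add: t_def)
    \<comment> \<open>Large enough for the tail bound at shift \<open>a + real N\<close>; the extra
      2 compensates \<open>c > -1\<close> and makes the real part at least 1.\<close>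
    define N where "N = nat \<lceil>2 * t / (pi * \<mu>)\<rceil> + 2"
    have N1: "2 * t / (pi * \<mu>) + 2 \<le> real N" unfolding N_def by linarith
    have N2: "real N \<le> 2 * t / (pi * \<mu>) + 3"
    proof -
      have "2 * t / (pi * \<mu>) \<ge> 0" using t \<mu> by simp
      thus ?thesis unfolding N_def by linarith
    qed
    have "2 * t / (pi * \<mu>) + 3 + a \<le> D * t"
    proof -
      have "3 + a \<le> (3 + a) * t" using t a by (simp add: mult_le_cancel_left1)
      thus ?thesis by (simp add: D_def algebra_simps)
    qed
    with N2 have N3: "real N + a \<le> D * t" by linarith
    have tail: "norm (lerch_int c l (a + real N) s) \<le> K0 * (D * t) powr B"
    proof -
      have "norm (lerch_int c l (a + real N) s) \<le> K0 * (a + real N + c) powr B"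
      proof (rule K0(2))
        have "2 * t / (pi * \<mu>) \<ge> 0" using t \<mu> by simp
        thus "1 \<le> a + real N + c" using N1 c a by linarith
        have "2 * t / (pi * \<mu>) \<le> a + real N + c" using N1 c a by linarith
        thus "2 * \<bar>Im s\<bar> \<le> pi * \<mu> * (a + real N + c)" using \<mu> by (simp add: t_def field_simps)
      qed (use s in auto)
      also have "\<dots> \<le> K0 * (D * t) powr B"
        using N3 c ac B K0 by (intro mult_left_mono powr_mono2) auto
      finally show ?thesis .
    qed
    have "norm (\<Sum>m<N. cis (2 * pi * l * real m) / complex_of_real (real m + a) powr s) \<le> 
        (\<Sum>m<N. (D * t) powr B + a powr (-B))"
    proof (rule sum_norm_le)
      fix m assume "m \<in> {..<N}"
      hence m: "real m + a \<le> D * t" "real m + a \<ge> a" using N3 by auto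
      have "norm (complex_of_real (real m + a) powr s) = (real m + a) powr Re s"
        using norm_powr_real_powr[of "complex_of_real (real m + a)" s] a by (simp del: of_real_add)
      hence "norm (cis (2 * pi * l * real m) / complex_of_real (real m + a) powr s) = (real m + a) powr (- Re s)"
        by (simp add: norm_divide norm_mult norm_inverse powr_minus divide_inverse del: of_real_add)
      also have "\<dots> \<le> (D * t) powr B + a powr (-B)"
      \<comment> \<open>A base below 1 can occur for small \<open>a\<close>; there the most negative
        exponent, \<open>- B\<close>, gives the largest power.\<close>
      proof (cases "real m + a \<ge> 1")
        case True
        hence "(real m + a) powr (- Re s) \<le> (real m + a) powr B" using s by (intro powr_mono) auto
        also have "\<dots> \<le> (D * t) powr B" using m a B by (intro powr_mono2) auto
        finally show ?thesis by (simp add: add_increasing2)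
      next
        case False
        hence "(real m + a) powr (- Re s) \<le> (real m + a) powr (-B)" using s a by (intro powr_mono') auto
        also have "\<dots> \<le> a powr (-B)" using m a B by (intro powr_mono2') auto
        finally show ?thesis by (simp add: add_increasing)
      qed
      finally show "norm (cis (2 * pi * l * real m) / complex_of_real (real m + a) powr s) \<le> (D * t) powr B + a powr (-B)" .
    qed
    also have "\<dots> = real N * ((D * t) powr B + a powr (-B))" by simp
    also have "\<dots> \<le> (D * t) * (D powr B * t powr B + a powr (-B) * t powr B)"
    proof (intro mult_mono add_mono)
      have "1 \<le> t powr B" using t B by (simp add: ge_one_powr_ge_zero)
      thus "a powr (-B) \<le> a powr (-B) * t powr B" by (simp add: mult_le_cancel_left1)
    qed (use N3 a D t in \<open>auto simp: powr_mult\<close>)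
    finally have head: "norm (\<Sum>m<N. cis (2 * pi * l * real m) / complex_of_real (real m + a) powr s) \<le> 
       D * (D powr B + a powr (-B)) * t powr (B + 1)"
      using t by (simp add: powr_add algebra_simps)
    have "K0 * (D * t) powr B \<le> K0 * D powr B * t powr (B + 1)"
    proof -
      have "t powr B \<le> t powr (B + 1)" using t by (intro powr_mono) auto
      thus ?thesis using K0 D t by (simp add: powr_mult mult_left_mono)
    qed
    with tail have tail': "norm (lerch_int c l (a + real N) s) \<le> K0 * D powr B * t powr (B + 1)" by linarith
    have "norm (lerch l a s) = norm ((\<Sum>m<N. cis (2 * pi * l * real m) / complex_of_real (real m + a) powr s)
       + cis (2 * pi * l * real N) * lerch_int c l (a + real N) s)"
      by (simp only: lerch_eq_lerch_int[OF c l ac] lerch_int_rec_iter_everywhere[OF c l ac, of s N])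
    also have "\<dots> \<le> norm (\<Sum>m<N. cis (2 * pi * l * real m) / complex_of_real (real m + a) powr s)
       + norm (lerch_int c l (a + real N) s)"
      by (rule order.trans[OF norm_triangle_ineq]) (simp add: norm_mult)
    also have "\<dots> \<le> K * t powr (B + 1)"
      using head tail' by (simp add: K_def distrib_right)
    finally show ?thesis by (simp add: t_def)
  qed
  moreover have "K > 0" using D K0 a by (auto simp: K_def intro!: add_pos_pos mult_pos_pos)
  ultimately show ?thesis using that by blast
qed

subsection \<open>The functional equation\<close>

definition gamma_integrand :: "real \<Rightarrow> complex \<Rightarrow> real \<Rightarrow> complex" where
  "gamma_integrand b z x = indicator {0<..} x *\<^sub>R (of_real x powr (z - 1) * of_real (exp (- b * x)))"

lemma measurable_gamma_integrand [measurable]: "gamma_integrand b z \<in> borel_measurable borel"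
  unfolding gamma_integrand_def[abs_def] powr_def by measurable

lemma has_bochner_integral_gamma_integrand_1:
  assumes z: "Re z > 0"
  shows "has_bochner_integral lborel (gamma_integrand 1 z) (Gamma z)"
proof -
  let ?f = "\<lambda>t. complex_of_real t powr (z - 1) / of_real (exp t)"
  have eq: "gamma_integrand 1 z = (\<lambda>x. indicator {0<..} x *\<^sub>R ?f x)"
    by (simp add: fun_eq_iff gamma_integrand_def exp_minus divide_inverse)
  have "integrable lebesgue (gamma_integrand 1 z)"
    using absolutely_integrable_Gamma_integral'[OF z] by (simp add: eq set_integrable_def)
  hence int: "integrable lborel (gamma_integrand 1 z)"
    by (simp add: integrable_completion)
  hence "set_integrable lborel {0<..} ?f" by (simp add: eq set_integrable_def)
  from set_borel_integral_eq_integral(2)[OF this]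
  have "integral\<^sup>L lborel (gamma_integrand 1 z) = integral {0<..} ?f"
    by (simp add: eq set_lebesgue_integral_def)
  also have "\<dots> = Gamma z"
    using Gamma_integral_complex'[OF z] by (rule integral_unique)
  finally show ?thesis using int by (simp add: has_bochner_integral_iff)
qed

lemma has_bochner_integral_gamma_integrand:
  assumes z: "Re z > 0" and b: "b > 0"
  shows "has_bochner_integral lborel (gamma_integrand b z) (Gamma z * of_real b powr (-z))"
proof -
  have eq: "gamma_integrand b z x = of_real b powr (1 - z) * gamma_integrand 1 z (0 + b * x)" for x
  proof (cases "x > 0")
    case True
    have "complex_of_real (b * x) powr (z - 1) = of_real b powr (z - 1) * of_real x powr (z - 1)"
      using True b by (simp add: powr_times_real)
    moreover have "of_real b powr (1 - z) * (of_real b powr (z - 1)) = (1 :: complex)"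
      using b by (simp flip: powr_add)
    ultimately show ?thesis using True b
      by (simp add: gamma_integrand_def indicator_def mult.assoc[symmetric] zero_less_mult_iff del: of_real_mult)
  next
    case False
    thus ?thesis using b by (simp add: gamma_integrand_def zero_less_mult_iff)
  qed
  have 1: "integrable lborel (gamma_integrand 1 z)" "integral\<^sup>L lborel (gamma_integrand 1 z) = Gamma z"
    using has_bochner_integral_gamma_integrand_1[OF z] by (auto simp: has_bochner_integral_iff)
  have "integrable lborel (\<lambda>x. gamma_integrand 1 z (0 + b * x))"
    using b 1 by (intro lborel_integrable_real_affine) auto
  hence int: "integrable lborel (gamma_integrand b z)"
    unfolding eq[abs_def] by (intro integrable_mult_right)
  have "Gamma z = \<bar>b\<bar> *\<^sub>R (LINT x|lborel. gamma_integrand 1 z (0 + b * x))"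
    using lborel_integral_real_affine[of b "gamma_integrand 1 z" 0] b 1 by simp
  hence "(LINT x|lborel. gamma_integrand 1 z (0 + b * x)) = Gamma z / of_real b"
    using b by (simp add: scaleR_conv_of_real field_simps)
  hence "integral\<^sup>L lborel (gamma_integrand b z) = of_real b powr (1 - z) * (Gamma z / of_real b)"
    unfolding eq[abs_def] by simp
  also have "\<dots> = Gamma z * of_real b powr (-z)"
    using b by (simp add: powr_diff powr_minus field_simps)
  finally show ?thesis using int by (simp add: has_bochner_integral_iff)
qed

text \<open>The absolute value is again such an integrand, with real exponent, so its integral
  follows from the complex formula.\<close>

lemma norm_gamma_integrand: "complex_of_real (norm (gamma_integrand b z x)) = gamma_integrand b (of_real (Re z)) x"
  using powr_of_real[of x "Re z - 1"]
  by (auto simp: gamma_integrand_def indicator_def norm_mult norm_powr_real_powr)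

lemma integral_norm_gamma_integrand:
  assumes z: "Re z > 0" and b: "b > 0"
  shows "(LINT x|lborel. norm (gamma_integrand b z x)) = norm (Gamma (complex_of_real (Re z))) * b powr (- Re z)"
proof -
  have "complex_of_real (LINT x|lborel. norm (gamma_integrand b z x)) = (LINT x|lborel. complex_of_real (norm (gamma_integrand b z x)))"
    by simp
  also have "\<dots> = Gamma (of_real (Re z)) * of_real b powr (- of_real (Re z))"
    unfolding norm_gamma_integrand using has_bochner_integral_gamma_integrand[of "of_real (Re z)" b] z b
    by (simp add: has_bochner_integral_iff)
  finally have "norm (complex_of_real (LINT x|lborel. norm (gamma_integrand b z x))) = norm (Gamma (complex_of_real (Re z))) * b powr (- Re z)"
    using b by (simp add: norm_mult norm_powr_real_powr)
  moreover have "(LINT x|lborel. norm (gamma_integrand b z x)) \<ge> 0" by simp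
  ultimately show ?thesis by (simp only: norm_of_real abs_of_nonneg)
qed

text \<open>The Bose-Einstein integrand with a phase, extended by 0 to the whole line. The phase
  parameter may be negative; the functional equation uses - a.\<close>

definition bose_integrand :: "real \<Rightarrow> real \<Rightarrow> complex \<Rightarrow> real \<Rightarrow> complex" where
  "bose_integrand \<mu> b z x = gamma_integrand b z x / (1 - cis (2 * pi * \<mu>) * of_real (exp (- x)))"

lemma summable_shifted_powr:
  fixes b p :: real
  assumes "b > 0" "p > 1"
  shows "summable (\<lambda>m. (real m + b) powr (-p))"
proof (rule summable_comparison_test')
  show "summable (\<lambda>m. real m powr (-p))" using assms by (simp add: summable_real_powr_iff)
  show "norm ((real m + b) powr (-p)) \<le> real m powr (-p)" if "m \<ge> 1" for m
    using that assms by (auto intro!: powr_mono2')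
qed

text \<open>Geometric expansion of the denominator gives Gamma integrals with scales m + b. Their L1
  norms are summable because Re z > 1, which justifies exchanging sum and integral.\<close>

lemma has_bochner_integral_bose_integrand:
  assumes z: "Re z > 1" and b: "b > 0"
  shows "has_bochner_integral lborel (bose_integrand \<mu> b z) (Gamma z * lerch_series \<mu> b z)"
proof -
  define f where "f = (\<lambda>m x. cis (2 * pi * \<mu> * real m) * gamma_integrand (real m + b) z x)"
  have f_int: "has_bochner_integral lborel (f m) (Gamma z * (cis (2 * pi * \<mu> * real m) / of_real (real m + b) powr z))" for m
  proof -
    have "has_bochner_integral lborel (\<lambda>x. cis (2 * pi * \<mu> * real m) * gamma_integrand (real m + b) z x) 
      (cis (2 * pi * \<mu> * real m) * (Gamma z * of_real (real m + b) powr (-z)))"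
      using z b by (intro has_bochner_integral_mult_right has_bochner_integral_gamma_integrand) auto
    thus ?thesis by (simp add: f_def powr_minus divide_inverse mult_ac del: of_real_add)
  qed
  have sums: "(\<lambda>m. f m x) sums bose_integrand \<mu> b z x" and abs: "summable (\<lambda>m. norm (f m x))" for x
  proof -
    define q where "q = cis (2 * pi * \<mu>) * of_real (exp (- x))"
    have f_eq: "f m x = gamma_integrand b z x * q ^ m" for m
    proof -
      have "exp (- (real m + b) * x) = exp (- b * x) * exp (- x) ^ m"
        by (simp flip: exp_add exp_of_nat_mult add: algebra_simps)
      moreover have "cis (2 * pi * \<mu> * real m) = cis (2 * pi * \<mu>) ^ m"
        unfolding Complex.DeMoivre by (simp add: mult_ac)
      ultimately show ?thesis
        by (simp add: f_def gamma_integrand_def q_def power_mult_distrib mult_ac)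
    qed
    have "(\<lambda>m. f m x) sums bose_integrand \<mu> b z x \<and> summable (\<lambda>m. norm (f m x))"
    proof (cases "x > 0")
      case True
      hence q: "norm q < 1" by (simp add: q_def norm_mult)
      have "(\<lambda>m. gamma_integrand b z x * q ^ m) sums (gamma_integrand b z x * (1 / (1 - q)))"
        using q by (intro sums_mult geometric_sums)
      moreover have "summable (\<lambda>m. norm (gamma_integrand b z x) * norm q ^ m)"
        using q by (intro summable_mult summable_geometric) auto
      ultimately show ?thesis by (simp add: f_eq bose_integrand_def q_def norm_mult norm_power)
    next
      case False
      thus ?thesis by (simp add: f_eq bose_integrand_def gamma_integrand_def)
    qed
    thus "(\<lambda>m. f m x) sums bose_integrand \<mu> b z x" "summable (\<lambda>m. norm (f m x))" by auto
  qed
  have norms: "summable (\<lambda>m. LINT x|lborel. norm (f m x))"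
  proof -
    have "(LINT x|lborel. norm (f m x)) = norm (Gamma (complex_of_real (Re z))) * (real m + b) powr (- Re z)" for m
      using integral_norm_gamma_integrand[of z "real m + b"] z b by (simp add: f_def norm_mult)
    thus ?thesis using summable_shifted_powr[OF b z] by (simp add: summable_mult)
  qed
  have int: "integrable lborel (f m)" for m using f_int by (simp add: has_bochner_integral_iff)
  have eq: "bose_integrand \<mu> b z = (\<lambda>x. \<Sum>m. f m x)"
    using sums by (simp add: fun_eq_iff sums_unique)
  have AE_abs: "AE x in lborel. summable (\<lambda>m. norm (f m x))"
    using abs by simp
  have "integrable lborel (bose_integrand \<mu> b z)"
    unfolding eq by (rule integrable_suminf[OF int AE_abs norms])
  moreover have "integral\<^sup>L lborel (bose_integrand \<mu> b z) = Gamma z * lerch_series \<mu> b z"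
  proof -
    have s1: "(\<lambda>m. integral\<^sup>L lborel (f m)) sums integral\<^sup>L lborel (bose_integrand \<mu> b z)"
      unfolding eq by (rule sums_integral[OF int AE_abs norms])
    have G: "Gamma z \<noteq> 0" using z by (auto simp: Gamma_eq_zero_iff elim!: nonpos_Ints_cases')
    have "(\<lambda>m. Gamma z * (cis (2 * pi * \<mu> * real m) / of_real (real m + b) powr z)) sums integral\<^sup>L lborel (bose_integrand \<mu> b z)"
      using s1 f_int by (simp add: has_bochner_integral_iff del: of_real_add)
    from sums_divide[OF this, of "Gamma z"] G
    have "(\<lambda>m. cis (2 * pi * \<mu> * real m) / of_real (real m + b) powr z) sums (integral\<^sup>L lborel (bose_integrand \<mu> b z) / Gamma z)"
      by (simp del: of_real_add)
    hence "lerch_series \<mu> b z = integral\<^sup>L lborel (bose_integrand \<mu> b z) / Gamma z"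
      unfolding lerch_series_def by (rule sums_unique[symmetric])
    thus ?thesis using G by simp
  qed
  ultimately show ?thesis by (simp add: has_bochner_integral_iff)
qed

text \<open>Jordan's inequality: concavity puts the sine above its chord from 0 to pi / 2, and
  symmetry covers the other half.\<close>

lemma sin_pi_ge:
  assumes "0 \<le> x" "x \<le> 1"
  shows "sin (pi * x) \<ge> 2 * min x (1 - x)"
proof -
  have *: "sin (pi * x) \<ge> 2 * x" if "0 \<le> x" "x \<le> 1 / 2" for x
  proof -
    have "concave_on {0..pi} sin"
      by (rule f''_le0_imp_concave[where f' = cos and f'' = "\<lambda>x. - sin x"])
         (auto intro!: derivative_eq_intros sin_ge_zero)
    from concave_onD[OF this, of "2 * x" 0 "pi / 2"] that
    show ?thesis by (simp add: mult.commute)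
  qed
  show ?thesis
  proof (cases "x \<le> 1 / 2")
    case True
    thus ?thesis using * assms by simp
  next
    case False
    have "sin (pi * x) = sin (pi * (1 - x))" by (simp add: right_diff_distrib sin_diff)
    thus ?thesis using *[of "1 - x"] False assms by simp
  qed
qed

text \<open>As \<open>b\<close> tends to 0 the line approaches Re z = - a, which for a = 1 runs
  through the pole at -1. There the kernel grows like the inverse of
  \<open>norm (Complex b y)\<close>; the product stays bounded uniformly in
  \<open>b\<close>.\<close>

lemma norm_lerch_kernel_near_pole:
  assumes a: "0 < a" "a \<le> 1" and b: "0 < b" "b \<le> a / 2" and l: "0 < l" "l < 1"
    and \<mu>: "0 \<le> \<mu>" "\<mu> \<le> l" "\<mu> \<le> 1 - l" "\<mu> \<le> 1" and y: "y \<noteq> 0"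
  shows "norm (Complex b y) * norm (lerch_kernel l (Complex (b - a) y)) \<le> 3 * exp (4 * pi) * (1 + \<bar>y\<bar>) * exp (- 2 * pi * \<mu> * \<bar>y\<bar>)"
proof (cases "\<bar>y\<bar> \<ge> 1")
  case True
  define q where "q = exp (- 2 * pi * y)"
  have q0: "q > 0" by (simp add: q_def)
  have half: "exp (-2 * pi * t) \<le> 1 / 3" if "t \<ge> 1" for t
  proof -
    have "2 * pi * 1 \<le> 2 * pi * t" using that by (intro mult_left_mono) auto
    hence "3 \<le> 1 + 2 * pi * t" using pi_gt3 by linarith
    also have "\<dots> \<le> exp (2 * pi * t)" using exp_ge_add_one_self by simp
    finally show ?thesis by (simp add: exp_minus field_simps)
  qed
  have "q \<le> 1 / 3 \<or> q \<ge> 3"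
    using half[of y] half[of "-y"] True by (auto simp: q_def exp_minus field_simps abs_if split: if_splits)
  hence q: "1 + q \<le> 2 * \<bar>1 - q\<bar>" by (auto simp: abs_if)
  have "norm (lerch_kernel l (Complex (b - a) y)) \<le> exp (- 2 * pi * l * y) / \<bar>1 - q\<bar>"
    unfolding norm_lerch_kernel using norm_one_minus_exp_ge_abs[of y "b - a"] q q0
    by (intro divide_left_mono) (auto simp: q_def intro!: mult_pos_pos intro: order.strict_trans2)
  also have "\<dots> \<le> (exp (- 2 * pi * \<mu> * \<bar>y\<bar>) * (1 + q)) / \<bar>1 - q\<bar>"
    using exp_le_exp_abs_times[OF \<mu>(2,3), of y] by (intro divide_right_mono) (auto simp: q_def)
  also have "\<dots> \<le> (exp (- 2 * pi * \<mu> * \<bar>y\<bar>) * (2 * \<bar>1 - q\<bar>)) / \<bar>1 - q\<bar>"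
    using q by (intro divide_right_mono mult_left_mono) auto
  also have "\<dots> = 2 * exp (- 2 * pi * \<mu> * \<bar>y\<bar>)" using q q0 by auto
  finally have "norm (Complex b y) * norm (lerch_kernel l (Complex (b - a) y)) \<le> (1 + \<bar>y\<bar>) * (2 * exp (- 2 * pi * \<mu> * \<bar>y\<bar>))"
    using norm_Complex_le[of b y] a b by (intro mult_mono) auto
  also have "\<dots> = 2 * ((1 + \<bar>y\<bar>) * exp (- 2 * pi * \<mu> * \<bar>y\<bar>))" by simp
  also have "\<dots> \<le> (3 * exp (4 * pi)) * ((1 + \<bar>y\<bar>) * exp (- 2 * pi * \<mu> * \<bar>y\<bar>))"
  proof (rule mult_right_mono)
    have "exp (4 * pi) \<ge> 1" by simp
    thus "2 \<le> 3 * exp (4 * pi)" by linarith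
  qed auto
  finally show ?thesis by (simp add: mult.assoc)
next
  case False
  define q where "q = exp (- 2 * pi * y)"
  define D where "D = norm (1 - exp (2 * pi * \<i> * Complex (b - a) y))"
  have pil: "2 * pi * \<bar>l * y\<bar> \<le> 2 * pi * 1"
    using False l by (intro mult_left_mono) (auto simp: abs_mult intro: mult_le_one)
  have "- 2 * pi * l * y \<le> 2 * pi * \<bar>l * y\<bar>"
    using mult_left_mono[of "- (l * y)" "\<bar>l * y\<bar>" "2 * pi"] by simp
  hence "- 2 * pi * l * y \<le> 2 * pi" using pil by linarith
  hence num: "exp (- 2 * pi * l * y) \<le> exp (2 * pi)" unfolding exp_le_cancel_iff .
  \<comment> \<open>The distances of b - a from 0 and from -1 are both at least b: the first because
    b <= a / 2, the second because a <= 1.\<close>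
  have D1: "D \<ge> 2 * b"
  proof -
    have "2 * b \<le> 2 * min (a - b) (1 - (a - b))" using a b by auto
    also have "\<dots> \<le> sin (pi * (a - b))" using a b by (intro sin_pi_ge) auto
    also have "\<dots> \<le> \<bar>sin (pi * (b - a))\<bar>"
      by (metis abs_ge_minus_self minus_diff_eq mult_minus_right sin_minus)
    also have "\<dots> \<le> \<bar>sin (pi * (b - a))\<bar> * (1 + q)" by (simp add: q_def mult_le_cancel_left1)
    also have "\<dots> \<le> D" unfolding D_def q_def by (rule norm_one_minus_exp_ge_sin)
    finally show ?thesis .
  qed
  have D2: "D \<ge> \<bar>y\<bar> / 2"
  proof -
    have aux: "1 - exp (- 2 * pi * t) \<ge> t / 2" if "t > 0" "t \<le> 1" for t
    proof -
      have "1 + t \<le> exp (2 * pi * t)"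
      proof -
        have "t \<le> 2 * pi * t" using mult_right_mono[of 1 "2 * pi" t] that pi_gt3 by simp
        thus ?thesis using exp_ge_add_one_self[of "2 * pi * t"] by linarith
      qed
      hence "exp (- 2 * pi * t) \<le> 1 / (1 + t)" using that by (simp add: exp_minus field_simps)
      also have "\<dots> \<le> 1 - t / 2" using that by (simp add: field_simps power2_eq_square)
      finally show ?thesis by simp
    qed
    have "\<bar>1 - q\<bar> \<ge> \<bar>y\<bar> / 2"
    proof (cases "y > 0")
      case True
      thus ?thesis using aux[of y] False by (simp add: q_def)
    next
      case F: False
      have "1 + 2 * pi * (-y) \<le> q" using exp_ge_add_one_self[of "- 2 * pi * y"] by (simp add: q_def)
      moreover have "2 * pi * (-y) \<ge> 1 * (-y)" using F pi_gt3 by (intro mult_right_mono) auto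
      ultimately have "q - 1 \<ge> - y" by linarith
      thus ?thesis using F y by (simp add: abs_if)
    qed
    also have "\<bar>1 - q\<bar> \<le> D" unfolding D_def q_def by (rule norm_one_minus_exp_ge_abs)
    finally show ?thesis .
  qed
  have Dpos: "D > 0" using D1 b by linarith
  have "norm (Complex b y) \<le> b + \<bar>y\<bar>" using norm_Complex_le[of b y] b by simp
  also have "\<dots> \<le> 3 * D" using D1 D2 by linarith
  finally have "norm (Complex b y) * norm (lerch_kernel l (Complex (b - a) y)) \<le> (3 * D) * (exp (2 * pi) / D)"
    unfolding norm_lerch_kernel D_def[symmetric] using num Dpos by (intro mult_mono divide_right_mono) auto
  also have "\<dots> = 3 * exp (2 * pi)" using Dpos by simp
  \<comment> \<open>One factor exp (2 pi) bounds the numerator; the second makes up for exp (- 2 pi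
    mu |y|) >= exp (- 2 pi).\<close>
  also have "\<dots> = 3 * exp (4 * pi) * 1 * exp (- 2 * pi * 1)" by (simp flip: exp_add)
  also have "\<dots> \<le> 3 * exp (4 * pi) * (1 + \<bar>y\<bar>) * exp (- 2 * pi * \<mu> * \<bar>y\<bar>)"
  proof (intro mult_mono)
    have "2 * pi * (\<mu> * \<bar>y\<bar>) \<le> 2 * pi * 1" using False \<mu> by (intro mult_left_mono mult_le_one) auto
    thus "exp (- 2 * pi * 1) \<le> exp (- 2 * pi * \<mu> * \<bar>y\<bar>)" by (simp add: mult.assoc)
  qed auto
  finally show ?thesis .
qed

text \<open>The value does not depend on the line, which is pushed to Re z = - a, where z + a is
  purely imaginary. The condition on Re s supplies a factor that cancels the pole met there when a =
  1.\<close>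

lemma lerch_eq_integral_imaginary_axis:
  assumes a: "0 < a" "a \<le> 1" and l: "0 < l" "l < 1" and s: "Re s < -1"
  shows "lerch l a s = \<i> * (LINT y|lborel. Complex 0 y powr (-s) * lerch_kernel l (Complex (- a) y))"
proof -
  define \<mu> where "\<mu> = min l (1 - l)"
  have \<mu>: "0 < \<mu>" "\<mu> \<le> l" "\<mu> \<le> 1 - l" "\<mu> \<le> 1" using l by (auto simp: \<mu>_def)
  define b where "b = (\<lambda>n. a / (real n + 2))"
  have b: "0 < b n" "b n \<le> a / 2" for n
    using a mult_nonneg_nonneg[of a "real n"] by (auto simp: b_def field_simps)
  have b_lim: "b \<longlonglongrightarrow> 0"
    using a unfolding b_def by real_asymp
  obtain K where K: "K > 0" "\<And>x. x \<ge> 0 \<Longrightarrow> (1 + x) powr (- Re s) \<le> K * exp (pi * \<mu> * x)"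
    using one_plus_powr_le_exp[of "- Re s" "pi * \<mu>"] s \<mu> by auto
  define f where "f = (\<lambda>n y. Complex (b n) y powr (-s) * lerch_kernel l (Complex (b n - a) y))"
  have f_eq: "lerch l a s = \<i> * (LINT y|lborel. f n y)" for n
  proof -
    have c: "-1 < b n - a" "b n - a < 0" using a b[of n] by auto
    have "lerch l a s = lerch_int (b n - a) l a s"
      using c b[of n] l by (subst lerch_eq_lerch_int) auto
    thus ?thesis by (simp add: lerch_int_def f_def)
  qed
  have "(\<lambda>n. LINT y|lborel. f n y) \<longlonglongrightarrow> (LINT y|lborel. Complex 0 y powr (-s) * lerch_kernel l (Complex (- a) y))"
  proof (rule integral_dominated_convergence)
    let ?E = "exp (pi / 2 * \<bar>Im s\<bar>) * (3 * exp (4 * pi))"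
    show "integrable lborel (\<lambda>y. ?E * K * exp (- (pi * \<mu>) * \<bar>y\<bar>))"
      using \<mu> by (intro integrable_mult_right integrable_exp_neg_abs) auto
    \<comment> \<open>At \<open>y = 0\<close> the base of the power reaches the branch point, and
      for \<open>a = 1\<close> the kernel reaches its pole.\<close>
    have nz: "AE y::real in lborel. y \<noteq> 0" by (rule AE_lborel_singleton)
    show "AE y in lborel. (\<lambda>n. f n y) \<longlonglongrightarrow> Complex 0 y powr (-s) * lerch_kernel l (Complex (- a) y)"
      using nz
    proof eventually_elim
      case (elim y)
      have "(\<lambda>n. b n - a) \<longlonglongrightarrow> -a"
        using tendsto_diff[OF b_lim tendsto_const[of a]] by simp
      moreover have "1 - exp (2 * pi * \<i> * Complex (-a) y) \<noteq> 0"
        using norm_one_minus_exp_ge_abs[of y "-a"] elim by auto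
      moreover have "Complex 0 y \<notin> \<real>\<^sub>\<le>\<^sub>0" using elim by (auto simp: complex_nonpos_Reals_iff)
      ultimately show ?case
        using b_lim unfolding f_def lerch_kernel_def by (intro tendsto_intros) auto
    qed
    show "AE y in lborel. norm (f n y) \<le> ?E * K * exp (- (pi * \<mu>) * \<bar>y\<bar>)" for n
      using nz
    proof eventually_elim
      case (elim y)
      let ?w = "Complex (b n) y"
      have w: "norm ?w > 0" "norm ?w \<le> 1 + \<bar>y\<bar>"
        using norm_Complex_le[of "b n" y] b[of n] a by (auto simp: complex_eq_iff)
      have "norm (?w powr (-s)) \<le> norm ?w powr (- Re s) * exp (pi / 2 * \<bar>Im s\<bar>)"
        using b[of n] by (intro norm_powr_le_half_plane) auto
      \<comment> \<open>The factor split off here tames the kernel; \<open>Re s < -1\<close> keeps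
        the remaining exponent positive.\<close>
      also have "norm ?w powr (- Re s) = norm ?w powr (- Re s - 1) * norm ?w"
        using w by (simp add: powr_diff)
      also have "\<dots> \<le> (1 + \<bar>y\<bar>) powr (- Re s - 1) * norm ?w"
        using w s by (intro mult_right_mono powr_mono2) auto
      finally have 1: "norm (?w powr (-s)) \<le> (1 + \<bar>y\<bar>) powr (- Re s - 1) * norm ?w * exp (pi / 2 * \<bar>Im s\<bar>)"
        by simp
      have "norm (f n y) \<le> (1 + \<bar>y\<bar>) powr (- Re s - 1) * norm ?w * exp (pi / 2 * \<bar>Im s\<bar>) * norm (lerch_kernel l (Complex (b n - a) y))"
        unfolding f_def norm_mult by (intro mult_right_mono 1) auto
      also have "\<dots> = (1 + \<bar>y\<bar>) powr (- Re s - 1) * exp (pi / 2 * \<bar>Im s\<bar>) * (norm ?w * norm (lerch_kernel l (Complex (b n - a) y)))"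
        by simp
      also have "\<dots> \<le> (1 + \<bar>y\<bar>) powr (- Re s - 1) * exp (pi / 2 * \<bar>Im s\<bar>) * (3 * exp (4 * pi) * (1 + \<bar>y\<bar>) * exp (- 2 * pi * \<mu> * \<bar>y\<bar>))"
        using \<mu> by (intro mult_left_mono norm_lerch_kernel_near_pole a b l elim) auto
      also have "\<dots> = ?E * ((1 + \<bar>y\<bar>) powr (- Re s - 1) * (1 + \<bar>y\<bar>)) * exp (- 2 * pi * \<mu> * \<bar>y\<bar>)"
        by simp
      also have "(1 + \<bar>y\<bar>) powr (- Re s - 1) * (1 + \<bar>y\<bar>) = (1 + \<bar>y\<bar>) powr (- Re s)"
        by (simp add: powr_diff add_pos_nonneg)
      also have "?E * (1 + \<bar>y\<bar>) powr (- Re s) * exp (- 2 * pi * \<mu> * \<bar>y\<bar>) \<le> ?E * (K * exp (pi * \<mu> * \<bar>y\<bar>)) * exp (- 2 * pi * \<mu> * \<bar>y\<bar>)"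
        using K by (intro mult_right_mono mult_left_mono) auto
      also have "\<dots> = ?E * K * (exp (pi * \<mu> * \<bar>y\<bar>) * exp (- 2 * pi * \<mu> * \<bar>y\<bar>))" by simp
      also have "exp (pi * \<mu> * \<bar>y\<bar>) * exp (- 2 * pi * \<mu> * \<bar>y\<bar>) = exp (- (pi * \<mu>) * \<bar>y\<bar>)"
        by (simp flip: exp_add)
      finally show ?case .
    qed
    show "f n \<in> borel_measurable lborel" for n unfolding f_def by measurable
    show "(\<lambda>y. Complex 0 y powr (-s) * lerch_kernel l (Complex (- a) y)) \<in> borel_measurable lborel" by measurable
  qed
  from tendsto_mult[OF tendsto_const[of \<i>] this]
  have "(\<lambda>n. lerch l a s) \<longlonglongrightarrow> \<i> * (LINT y|lborel. Complex 0 y powr (-s) * lerch_kernel l (Complex (- a) y))"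
    by (simp only: f_eq[symmetric])
  thus ?thesis by (simp add: tendsto_const_iff)
qed

text \<open>After x = 2 pi |y| the two halves of the imaginary axis are Bose integrals: for y > 0
  the kernel expands in powers of exp (2 pi i z), for y < 0 in powers of the inverse, which turns l
  into 1 - l. The phases come from rotating i y and - i |y| to the positive axis.\<close>

theorem lerch_functional_equation_left:
  assumes a: "0 < a" "a \<le> 1" and l: "0 < l" "l < 1" and s: "Re s < -1"
  shows "lerch l a s = Gamma (1 - s) * of_real (2 * pi) powr (s - 1) *
    (exp (pi * \<i> * (1 - s) / 2 - 2 * pi * \<i> * a * l) * lerch_series (- a) l (1 - s) +
     exp (- pi * \<i> * (1 - s) / 2 + 2 * pi * \<i> * a * (1 - l)) * lerch_series a (1 - l) (1 - s))"
proof -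
  define z where "z = 1 - s"
  have z: "Re z > 1" using s by (simp add: z_def)
  let ?F1 = "bose_integrand (- a) l z" and ?F2 = "bose_integrand a (1 - l) z"
  define A where "A = exp (- pi * \<i> * s / 2 - 2 * pi * \<i> * a * l) * of_real (2 * pi) powr s"
  define B where "B = - exp (pi * \<i> * s / 2 + 2 * pi * \<i> * a * (1 - l)) * of_real (2 * pi) powr s"
  have scale: "complex_of_real y powr (-s) = of_real (2 * pi) powr s * of_real (2 * pi * y) powr (z - 1)" if "y > 0" for y
  proof -
    have "complex_of_real (2 * pi * y) powr (z - 1) = of_real (2 * pi) powr (-s) * of_real y powr (-s)"
      using that by (simp add: z_def powr_times_real)
    moreover have "of_real (2 * pi) powr s * of_real (2 * pi) powr (-s) = (1 :: complex)"
      by (simp flip: powr_add)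
    ultimately show ?thesis by (simp add: mult.assoc[symmetric] del: of_real_mult)
  qed
  have rot: "Complex 0 y powr (-s) = exp (- sgn y * pi * \<i> * s / 2) * complex_of_real \<bar>y\<bar> powr (-s)" if "y \<noteq> 0" for y
  proof -
    have "Complex 0 y = of_real \<bar>y\<bar> * (of_real (sgn y) * \<i>)"
      by (simp add: complex_eq_iff abs_mult_sgn mult.commute)
    moreover have "sgn y \<noteq> 0" using that by (simp add: sgn_eq_0_iff)
    ultimately have "Ln (Complex 0 y) = Ln (of_real \<bar>y\<bar>) + Ln (of_real (sgn y) * \<i>)"
      using that Ln_times_of_real[of "\<bar>y\<bar>" "of_real (sgn y) * \<i>"] by (simp add: Ln_of_real)
    also have "Ln (of_real (sgn y) * \<i>) = sgn y * \<i> * pi / 2"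
      using that by (cases "y > 0") auto
    finally have Ln: "Ln (Complex 0 y) = Ln (of_real \<bar>y\<bar>) + sgn y * \<i> * pi / 2" .
    have "Complex 0 y \<noteq> 0" "complex_of_real \<bar>y\<bar> \<noteq> 0" using that by (auto simp: complex_eq_iff)
    thus ?thesis
      unfolding powr_def by (simp add: Ln exp_add[symmetric] algebra_simps)
  qed
  \<comment> \<open>The indicator in \<open>gamma_integrand\<close> switches off the second term for
    y > 0 and the first for y < 0, so both halves fit into one integral over the line.\<close>
  have split: "Complex 0 y powr (-s) * lerch_kernel l (Complex (- a) y) = A * ?F1 (0 + (2 * pi) * y) + B * ?F2 (0 + (- (2 * pi)) * y)" for y
  proof -
    consider "y > 0" | "y < 0" | "y = 0" by linarith
    thus ?thesis
    proof cases
      case 1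
      have e1: "exp (2 * pi * \<i> * Complex (-a) y) = cis (2 * pi * (-a)) * of_real (exp (- (2 * pi * y)))"
        by (simp add: cis_conv_exp exp_of_real[symmetric] exp_add[symmetric] Complex_eq algebra_simps)
      have e2: "exp (2 * pi * \<i> * l * Complex (-a) y) = exp (- (2 * pi * \<i> * a * l)) * of_real (exp (- l * (2 * pi * y)))"
        by (simp add: exp_of_real[symmetric] exp_add[symmetric] Complex_eq algebra_simps)
      have F2: "?F2 (0 + (- (2 * pi)) * y) = 0"
        using 1 by (simp add: bose_integrand_def gamma_integrand_def indicator_def mult_less_0_iff)
      have F1: "?F1 (0 + (2 * pi) * y) = of_real (2 * pi * y) powr (z - 1) * of_real (exp (- l * (2 * pi * y))) / (1 - cis (2 * pi * (-a)) * of_real (exp (- (2 * pi * y))))"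
        using 1 by (simp add: bose_integrand_def gamma_integrand_def)
      have "Complex 0 y powr (-s) = exp (- pi * \<i> * s / 2) * (of_real (2 * pi) powr s * of_real (2 * pi * y) powr (z - 1))"
        using rot[of y] scale[of y] 1 by simp
      moreover have "A = exp (- pi * \<i> * s / 2) * exp (- (2 * pi * \<i> * a * l)) * of_real (2 * pi) powr s"
        unfolding A_def exp_add[symmetric] by simp
      ultimately show ?thesis
        unfolding F1 F2 lerch_kernel_def e1 e2
        by (simp only: mult_zero_right add_0_right times_divide_eq_right times_divide_eq_left mult_ac)
    next
      case 2
      define u where "u = - y"
      have u: "u > 0" "y = - u" using 2 by (auto simp: u_def)
      define w where "w = cis (2 * pi * a) * of_real (exp (- (2 * pi * u)))"
      have w0: "w \<noteq> 0" by (simp add: w_def)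
      have "norm w = exp (- (2 * pi * u))" by (simp add: w_def norm_mult)
      hence "norm w \<noteq> 1" using u by simp
      hence w1: "w \<noteq> 1" by auto
      have e1: "exp (2 * pi * \<i> * Complex (-a) y) = inverse w"
        unfolding w_def u by (simp add: cis_conv_exp exp_of_real[symmetric] exp_add[symmetric] exp_minus[symmetric] Complex_eq algebra_simps)
      have e2: "exp (2 * pi * \<i> * l * Complex (-a) y) = exp (2 * pi * \<i> * a * (1 - l)) * of_real (exp (- (1 - l) * (2 * pi * u))) * inverse w"
        unfolding w_def u by (simp add: cis_conv_exp exp_of_real[symmetric] exp_add[symmetric] exp_minus[symmetric] Complex_eq algebra_simps)
      \<comment> \<open>The factor \<open>inverse w\<close> in \<open>e2\<close> and the denominator
        1 - \<open>inverse w\<close> combine to - 1 / (1 - w).\<close>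
      have K: "lerch_kernel l (Complex (-a) y) = - exp (2 * pi * \<i> * a * (1 - l)) * of_real (exp (- (1 - l) * (2 * pi * u))) / (1 - w)"
        unfolding lerch_kernel_def e1 e2 using w0 w1 by (simp add: field_simps)
      have F1: "?F1 (0 + (2 * pi) * y) = 0"
        using 2 by (simp add: bose_integrand_def gamma_integrand_def indicator_def zero_less_mult_iff)
      have F2: "?F2 (0 + (- (2 * pi)) * y) = of_real (2 * pi * u) powr (z - 1) * of_real (exp (- (1 - l) * (2 * pi * u))) / (1 - w)"
        using u by (simp add: bose_integrand_def gamma_integrand_def w_def)
      have "Complex 0 y powr (-s) = exp (pi * \<i> * s / 2) * (of_real (2 * pi) powr s * of_real (2 * pi * u) powr (z - 1))"
        using rot[of y] scale[of u] u by simp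
      moreover have "B = exp (pi * \<i> * s / 2) * (- exp (2 * pi * \<i> * a * (1 - l))) * of_real (2 * pi) powr s"
        unfolding B_def exp_add by simp
      ultimately show ?thesis
        unfolding F1 F2 K
        by (simp only: mult_zero_right add_0_left times_divide_eq_right times_divide_eq_left mult_ac)
    next
      case 3
      thus ?thesis by (simp add: bose_integrand_def gamma_integrand_def powr_def zero_complex.code[symmetric])
    qed
  qed
  have F: "integrable lborel ?F1" "integral\<^sup>L lborel ?F1 = Gamma z * lerch_series (- a) l z"
     "integrable lborel ?F2" "integral\<^sup>L lborel ?F2 = Gamma z * lerch_series a (1 - l) z"
    using has_bochner_integral_bose_integrand[of z l "-a"] has_bochner_integral_bose_integrand[of z "1 - l" a] z l
    by (auto simp: has_bochner_integral_iff)
  have int: "integrable lborel (\<lambda>y. ?F1 (0 + (2 * pi) * y))" "integrable lborel (\<lambda>y. ?F2 (0 + (- (2 * pi)) * y))"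
    by (intro lborel_integrable_real_affine F; simp)+
  have L1: "(LINT y|lborel. ?F1 (0 + (2 * pi) * y)) = Gamma z * lerch_series (- a) l z / (2 * pi)"
    using lborel_integral_real_affine[of "2 * pi" ?F1 0] F by (simp add: scaleR_conv_of_real field_simps)
  have L2: "(LINT y|lborel. ?F2 (0 + (- (2 * pi)) * y)) = Gamma z * lerch_series a (1 - l) z / (2 * pi)"
    using lborel_integral_real_affine[of "- (2 * pi)" ?F2 0] F by (simp add: scaleR_conv_of_real field_simps)
  have "lerch l a s = \<i> * (LINT y|lborel. A * ?F1 (0 + (2 * pi) * y) + B * ?F2 (0 + (- (2 * pi)) * y))"
    using lerch_eq_integral_imaginary_axis[OF a l s] by (simp only: split)
  also have "(LINT y|lborel. A * ?F1 (0 + (2 * pi) * y) + B * ?F2 (0 + (- (2 * pi)) * y)) = 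
      A * (Gamma z * lerch_series (- a) l z / (2 * pi)) + B * (Gamma z * lerch_series a (1 - l) z / (2 * pi))"
    using int by (subst Bochner_Integration.integral_add) (simp_all only: integrable_mult_right integral_mult_right_zero L1 L2)
  finally have L: "lerch l a s = Gamma z / (2 * pi) * (\<i> * A * lerch_series (- a) l z + \<i> * B * lerch_series a (1 - l) z)"
    by (simp add: algebra_simps)
  \<comment> \<open>Writing the factor i of the line integral as an exponential turns the exponents
    in s into exponents in 1 - s.\<close>
  have iexp: "\<i> = exp (\<i> * pi / 2)" using cis_conv_exp[of "pi / 2"] by (simp add: cis_pi_half)
  have miexp: "- \<i> = exp (- (\<i> * pi / 2))" using iexp by (simp add: exp_minus flip: iexp)
  have A': "\<i> * A = exp (pi * \<i> * z / 2 - 2 * pi * \<i> * a * l) * of_real (2 * pi) powr s"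
  proof -
    have "\<i> * exp (- pi * \<i> * s / 2 - 2 * pi * \<i> * a * l) = exp (\<i> * pi / 2) * exp (- pi * \<i> * s / 2 - 2 * pi * \<i> * a * l)"
      by (simp only: iexp[symmetric])
    also have "\<dots> = exp (pi * \<i> * z / 2 - 2 * pi * \<i> * a * l)"
      unfolding exp_add[symmetric] z_def by (rule arg_cong[of _ _ exp]) (simp add: field_simps)
    finally show ?thesis by (simp add: A_def mult.assoc[symmetric])
  qed
  have B': "\<i> * B = exp (- pi * \<i> * z / 2 + 2 * pi * \<i> * a * (1 - l)) * of_real (2 * pi) powr s"
  proof -
    have "- \<i> * exp (pi * \<i> * s / 2 + 2 * pi * \<i> * a * (1 - l)) = exp (- (\<i> * pi / 2)) * exp (pi * \<i> * s / 2 + 2 * pi * \<i> * a * (1 - l))"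
      by (simp only: miexp[symmetric])
    also have "\<dots> = exp (- pi * \<i> * z / 2 + 2 * pi * \<i> * a * (1 - l))"
      unfolding exp_add[symmetric] z_def by (rule arg_cong[of _ _ exp]) (simp add: field_simps)
    finally have E: "- \<i> * exp (pi * \<i> * s / 2 + 2 * pi * \<i> * a * (1 - l)) = exp (- pi * \<i> * z / 2 + 2 * pi * \<i> * a * (1 - l))" .
    have "\<i> * B = (- \<i> * exp (pi * \<i> * s / 2 + 2 * pi * \<i> * a * (1 - l))) * of_real (2 * pi) powr s"
      by (simp add: B_def)
    thus ?thesis by (simp only: E)
  qed
  have "of_real (2 * pi) powr s / (2 * pi) = of_real (2 * pi) powr (s - 1)"
    by (simp add: powr_diff)
  hence P: "of_real (2 * pi) powr s = (2 * pi) * of_real (2 * pi) powr (s - 1)"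
    by (simp add: field_simps)
  show ?thesis
    unfolding L A' B' z_def[symmetric] P by (simp add: algebra_simps)
qed

subsection \<open>The Gamma function in strips, zero counting and reflection\<close>

text \<open>The modulus of n powr (x + i y) depends on x alone, so Euler's approximants split into
  their value at the real point and the factors by which \<open>y\<close> reduces it.\<close>

lemma norm_Gamma_series:
  assumes "x > 0"
  shows "norm (Gamma_series (Complex x y) n) = 
    norm (Gamma_series (complex_of_real x) n) * (\<Prod>k<Suc n. (x + real k) / norm (Complex (x + real k) y))"
proof -
  have nrm: "norm (Complex x y + of_nat k) = norm (Complex (x + real k) y)" for k
    by (rule arg_cong[of _ _ norm]) (simp add: complex_eq_iff)
  have nrm': "norm (complex_of_real x + of_nat k) = x + real k" for k
    using assms by (metis abs_of_pos add_pos_nonneg norm_of_real of_nat_0_le_iff of_real_add of_real_of_nat_eq)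
  have p1: "norm (pochhammer (Complex x y) (Suc n)) = (\<Prod>k<Suc n. norm (Complex (x + real k) y))"
    unfolding pochhammer_prod by (simp only: prod_norm[symmetric] nrm atLeast0LessThan)
  have p2: "norm (pochhammer (complex_of_real x) (Suc n)) = (\<Prod>k<Suc n. x + real k)"
    unfolding pochhammer_prod by (simp only: prod_norm[symmetric] nrm' atLeast0LessThan)
  have "(\<Prod>k<Suc n. x + real k) \<noteq> 0" using assms by (auto simp del: prod.lessThan_Suc)
  thus ?thesis
    unfolding Gamma_series_def norm_divide norm_mult Suc_eq_plus1[symmetric] p1 p2 prod_dividef
    by simp
qed

text \<open>In quotient form: |Gamma (x + i y)| / Gamma x increases with x, because each factor u /
  |u + i y| does. This reduces strips to integer abscissas and takes the place of Stirling's
  formula.\<close>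

lemma norm_Gamma_quotient_mono:
  assumes x: "0 < x" "x \<le> x'"
  shows "norm (Gamma (Complex x y)) * Gamma x' \<le> norm (Gamma (Complex x' y)) * Gamma x"
proof (rule LIMSEQ_le)
  have G: "norm (Gamma (complex_of_real u)) = Gamma u" if "u > 0" for u
    using that Gamma_real_pos[of u] by (simp add: Gamma_complex_of_real)
  show "(\<lambda>n. norm (Gamma_series (Complex x y) n) * norm (Gamma_series (complex_of_real x') n)) \<longlonglongrightarrow> norm (Gamma (Complex x y)) * Gamma x'"
    using x by (subst G[symmetric]) (auto intro!: tendsto_intros Gamma_series_LIMSEQ)
  show "(\<lambda>n. norm (Gamma_series (Complex x' y) n) * norm (Gamma_series (complex_of_real x) n)) \<longlonglongrightarrow> norm (Gamma (Complex x' y)) * Gamma x"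
    using x by (subst G[symmetric]) (auto intro!: tendsto_intros Gamma_series_LIMSEQ)
  have "norm (Gamma_series (Complex x y) n) * norm (Gamma_series (complex_of_real x') n) \<le> 
      norm (Gamma_series (Complex x' y) n) * norm (Gamma_series (complex_of_real x) n)" for n
  proof -
    have le: "u / norm (Complex u y) \<le> u' / norm (Complex u' y)" if u: "0 < u" "u \<le> u'" for u u'
    proof -
      have "u * norm (Complex u' y) \<le> u' * norm (Complex u y)"
      proof (rule power2_le_imp_le)
        have "u\<^sup>2 * y\<^sup>2 \<le> u'\<^sup>2 * y\<^sup>2" using u by (intro mult_right_mono power_mono) auto
        thus "(u * norm (Complex u' y))\<^sup>2 \<le> (u' * norm (Complex u y))\<^sup>2"
          by (simp add: power_mult_distrib cmod_power2 algebra_simps)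
      qed (use u in auto)
      moreover have "norm (Complex u y) > 0" "norm (Complex u' y) > 0" using u by (auto simp: complex_eq_iff)
      ultimately show ?thesis by (simp add: field_simps)
    qed
    have "(\<Prod>k<Suc n. (x + real k) / norm (Complex (x + real k) y)) \<le> (\<Prod>k<Suc n. (x' + real k) / norm (Complex (x' + real k) y))"
      using x by (intro prod_mono conjI le divide_nonneg_nonneg) auto
    hence "norm (Gamma_series (complex_of_real x) n) * norm (Gamma_series (complex_of_real x') n) * (\<Prod>k<Suc n. (x + real k) / norm (Complex (x + real k) y)) \<le> 
      norm (Gamma_series (complex_of_real x) n) * norm (Gamma_series (complex_of_real x') n) * (\<Prod>k<Suc n. (x' + real k) / norm (Complex (x' + real k) y))"
      by (intro mult_left_mono) auto
    thus ?thesis using x by (simp only: norm_Gamma_series mult_ac)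
  qed
  thus "\<exists>N. \<forall>n\<ge>N. norm (Gamma_series (Complex x y) n) * norm (Gamma_series (complex_of_real x') n) \<le> 
      norm (Gamma_series (Complex x' y) n) * norm (Gamma_series (complex_of_real x) n)" by blast
qed

text \<open>The reflection formula gives the square exactly, as pi |y| / sinh (pi |y|).\<close>

lemma norm_Gamma_1_plus_imaginary:
  assumes "\<bar>y\<bar> \<ge> 1"
  shows "norm (Gamma (Complex 1 y)) \<le> 4 * \<bar>y\<bar> * exp (- pi * \<bar>y\<bar> / 2)"
proof (rule power2_le_imp_le)
  define z where "z = \<i> * of_real y"
  have z: "z \<noteq> 0" "z \<notin> \<int>\<^sub>\<le>\<^sub>0" using assms by (auto simp: z_def nonpos_Ints_def complex_eq_iff)
  have e: "Complex 1 y = z + 1" "1 - z = cnj (Complex 1 y)" by (auto simp: z_def complex_eq_iff)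
  have "Gamma (Complex 1 y) = z * Gamma z"
    using Gamma_plus1[OF z(2)] by (simp add: e(1))
  hence "Gamma (Complex 1 y) * Gamma (cnj (Complex 1 y)) = z * (Gamma z * Gamma (1 - z))"
    by (simp only: e(2)[symmetric] mult.assoc)
  also have "\<dots> = z * (of_real pi / sin (of_real pi * z))" by (simp only: Gamma_reflection_complex)
  finally have "norm (Gamma (Complex 1 y)) * norm (Gamma (cnj (Complex 1 y))) = \<bar>y\<bar> * pi / norm (sin (of_real pi * z))"
    by (simp add: norm_mult[symmetric] norm_divide) (simp add: norm_mult norm_divide z_def)
  moreover have "Gamma (cnj (Complex 1 y)) = cnj (Gamma (Complex 1 y))"
    by (rule cnj_Gamma[symmetric]) 
  ultimately have sq: "(norm (Gamma (Complex 1 y)))\<^sup>2 = \<bar>y\<bar> * pi / norm (sin (of_real pi * z))"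
    by (simp add: power2_eq_square)
  have "norm (sin (of_real pi * z)) \<ge> exp (pi * \<bar>y\<bar>) / 4"
  proof -
    have "sin (of_real pi * z) = (exp (\<i> * (of_real pi * z)) - exp (- (\<i> * (of_real pi * z)))) / (2 * \<i>)"
      by (rule sin_exp_eq)
    hence "norm (sin (of_real pi * z)) = norm (exp (\<i> * (of_real pi * z)) - exp (- (\<i> * (of_real pi * z)))) / 2"
      by (simp add: norm_divide norm_mult)
    also have "\<dots> \<ge> \<bar>exp (- pi * y) - exp (pi * y)\<bar> / 2"
      using norm_triangle_ineq3[of "exp (\<i> * (of_real pi * z))" "exp (- (\<i> * (of_real pi * z)))"]
      by (simp add: z_def)
    also have "\<bar>exp (- pi * y) - exp (pi * y)\<bar> = exp (pi * \<bar>y\<bar>) - exp (- (pi * \<bar>y\<bar>))"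
      by (cases "y \<ge> 0") (auto simp: abs_if mult_le_0_iff zero_le_mult_iff zero_less_mult_iff)
    finally have 1: "norm (sin (of_real pi * z)) \<ge> (exp (pi * \<bar>y\<bar>) - exp (- (pi * \<bar>y\<bar>))) / 2" .
    have "pi * \<bar>y\<bar> \<ge> 1 * 1" using assms pi_gt3 by (intro mult_mono) auto
    hence "exp (pi * \<bar>y\<bar>) \<ge> 2" using exp_ge_add_one_self[of "pi * \<bar>y\<bar>"] by linarith
    moreover have "exp (- (pi * \<bar>y\<bar>)) \<le> 1" by simp
    moreover have "E / 4 \<le> (E - F) / 2" if "E \<ge> 2" "F \<le> 1" for E F :: real using that by simp
    ultimately have "exp (pi * \<bar>y\<bar>) / 4 \<le> (exp (pi * \<bar>y\<bar>) - exp (- (pi * \<bar>y\<bar>))) / 2" by blast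
    thus ?thesis using 1 by (rule order.trans)
  qed
  hence "\<bar>y\<bar> * pi / norm (sin (of_real pi * z)) \<le> \<bar>y\<bar> * pi / (exp (pi * \<bar>y\<bar>) / 4)"
    by (intro divide_left_mono) (auto intro!: mult_pos_pos elim: order.strict_trans2[rotated])
  also have "\<dots> = \<bar>y\<bar> * (4 * pi) * exp (- (pi * \<bar>y\<bar>))" by (simp add: exp_minus field_simps)
  also have "\<dots> \<le> \<bar>y\<bar> * (16 * \<bar>y\<bar>) * exp (- (pi * \<bar>y\<bar>))"
    using assms pi_less_4 by (intro mult_right_mono mult_left_mono) auto
  also have "\<dots> = (4 * \<bar>y\<bar> * exp (- pi * \<bar>y\<bar> / 2))\<^sup>2"
    by (simp add: power_mult_distrib power2_eq_square exp_add[symmetric])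
  finally show "(norm (Gamma (Complex 1 y)))\<^sup>2 \<le> (4 * \<bar>y\<bar> * exp (- pi * \<bar>y\<bar> / 2))\<^sup>2"
    using sq by simp
qed auto

text \<open>The point is shifted to the right into Re >= 1, compared with an integer abscissa by
  monotonicity, and brought down to abscissa 1 by the recursion, which costs a polynomial
  factor.\<close>

lemma norm_Gamma_strip_le:
  assumes "B \<ge> 0"
  obtains K N where "K > 0" "\<And>x y. \<bar>x\<bar> \<le> B \<Longrightarrow> \<bar>y\<bar> \<ge> 1 \<Longrightarrow> norm (Gamma (Complex x y)) \<le> K * \<bar>y\<bar> ^ N * exp (- pi * \<bar>y\<bar> / 2)"
proof -
  \<comment> \<open>Chosen so that x + M lies between 1 and 2 M, below the integer abscissa
    \<open>Suc n\<close> = 2 M + 1.\<close>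
  define M where "M = nat \<lceil>B\<rceil> + 1"
  have M: "B + 1 \<le> real M" unfolding M_def by linarith
  define n where "n = 2 * M"
  have "continuous_on {1..real (Suc n)} (Gamma :: real \<Rightarrow> real)"
    by (intro continuous_on_Gamma) (auto elim!: nonpos_Ints_cases)
  hence "bounded ((Gamma :: real \<Rightarrow> real) ` {1..real (Suc n)})"
    by (intro compact_imp_bounded compact_continuous_image) auto
  then obtain K0 where K0: "K0 > 0" "\<And>x. x \<in> {1..real (Suc n)} \<Longrightarrow> Gamma x \<le> K0"
    unfolding bounded_pos by (auto simp: abs_le_iff)
  define K where "K = 4 * (real n + 1) ^ n * K0"
  have "norm (Gamma (Complex x y)) \<le> K * \<bar>y\<bar> ^ (n + 1) * exp (- pi * \<bar>y\<bar> / 2)" if xy: "\<bar>x\<bar> \<le> B" "\<bar>y\<bar> \<ge> 1" for x y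
  proof -
    have nonint: "Complex u y \<notin> \<int>\<^sub>\<le>\<^sub>0" for u using xy by (auto simp: nonpos_Ints_def complex_eq_iff)
    have shift: "norm (Gamma (Complex (u + real m) y)) = norm (pochhammer (Complex u y) m) * norm (Gamma (Complex u y))" for u m
    proof -
      have "Complex u y + of_nat m = Complex (u + real m) y" by (simp add: complex_eq_iff)
      moreover have "Gamma (Complex u y) \<noteq> 0" using nonint by (simp add: Gamma_eq_zero_iff)
      ultimately have "Gamma (Complex (u + real m) y) = pochhammer (Complex u y) m * Gamma (Complex u y)"
        using pochhammer_Gamma[OF nonint, of u m] by simp
      thus ?thesis by (simp add: norm_mult)
    qed
    have comp: "norm (Complex u y + of_nat k) = norm (Complex (u + real k) y)" for u k
      by (rule arg_cong[of _ _ norm]) (simp add: complex_eq_iff)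
    have poch_ge: "norm (pochhammer (Complex x y) M) \<ge> 1"
    proof -
      have "norm (Complex x y + of_nat k) \<ge> 1" for k
        using abs_Im_le_cmod[of "Complex (x + real k) y"] xy unfolding comp by simp
      thus ?thesis unfolding pochhammer_prod prod_norm[symmetric] by (intro prod_ge_1) auto
    qed
    have poch_le: "norm (pochhammer (Complex 1 y) n) \<le> ((real n + 1) * \<bar>y\<bar>) ^ n"
    proof -
      have "norm (Complex 1 y + of_nat k) \<le> (real n + 1) * \<bar>y\<bar>" if "k < n" for k
      proof -
        have "norm (Complex 1 y + of_nat k) \<le> 1 + real k + \<bar>y\<bar>"
          unfolding comp using norm_Complex_le[of "1 + real k" y] by simp
        also have "\<dots> \<le> real n * 1 + \<bar>y\<bar>" using that by simp
        also have "\<dots> \<le> real n * \<bar>y\<bar> + \<bar>y\<bar>" using xy by (intro add_right_mono mult_left_mono) auto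
        finally show ?thesis by (simp add: algebra_simps)
      qed
      hence "(\<Prod>k=0..<n. norm (Complex 1 y + of_nat k)) \<le> (\<Prod>k=0..<n. (real n + 1) * \<bar>y\<bar>)"
        by (intro prod_mono) auto
      thus ?thesis unfolding pochhammer_prod prod_norm[symmetric] by simp
    qed
    have x': "1 \<le> x + real M" "x + real M \<le> real (Suc n)" using xy M by (auto simp: n_def)
    have G1: "Gamma (real (Suc n)) \<ge> 1"
      using Gamma_fact[of n, where ?'a = real] by (simp add: add.commute)
    have "norm (Gamma (Complex x y)) \<le> norm (pochhammer (Complex x y) M) * norm (Gamma (Complex x y))"
      using poch_ge by (simp add: mult_le_cancel_right1)
    also have "\<dots> = norm (Gamma (Complex (x + real M) y))" by (simp only: shift)
    also have "\<dots> \<le> norm (Gamma (Complex (x + real M) y)) * Gamma (real (Suc n))"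
      using G1 by (simp add: mult_le_cancel_left1)
    also have "\<dots> \<le> norm (Gamma (Complex (real (Suc n)) y)) * Gamma (x + real M)"
      using x' by (intro norm_Gamma_quotient_mono) auto
    also have "\<dots> \<le> norm (Gamma (Complex (real (Suc n)) y)) * K0"
      using x' K0 by (intro mult_left_mono) auto
    also have "norm (Gamma (Complex (real (Suc n)) y)) = norm (pochhammer (Complex 1 y) n) * norm (Gamma (Complex 1 y))"
      using shift[of 1 n] by simp
    also have "\<dots> * K0 \<le> (((real n + 1) * \<bar>y\<bar>) ^ n * (4 * \<bar>y\<bar> * exp (- pi * \<bar>y\<bar> / 2))) * K0"
      using K0 poch_le norm_Gamma_1_plus_imaginary[OF xy(2)] by (intro mult_right_mono mult_mono) auto
    also have "\<dots> = K * \<bar>y\<bar> ^ (n + 1) * exp (- pi * \<bar>y\<bar> / 2)"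
      by (simp add: K_def power_mult_distrib)
    finally show ?thesis .
  qed
  moreover have "K > 0" using K0 by (simp add: K_def)
  ultimately show ?thesis using that by blast
qed

text \<open>A form of Jensen's inequality. After division by all z - w, these factors are at least 2
  r on the circle of radius 3 r and at most r at the centre, so by the maximum principle each zero
  gains a factor 2. Distinct points are counted, since only positions matter when choosing a
  circle.\<close>

lemma card_zeros_le:
  assumes f: "f holomorphic_on UNIV" and Z: "finite Z" "\<And>w. w \<in> Z \<Longrightarrow> f w = 0 \<and> dist c w \<le> r"
    and r: "r > 0" and M: "\<And>z. dist c z \<le> 3 * r \<Longrightarrow> norm (f z) \<le> M"
  shows "2 ^ card Z * norm (f c) \<le> M"
proof -
  have "\<exists>h. h holomorphic_on UNIV \<and> (\<forall>z. f z = (\<Prod>w\<in>Z. z - w) * h z)"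
    using Z
  proof (induction Z rule: finite_induct)
    case empty
    thus ?case using f by (intro exI[of _ f]) auto
  next
    case (insert w Z)
    then obtain h where h: "h holomorphic_on UNIV" "\<And>z. f z = (\<Prod>w\<in>Z. z - w) * h z" by blast
    have "f w = 0" using insert by auto
    moreover have "(\<Prod>v\<in>Z. w - v) \<noteq> 0" using insert by auto
    ultimately have "h w = 0" using h(2)[of w] by simp
    \<comment> \<open>The difference quotient, with the derivative filled in at \<open>w\<close>, is
      the holomorphic quotient by z - w.\<close>
    define h' where "h' = (\<lambda>z. if z = w then deriv h w else (h z - h w) / (z - w))"
    have "h' holomorphic_on UNIV" unfolding h'_def by (intro pole_lemma_open h) auto
    moreover have "h z = (z - w) * h' z" for z using \<open>h w = 0\<close> by (simp add: h'_def)
    hence "f z = (\<Prod>w\<in>insert w Z. z - w) * h' z" for z using insert h(2)[of z] by (simp add: mult_ac)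
    ultimately show ?case by blast
  qed
  then obtain h where h: "h holomorphic_on UNIV" "\<And>z. f z = (\<Prod>w\<in>Z. z - w) * h z" by blast
  define n where "n = card Z"
  have "norm (h c) \<le> M / (2 * r) ^ n"
  proof (rule maximum_modulus_frontier[of h "cball c (3 * r)"])
    show "h holomorphic_on interior (cball c (3 * r))" using h(1) by (rule holomorphic_on_subset) auto
    show "continuous_on (closure (cball c (3 * r))) h"
      using holomorphic_on_imp_continuous_on[OF h(1)] by (rule continuous_on_subset) auto
    fix z assume "z \<in> frontier (cball c (3 * r))"
    hence z: "dist c z = 3 * r" using r by (simp add: frontier_cball)
    have "(2 * r) ^ n = (\<Prod>w\<in>Z. 2 * r)" by (simp add: n_def)
    also have "\<dots> \<le> (\<Prod>w\<in>Z. norm (z - w))"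
    proof (intro prod_mono conjI)
      fix w assume "w \<in> Z"
      hence "dist c w \<le> r" using Z by auto
      moreover have "dist c z \<le> dist c w + dist w z" by (rule dist_triangle)
      ultimately show "2 * r \<le> norm (z - w)" using z by (simp add: dist_norm norm_minus_commute)
    qed (use r in auto)
    finally have "(2 * r) ^ n * norm (h z) \<le> (\<Prod>w\<in>Z. norm (z - w)) * norm (h z)" by (intro mult_right_mono) auto
    also have "\<dots> = norm (f z)" by (simp add: h(2) norm_mult prod_norm)
    also have "\<dots> \<le> M" using M z by simp
    finally show "norm (h z) \<le> M / (2 * r) ^ n" using r by (simp add: field_simps)
  qed (use r in auto)
  hence h_le: "(2 * r) ^ n * norm (h c) \<le> M" using r by (simp add: field_simps)
  have "norm (f c) = (\<Prod>w\<in>Z. norm (c - w)) * norm (h c)" by (simp add: h(2) norm_mult prod_norm)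
  also have "\<dots> \<le> (\<Prod>w\<in>Z. r) * norm (h c)"
    using Z by (intro mult_right_mono prod_mono) (auto simp: dist_norm)
  finally have "2 ^ n * norm (f c) \<le> 2 ^ n * (r ^ n * norm (h c))" by (simp add: n_def)
  also have "\<dots> \<le> M" using h_le by (simp add: power_mult_distrib mult.assoc)
  finally show ?thesis by (simp add: n_def)
qed

text \<open>Pigeonhole: N + 1 candidates spaced by twice the required distance; each element of
  \<open>T\<close> spoils at most one of them.\<close>

lemma exists_radius_avoiding:
  fixes R :: real
  assumes T: "finite T" "card T \<le> N" and R: "R > 0"
  obtains r where "R \<le> r" "r \<le> 2 * R" "\<And>d. d \<in> T \<Longrightarrow> \<bar>r - d\<bar> \<ge> R / (2 * (real N + 1))"
proof -
  define \<delta> where "\<delta> = R / (2 * (real N + 1))"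
  have \<delta>: "\<delta> > 0" using R by (simp add: \<delta>_def)
  define \<rho> where "\<rho> = (\<lambda>j::nat. R + 2 * real j * \<delta>)"
  have "\<exists>j\<in>{..N}. \<forall>d\<in>T. \<bar>\<rho> j - d\<bar> \<ge> \<delta>"
  proof (rule ccontr)
    assume "\<not> ?thesis"
    hence "\<forall>j\<in>{..N}. \<exists>d\<in>T. \<bar>\<rho> j - d\<bar> < \<delta>" by (auto simp: not_le)
    then obtain D where D: "\<And>j. j \<le> N \<Longrightarrow> D j \<in> T \<and> \<bar>\<rho> j - D j\<bar> < \<delta>" by (metis atMost_iff)
    have "inj_on D {..N}"
    proof (rule inj_onI)
      fix i j assume ij: "i \<in> {..N}" "j \<in> {..N}" "D i = D j"
      hence "\<bar>\<rho> i - \<rho> j\<bar> < 2 * \<delta>" using D[of i] D[of j] by auto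
      also have "\<rho> i - \<rho> j = (2 * \<delta>) * (real i - real j)" by (simp add: \<rho>_def algebra_simps)
      finally have "\<bar>real i - real j\<bar> < 1" using \<delta> by (simp add: abs_mult)
      thus "i = j" by linarith
    qed
    hence "card {..N} \<le> card T" using D T by (intro card_inj_on_le[of D]) auto
    thus False using T by simp
  qed
  then obtain j where j: "j \<le> N" "\<And>d. d \<in> T \<Longrightarrow> \<bar>\<rho> j - d\<bar> \<ge> \<delta>" by auto
  have "2 * real j * \<delta> \<le> 2 * (real N + 1) * \<delta>" using j \<delta> by (intro mult_right_mono) auto
  also have "\<dots> = R" by (simp add: \<delta>_def)
  finally have "\<rho> j \<le> 2 * R" by (simp add: \<rho>_def)
  moreover have "R \<le> \<rho> j" using \<delta> by (simp add: \<rho>_def)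
  ultimately show ?thesis using that[of "\<rho> j"] j by (simp add: \<delta>_def)
qed

text \<open>The point \<open>1 - cnj s\<close> is the mirror image in Re s = 1 / 2 and has the same
  imaginary part, so the upper half plane is preserved. The outer conjugation restores
  holomorphy.\<close>

definition reflect :: "(complex \<Rightarrow> complex) \<Rightarrow> complex \<Rightarrow> complex" where
  "reflect f s = cnj (f (1 - cnj s))"

lemma reflect_holomorphic:
  assumes f: "f holomorphic_on {s. Im s > 0}"
  shows "reflect f holomorphic_on {s. Im s > 0}"
proof -
  have "cnj \<circ> f \<circ> cnj holomorphic_on {s. Im s < 0}"
  proof (rule holomorphic_on_compose_cnj_cnj)
    show "f holomorphic_on cnj ` {s. Im s < 0}" using f by (rule holomorphic_on_subset) auto
    show "open {s. Im s < 0}" by (rule open_halfspace_Im_lt)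
  qed
  note h = this
  have lin: "(\<lambda>s. 1 - s) holomorphic_on {s. Im s > 0}" by (intro holomorphic_intros)
  have "(cnj \<circ> f \<circ> cnj) \<circ> (\<lambda>s. 1 - s) holomorphic_on {s. Im s > 0}"
    by (rule holomorphic_on_compose_gen[OF lin h]) auto
  thus ?thesis by (simp add: reflect_def[abs_def] o_def)
qed

text \<open>The local factorization at \<open>1 - cnj p\<close> is transported to \<open>p\<close>,
  where conjugation turns its linear factor into - (s - p). The point \<open>w\<close> excludes the
  zero function.\<close>

lemma zorder_reflect:
  assumes f: "f holomorphic_on {s. Im s > 0}" and p: "Im p > 0" and nz: "Im w > 0" "f w \<noteq> 0"
  shows "zorder (reflect f) p = zorder f (1 - cnj p)"
proof -
  define q where "q = 1 - cnj p"
  define n where "n = zorder f q"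
  let ?h = "zor_poly f q"
  have q: "Im q > 0" using p by (simp add: q_def)
  have "connected {s. Im s > 0}" by (intro convex_connected convex_halfspace_Im_gt)
  moreover have "\<exists>w\<in>{s. Im s > 0}. f w \<noteq> 0" using nz by auto
  ultimately have "(if f q = 0 then n > 0 else n = 0) \<and> (\<exists>r. r > 0 \<and> cball q r \<subseteq> {s. Im s > 0} \<and> ?h holomorphic_on cball q r
    \<and> (\<forall>w\<in>cball q r. f w = ?h w * (w - q) ^ nat n \<and> ?h w \<noteq> 0))"
    unfolding n_def using q by (intro zorder_exist_zero[OF f open_halfspace_Im_gt]) auto
  hence n: "n \<ge> 0" and "\<exists>r. r > 0 \<and> cball q r \<subseteq> {s. Im s > 0} \<and> ?h holomorphic_on cball q r
    \<and> (\<forall>w\<in>cball q r. f w = ?h w * (w - q) ^ nat n \<and> ?h w \<noteq> 0)"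
    by (auto split: if_splits)
  then obtain r where r: "r > 0" "?h holomorphic_on cball q r" 
     "\<And>w. w \<in> cball q r \<Longrightarrow> f w = ?h w * (w - q) ^ nat n \<and> ?h w \<noteq> 0" by blast
  define g where "g = (\<lambda>s. (-1) ^ nat n * cnj (?h (1 - cnj s)))"
  have dist: "dist q (1 - cnj s) = dist p s" for s
  proof -
    have "q - (1 - cnj s) = - cnj (p - s)" by (simp add: q_def)
    thus ?thesis unfolding dist_norm by (metis complex_mod_cnj norm_minus_cancel)
  qed
  have "zorder (reflect f) p = n"
  proof (rule zorder_eqI[of "ball p r" p g])
    have "cnj \<circ> ?h \<circ> cnj holomorphic_on ball (cnj q) r"
    proof (rule holomorphic_on_compose_cnj_cnj)
      have "cnj ` ball (cnj q) r \<subseteq> cball q r"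
        by (auto simp: dist_norm simp flip: complex_cnj_diff) (metis complex_cnj_cnj complex_cnj_diff complex_mod_cnj less_imp_le)
      thus "?h holomorphic_on cnj ` ball (cnj q) r" using r(2) by (rule holomorphic_on_subset[rotated])
    qed auto
    note h = this
    have lin: "(\<lambda>s. 1 - s) holomorphic_on ball p r" by (intro holomorphic_intros)
    have "(cnj \<circ> ?h \<circ> cnj) \<circ> (\<lambda>s. 1 - s) holomorphic_on ball p r"
      by (rule holomorphic_on_compose_gen[OF lin h]) (auto simp: q_def dist_norm norm_minus_commute)
    thus "g holomorphic_on ball p r"
      unfolding g_def by (intro holomorphic_intros) (simp add: o_def)
    show "g p \<noteq> 0" using r(3)[of q] r(1) by (simp add: g_def q_def)
    fix s assume "s \<in> ball p r" "s \<noteq> p"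
    hence "1 - cnj s \<in> cball q r" by (simp add: dist)
    from r(3)[OF this] have "reflect f s = cnj (?h (1 - cnj s)) * (cnj (1 - cnj s - q)) ^ nat n"
      by (simp add: reflect_def)
    also have "cnj (1 - cnj s - q) = - (s - p)" by (simp add: q_def)
    also have "(- (s - p)) ^ nat n = (-1) ^ nat n * (s - p) ^ nat n" by (rule power_minus)
    also have "(s - p) ^ nat n = (s - p) powi n" using n by (simp add: power_int_def)
    finally show "reflect f s = g s * (s - p) powi n" by (simp add: g_def mult_ac)
  qed (use r in auto)
  thus ?thesis by (simp add: n_def q_def)
qed

lemma reflect_ball: "(\<lambda>s. 1 - cnj s) ` ball p r = ball (1 - cnj p) r"
proof -
  have dist: "dist (1 - cnj p) (1 - cnj s) = dist p s" for p s
  proof -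
    have "(1 - cnj p) - (1 - cnj s) = - cnj (p - s)" by simp
    thus ?thesis unfolding dist_norm by (metis complex_mod_cnj norm_minus_cancel)
  qed
  show ?thesis
  proof (intro equalityI subsetI)
    fix s assume "s \<in> ball (1 - cnj p) r"
    hence "1 - cnj s \<in> ball p r" using dist[of p "1 - cnj s"] by simp
    thus "s \<in> (\<lambda>s. 1 - cnj s) ` ball p r" by (intro image_eqI[of _ _ "1 - cnj s"]) auto
  qed (auto simp: dist)
qed

text \<open>A zero-free factor leaves orders unchanged. The sum on the left has the shape in which
  Rouche's theorem counts zeros.\<close>

lemma num_zeros_in_reflect:
  assumes f: "f holomorphic_on {s. Im s > 0}" and nz: "Im w > 0" "f w \<noteq> 0"
    and X: "X holomorphic_on {s. Im s > 0}" "\<And>s. Im s > 0 \<Longrightarrow> X s \<noteq> 0"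
    and D: "D \<subseteq> {s. Im s > 0}"
  shows "(\<Sum>p | p \<in> D \<and> X p * reflect f p = 0. zorder (\<lambda>s. X s * reflect f s) p) = num_zeros_in f ((\<lambda>s. 1 - cnj s) ` D)"
proof -
  have op: "open {s. Im s > 0}" by (rule open_halfspace_Im_gt)
  have an: "f analytic_on {s}" if "Im s > 0" for s
    using f op that by (auto simp: analytic_on_open[symmetric] intro: analytic_on_subset)
  have "zorder (\<lambda>s. X s * reflect f s) p = zorder f (1 - cnj p)" if p: "p \<in> D" for p
  proof -
    have p: "Im p > 0" using p D by auto
    have ev: "zorder (\<lambda>s. X s * reflect f s) p = zorder X p + zorder (reflect f) p"
    proof (rule zorder_times_analytic)
      show "X analytic_on {p}" using X op p by (auto simp: analytic_on_open[symmetric] intro: analytic_on_subset)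
      show "reflect f analytic_on {p}"
        using reflect_holomorphic[OF f] op p by (auto simp: analytic_on_open[symmetric] intro: analytic_on_subset)
      have "\<forall>\<^sub>F z in at p. reflect f z \<noteq> 0 \<and> z \<in> {s. Im s > 0}"
        by (rule non_zero_neighbour_alt[OF reflect_holomorphic[OF f] op, of _ "1 - cnj w"])
           (use p nz in \<open>auto simp: reflect_def intro!: convex_connected convex_halfspace_Im_gt\<close>)
      thus "\<forall>\<^sub>F z in at p. X z * reflect f z \<noteq> 0"
        by (rule eventually_mono) (use X in auto)
    qed
    have "zorder X p = 0" by (rule zorder_eqI[of "{s. Im s > 0}" p X]) (use X op p in auto)
    thus ?thesis using ev zorder_reflect[OF f p nz] by simp
  qed
  hence "(\<Sum>p | p \<in> D \<and> X p * reflect f p = 0. zorder (\<lambda>s. X s * reflect f s) p) = 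
     (\<Sum>p | p \<in> D \<and> X p * reflect f p = 0. zorder f (1 - cnj p))" by (intro sum.cong) auto
  also have "\<dots> = num_zeros_in f ((\<lambda>s. 1 - cnj s) ` D)"
    unfolding num_zeros_in_def
  proof (rule sum.reindex_bij_betw)
    show "bij_betw (\<lambda>s. 1 - cnj s) {p \<in> D. X p * reflect f p = 0} (zeros_of f \<inter> (\<lambda>s. 1 - cnj s) ` D)"
    proof (rule bij_betwI')
      fix y assume "y \<in> zeros_of f \<inter> (\<lambda>s. 1 - cnj s) ` D"
      thus "\<exists>x\<in>{p \<in> D. X p * reflect f p = 0}. y = 1 - cnj x"
        by (auto simp: zeros_of_def reflect_def)
    next
      fix p assume "p \<in> {p \<in> D. X p * reflect f p = 0}"
      thus "1 - cnj p \<in> zeros_of f \<inter> (\<lambda>s. 1 - cnj s) ` D"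
        using D X an[of "1 - cnj p"] by (auto simp: zeros_of_def reflect_def)
    qed auto
  qed
  finally show ?thesis .
qed

subsection \<open>Comparison of the two discs\<close>

text \<open>The first term dominates: the rest is at most the integral of x powr (- Re s) from a to
  infinity, which is a / (Re s - 1) times the modulus of the first term, and that modulus is at
  least 1.\<close>

lemma norm_lerch_series_ge:
  assumes l: "0 < l" "l \<le> 1" and a: "0 < a" "a \<le> 1" and s: "Re s > 1 + a"
  shows "norm (lerch_series l a s) \<ge> 1 - a / (Re s - 1)"
proof -
  define \<sigma> where "\<sigma> = Re s"
  have \<sigma>: "\<sigma> > 1" "\<sigma> > 1 + a" using s a by (auto simp: \<sigma>_def)
  define t where "t = (\<lambda>m. cis (2 * pi * l * real m) / complex_of_real (real m + a) powr s)"
  have t_norm: "norm (t m) = (real m + a) powr (- \<sigma>)" for m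
    using norm_powr_real_powr[of "complex_of_real (real m + a)" s] a
    by (simp add: t_def norm_divide norm_mult norm_inverse powr_minus divide_inverse \<sigma>_def del: of_real_add)
  have t_sum: "t sums lerch_series l a s"
  proof -
    have c: "-1 < - a / 2" "- a / 2 < 0" "a + - a / 2 > 0" using a by auto
    have "Re s > 1" using \<sigma> by (simp add: \<sigma>_def)
    from lerch_sums_lerch_int[OF c(1,2) l this c(3)] lerch_int_eq_series[OF c(1,2) l this c(3)]
    show ?thesis by (simp add: t_def)
  qed
  define F where "F = (\<lambda>m::nat. - ((real m + a) powr (1 - \<sigma>)) / (\<sigma> - 1))"
  \<comment> \<open>Comparison of a term with the integral over the preceding unit interval, through
    an antiderivative and the mean value theorem.\<close>
  have F_step: "(real (Suc m) + a) powr (- \<sigma>) \<le> F (Suc m) - F m" for m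
  proof -
    have der: "((\<lambda>x. - (x powr (1 - \<sigma>)) / (\<sigma> - 1)) has_real_derivative x powr (- \<sigma>)) (at x)" if "x > 0" for x
    proof -
      have "((\<lambda>x. x powr (1 - \<sigma>)) has_real_derivative (1 - \<sigma>) * x powr (- \<sigma>)) (at x)"
        using has_real_derivative_powr[OF that, of "1 - \<sigma>"] by simp
      from DERIV_cdivide[OF DERIV_minus[OF this], of "\<sigma> - 1"]
      have "((\<lambda>x. - (x powr (1 - \<sigma>)) / (\<sigma> - 1)) has_real_derivative - ((1 - \<sigma>) * x powr (- \<sigma>)) / (\<sigma> - 1)) (at x)" .
      moreover have "- ((1 - \<sigma>) * x powr (- \<sigma>)) / (\<sigma> - 1) = x powr (- \<sigma>)"
        using \<sigma> by (simp add: divide_eq_eq algebra_simps)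
      ultimately show ?thesis by (simp only:)
    qed
    have "\<exists>z. real m + a < z \<and> z < real (Suc m) + a \<and>
       (- ((real (Suc m) + a) powr (1 - \<sigma>)) / (\<sigma> - 1)) - (- ((real m + a) powr (1 - \<sigma>)) / (\<sigma> - 1)) 
        = ((real (Suc m) + a) - (real m + a)) * z powr (- \<sigma>)"
      using a by (intro MVT2 der) auto
    then obtain z where z: "real m + a < z" "z < real (Suc m) + a" "F (Suc m) - F m = z powr (- \<sigma>)"
      by (auto simp: F_def)
    thus ?thesis using a \<sigma> by (auto intro!: powr_mono2')
  qed
  have F_sum: "(\<lambda>m. F (Suc m) - F m) sums (a powr (1 - \<sigma>) / (\<sigma> - 1))"
  proof -
    have "F \<longlonglongrightarrow> 0" unfolding F_def using \<sigma> a by real_asymp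
    from telescope_sums[OF this] show ?thesis by (simp add: F_def)
  qed
  have summ: "summable (\<lambda>m. norm (t (Suc m)))"
    using summable_shifted_powr[of a \<sigma>] a \<sigma> by (subst summable_Suc_iff) (simp add: t_norm)
  have "norm (\<Sum>m. t (Suc m)) \<le> (\<Sum>m. norm (t (Suc m)))" by (rule summable_norm[OF summ])
  also have "\<dots> \<le> (\<Sum>m. F (Suc m) - F m)"
    using F_step summ F_sum by (intro suminf_le) (auto simp: t_norm sums_iff)
  also have "\<dots> = a powr (1 - \<sigma>) / (\<sigma> - 1)" using F_sum by (simp add: sums_iff)
  also have "\<dots> = a powr (- \<sigma>) * (a / (\<sigma> - 1))" using a by (simp add: powr_diff powr_minus divide_inverse)
  finally have tail: "norm (\<Sum>m. t (Suc m)) \<le> a powr (- \<sigma>) * (a / (\<sigma> - 1))" .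
  have "lerch_series l a s = t 0 + (\<Sum>m. t (Suc m))"
    using suminf_split_head[of t] t_sum by (simp add: sums_iff)
  hence "norm (lerch_series l a s) \<ge> norm (t 0) - norm (\<Sum>m. t (Suc m))"
    by (metis norm_diff_ineq)
  also have "norm (t 0) = a powr (- \<sigma>)" by (simp add: t_norm)
  finally have "norm (lerch_series l a s) \<ge> a powr (- \<sigma>) * (1 - a / (\<sigma> - 1))"
    using tail by (simp add: right_diff_distrib)
  moreover have "1 \<le> a powr (- \<sigma>)" 
    using powr_mono2'[of "-\<sigma>" a 1] a \<sigma> by simp
  hence "1 * (1 - a / (\<sigma> - 1)) \<le> a powr (- \<sigma>) * (1 - a / (\<sigma> - 1))"
    using \<sigma> by (intro mult_right_mono) auto
  ultimately show ?thesis by (simp add: \<sigma>_def)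
qed

text \<open>The factor \<open>X\<close> of the overview: the coefficient of the first series when
  both parameters are \<open>l\<close>.\<close>

definition fe_factor :: "real \<Rightarrow> complex \<Rightarrow> complex" where
  "fe_factor l s = Gamma (1 - s) * of_real (2 * pi) powr (s - 1) * exp (pi * \<i> * (1 - s) / 2 - 2 * pi * \<i> * l * l)"

text \<open>The term \<open>D\<close> of the overview: the second series times the quotient of the
  two phases, whose modulus is exp (- pi Im s).\<close>

definition fe_error :: "real \<Rightarrow> complex \<Rightarrow> complex" where
  "fe_error l s = exp (- pi * \<i> * (1 - s) + 2 * pi * \<i> * l) * lerch l (1 - l) (1 - s)"

lemma one_minus_not_nonpos_Int: "Im s \<noteq> 0 \<Longrightarrow> 1 - s \<notin> \<int>\<^sub>\<le>\<^sub>0"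
  by (auto simp: nonpos_Ints_def complex_eq_iff)

lemma fe_factor_holomorphic: "fe_factor l holomorphic_on {s. Im s > 0}"
  unfolding fe_factor_def[abs_def]
  by (intro holomorphic_intros) (use one_minus_not_nonpos_Int in auto)

lemma fe_factor_nonzero: "Im s > 0 \<Longrightarrow> fe_factor l s \<noteq> 0"
  using one_minus_not_nonpos_Int[of s] by (auto simp: fe_factor_def Gamma_eq_zero_iff)

text \<open>Conjugation inverts the phases and fixes the positive bases. This identifies the series
  with parameters (- l, l) in the functional equation as a reflected value.\<close>

lemma cnj_lerch_series:
  assumes l: "0 < l" "l \<le> 1" and a: "0 < a" "a \<le> 1" and s: "Re s > 1"
  shows "cnj (lerch_series l a s) = lerch_series (- l) a (cnj s)"
proof -
  have c: "-1 < - a / 2" "- a / 2 < 0" "a + - a / 2 > 0" using a by auto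
  have "(\<lambda>m. cis (2 * pi * l * real m) / complex_of_real (real m + a) powr s) sums lerch_series l a s"
    using lerch_sums_lerch_int[OF c(1,2) l s c(3)] lerch_int_eq_series[OF c(1,2) l s c(3)] by simp
  hence "(\<lambda>m. cnj (cis (2 * pi * l * real m) / complex_of_real (real m + a) powr s)) sums cnj (lerch_series l a s)"
    by (simp only: sums_cnj)
  moreover have "cnj (cis (2 * pi * l * real m) / complex_of_real (real m + a) powr s) = 
     cis (2 * pi * (- l) * real m) / complex_of_real (real m + a) powr cnj s" for m
    using a by (simp add: cnj_powr cis_cnj del: of_real_add)
  ultimately show ?thesis
    unfolding lerch_series_def by (simp only: sums_iff)
qed

text \<open>For Re s < -1 this is the general functional equation with a = l, its first series
  recognized as \<open>reflect\<close>. Both sides are holomorphic in the upper half plane, so it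
  persists there.\<close>

lemma lerch_functional_equation:
  assumes l: "0 < l" "l < 1" and s: "Im s > 0"
  shows "lerch l l s = fe_factor l s * (reflect (lerch l l) s + fe_error l s)"
proof (rule analytic_continuation_open[of "{s. Im s > 0} \<inter> {s. Re s < -1}" "{s. Im s > 0}" "lerch l l"])
  show "open ({s. Im s > 0} \<inter> {s. Re s < -1})"
    by (intro open_Int open_halfspace_Im_gt open_halfspace_Re_lt)
  show "{s. Im s > 0} \<inter> {s. Re s < -1} \<noteq> {}"
  proof -
    have "Complex (-2) 1 \<in> {s. Im s > 0} \<inter> {s. Re s < -1}" by simp
    thus ?thesis by blast
  qed
  show "connected {s. Im s > 0}" by (intro convex_connected convex_halfspace_Im_gt)
  show "lerch l l holomorphic_on {s. Im s > 0}" using l by (intro lerch_holomorphic) auto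
  have "lerch l (1 - l) \<circ> (\<lambda>s. 1 - s) holomorphic_on {s. Im s > 0}"
    using l by (intro holomorphic_on_compose[of "\<lambda>s. 1 - s"] lerch_holomorphic) (auto intro!: holomorphic_intros)
  hence E: "fe_error l holomorphic_on {s. Im s > 0}"
    unfolding fe_error_def[abs_def] by (intro holomorphic_intros) (simp add: o_def)
  show "(\<lambda>s. fe_factor l s * (reflect (lerch l l) s + fe_error l s)) holomorphic_on {s. Im s > 0}"
    using l by (intro holomorphic_intros fe_factor_holomorphic E reflect_holomorphic lerch_holomorphic) auto
  fix s assume "s \<in> {s. Im s > 0} \<inter> {s. Re s < -1}"
  hence s: "Re s < -1" by auto
  have "reflect (lerch l l) s = lerch_series (-l) l (1 - s)"
    using s l cnj_lerch_series[of l l "1 - cnj s"] by (simp add: reflect_def lerch_eq_series)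
  moreover have "lerch l (1 - l) (1 - s) = lerch_series l (1 - l) (1 - s)"
    using s l by (intro lerch_eq_series) auto
  moreover have "exp (- pi * \<i> * (1 - s) / 2 + 2 * pi * \<i> * l * (1 - complex_of_real l)) = 
      exp (pi * \<i> * (1 - s) / 2 - 2 * pi * \<i> * l * l) * exp (- pi * \<i> * (1 - s) + 2 * pi * \<i> * l)"
    unfolding exp_add[symmetric] by (rule arg_cong[of _ _ exp]) (simp add: field_simps)
  ultimately show "lerch l l s = fe_factor l s * (reflect (lerch l l) s + fe_error l s)"
    using lerch_functional_equation_left[OF l(1) less_imp_le[OF l(2)] l s]
    by (simp only: fe_factor_def fe_error_def) (simp only: distrib_left mult.assoc)
qed (use s in \<open>auto intro: open_halfspace_Im_gt\<close>)

lemma fe_error_bound: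
  assumes l: "0 < l" "l < 1" and B: "B \<ge> 0"
  obtains K where "K > 0" "\<And>s. \<bar>Re s\<bar> \<le> B \<Longrightarrow> Im s \<ge> 1 \<Longrightarrow> norm (fe_error l s) \<le> K * Im s powr (B + 2) * exp (- pi * Im s)"
proof -
  obtain K where K: "K > 0" "\<And>s. \<bar>Re s\<bar> \<le> B + 1 \<Longrightarrow> \<bar>Im s\<bar> \<ge> 1 \<Longrightarrow> norm (lerch l (1 - l) s) \<le> K * \<bar>Im s\<bar> powr (B + 1 + 1)"
    using lerch_growth[of l "1 - l" "B + 1"] l B by auto
  show ?thesis
  proof (rule that[of K])
    fix s :: complex assume s: "\<bar>Re s\<bar> \<le> B" "Im s \<ge> 1"
    have "norm (fe_error l s) = exp (- pi * Im s) * norm (lerch l (1 - l) (1 - s))"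
      by (simp add: fe_error_def norm_mult)
    also have "norm (lerch l (1 - l) (1 - s)) \<le> K * \<bar>Im (1 - s)\<bar> powr (B + 1 + 1)"
      using s by (intro K) auto
    finally show "norm (fe_error l s) \<le> K * Im s powr (B + 2) * exp (- pi * Im s)"
      using s by (simp add: mult_ac add.assoc)
  qed (use K in auto)
qed

text \<open>The decay exp (- pi t / 2) of Gamma is cancelled exactly by the growth of the phase,
  leaving a power of t.\<close>

lemma fe_factor_bound:
  assumes B: "B \<ge> 0"
  obtains K N where "K > 0" "\<And>s. \<bar>Re s\<bar> \<le> B \<Longrightarrow> Im s \<ge> 1 \<Longrightarrow> norm (fe_factor l s) \<le> K * Im s ^ N"
proof -
  obtain K N where K: "K > 0" "\<And>x y. \<bar>x\<bar> \<le> B + 1 \<Longrightarrow> \<bar>y\<bar> \<ge> 1 \<Longrightarrow> norm (Gamma (Complex x y)) \<le> K * \<bar>y\<bar> ^ N * exp (- pi * \<bar>y\<bar> / 2)"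
    using norm_Gamma_strip_le[of "B + 1"] B by auto
  show ?thesis
  proof (rule that[of "K * (2 * pi) powr B" N])
    fix s :: complex assume s: "\<bar>Re s\<bar> \<le> B" "Im s \<ge> 1"
    have "1 - s = Complex (1 - Re s) (- Im s)" by (simp add: complex_eq_iff)
    hence 1: "norm (Gamma (1 - s)) \<le> K * Im s ^ N * exp (- pi * Im s / 2)"
      using K(2)[of "1 - Re s" "- Im s"] s by simp
    have "norm (complex_of_real (2 * pi) powr (s - 1)) = (2 * pi) powr (Re s - 1)"
      by (subst norm_powr_real_powr) auto
    also have "\<dots> \<le> (2 * pi) powr B" using s pi_gt3 by (intro powr_mono) auto
    finally have 2: "norm (complex_of_real (2 * pi) powr (s - 1)) \<le> (2 * pi) powr B" .
    have 3: "norm (exp (pi * \<i> * (1 - s) / 2 - 2 * pi * \<i> * l * l)) = exp (pi * Im s / 2)"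
      by simp
    have "norm (fe_factor l s) \<le> (K * Im s ^ N * exp (- pi * Im s / 2)) * (2 * pi) powr B * exp (pi * Im s / 2)"
      unfolding fe_factor_def norm_mult 3 using K s by (intro mult_mono 1 2) auto
    also have "\<dots> = K * (2 * pi) powr B * Im s ^ N * (exp (- pi * Im s / 2) * exp (pi * Im s / 2))"
      by (simp only: mult_ac)
    also have "exp (- pi * Im s / 2) * exp (pi * Im s / 2) = 1" by (simp flip: exp_add)
    finally show "norm (fe_factor l s) \<le> K * (2 * pi) powr B * Im s ^ N" by simp
  qed (use K in auto)
qed

section \<open>Rouche's theorem on a small disc\<close>

lemma finite_zeros_compact:
  assumes "f holomorphic_on S" "open S" "connected S" "compact K" "K \<subseteq> S" "w \<in> S" "f w \<noteq> 0"
  shows "finite {z \<in> K. f z = 0}"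
proof (cases "f constant_on S")
  case True
  hence "{z \<in> K. f z = 0} = {}" using assms by (auto simp: constant_on_def)
  thus ?thesis by (simp only: finite.emptyI)
qed (use holomorphic_compact_finite_zeros assms in blast)

lemma lerch_disc_comparison:
  assumes l: "0 < l" "l < 1" and \<rho>: "Im \<rho> > 1" and r: "0 < r" "r < 1"
    and less: "\<And>s. dist \<rho> s = r \<Longrightarrow> norm (fe_factor l s * fe_error l s) < norm (lerch l l s)"
  shows "num_zeros_in (lerch l l) (ball \<rho> r) = num_zeros_in (lerch l l) (ball (1 - cnj \<rho>) r)"
proof -
  let ?f = "lerch l l" and ?g = "\<lambda>s. - (fe_factor l s * fe_error l s)" and ?P = "{s. Im s > 0}"
  let ?h = "\<lambda>s. fe_factor l s * reflect ?f s"
  let ?c = "circlepath \<rho> r"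
  have f: "?f holomorphic_on A" for A using l by (intro lerch_holomorphic) auto
  have fg: "?f s + ?g s = ?h s" if "Im s > 0" for s
    using lerch_functional_equation[OF l that] by (simp add: algebra_simps)
  \<comment> \<open>A disc of fixed radius 1 is the domain for Rouche's theorem; zeros between the
    circle and its boundary get winding number 0.\<close>
  have sub: "cball \<rho> 1 \<subseteq> ?P"
  proof
    fix s assume "s \<in> cball \<rho> 1"
    hence "\<bar>Im (\<rho> - s)\<bar> \<le> 1" using abs_Im_le_cmod[of "\<rho> - s"] by (simp add: dist_norm)
    thus "s \<in> ?P" using \<rho> by simp
  qed
  have P: "open ?P" "connected ?P"
    by (auto intro!: open_halfspace_Im_gt convex_connected convex_halfspace_Im_gt)
  have h: "?h holomorphic_on ?P"
    by (intro holomorphic_intros fe_factor_holomorphic reflect_holomorphic f)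
  \<comment> \<open>By the functional equation this is a difference of functions already known to be
    holomorphic.\<close>
  have g: "?g holomorphic_on ?P"
  proof (rule holomorphic_transform)
    show "(\<lambda>s. ?h s - ?f s) holomorphic_on ?P" by (intro holomorphic_intros h f)
  qed (use fg in \<open>auto simp: algebra_simps\<close>)
  define w where "w = \<rho> + of_real r"
  have w: "dist \<rho> w = r" using r by (simp add: w_def dist_norm)
  hence wP: "w \<in> ?P" using r by (intro subsetD[OF sub]) auto
  \<comment> \<open>Strictness in \<open>less\<close> rules out zeros of \<open>?f\<close> and of
    \<open>?f + ?g\<close> on the circle.\<close>
  have fw: "?f s \<noteq> 0" and hw: "?h s \<noteq> 0" if "dist \<rho> s = r" for s
  proof -
    have "s \<in> ?P" using that r by (intro subsetD[OF sub]) auto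
    thus "?f s \<noteq> 0" "?h s \<noteq> 0" using less[OF that] fg[of s] by (auto simp: add_eq_0_iff)
  qed
  have fin_f: "finite {p \<in> ball \<rho> 1. ?f p = 0}"
    by (rule finite_subset[OF _ finite_zeros_compact[OF f P compact_cball sub wP fw[OF w]]]) auto
  have fin_h: "finite {p \<in> ball \<rho> 1. ?h p = 0}"
    by (rule finite_subset[OF _ finite_zeros_compact[OF h P compact_cball sub wP hw[OF w]]]) auto
  have bP: "Im s > 0" if "s \<in> ball \<rho> 1" for s using that sub by (auto simp: subset_iff)
  have zeq: "{p \<in> ball \<rho> 1. ?f p + ?g p = 0} = {p \<in> ball \<rho> 1. ?h p = 0}"
  proof -
    have "?f p + ?g p = 0 \<longleftrightarrow> ?h p = 0" if "p \<in> ball \<rho> 1" for p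
      by (simp only: fg[OF bP[OF that]])
    thus ?thesis by blast
  qed
  have wind0: "winding_number ?c z = 0" if "z \<notin> cball \<rho> r" for z
    using that r by (intro winding_number_zero_outside[of _ "cball \<rho> r"]) auto
  have "(\<Sum>p\<in>{p \<in> ball \<rho> 1. ?f p + ?g p = 0}. winding_number ?c p * zorder (\<lambda>p. ?f p + ?g p) p)
      = (\<Sum>p\<in>{p \<in> ball \<rho> 1. ?f p = 0}. winding_number ?c p * zorder ?f p)"
  proof (rule Rouche_theorem)
    show "?g holomorphic_on ball \<rho> 1" using g by (rule holomorphic_on_subset) (use bP in auto)
    show "path_image ?c \<subseteq> ball \<rho> 1" using r by auto
    show "\<forall>z\<in>path_image ?c. cmod (?g z) < cmod (?f z)"
      using less r by (auto simp: dist_commute)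
    show "\<forall>z. z \<notin> ball \<rho> 1 \<longrightarrow> winding_number ?c z = 0"
      using r by (intro allI impI wind0) auto
  qed (use f fin_f fin_h zeq in auto)
  also have "(\<Sum>p\<in>{p \<in> ball \<rho> 1. ?f p + ?g p = 0}. winding_number ?c p * zorder (\<lambda>p. ?f p + ?g p) p) = 
     (\<Sum>p\<in>{p \<in> ball \<rho> 1. ?h p = 0}. winding_number ?c p * zorder ?h p)"
    unfolding zeq
  proof (intro sum.cong refl arg_cong2[of _ _ _ _ "(*)"] arg_cong[of _ _ of_int] zorder_cong)
    fix p assume "p \<in> {p \<in> ball \<rho> 1. ?h p = 0}"
    hence "\<forall>\<^sub>F z in nhds p. z \<in> ?P" using bP P(1) by (intro eventually_nhds_in_open) auto
    hence "\<forall>\<^sub>F z in nhds p. ?f z + ?g z = ?h z" by eventually_elim (use fg in auto)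
    thus "\<forall>\<^sub>F z in at p. ?f z + ?g z = ?h z" by (rule eventually_at_filter[THEN iffD2, OF eventually_mono]) auto
  qed
  finally have eq: "(\<Sum>p\<in>{p \<in> ball \<rho> 1. ?h p = 0}. winding_number ?c p * zorder ?h p) = 
      (\<Sum>p\<in>{p \<in> ball \<rho> 1. ?f p = 0}. winding_number ?c p * zorder ?f p)" .
  \<comment> \<open>Winding numbers are 1 inside and 0 outside, and no zero lies on the circle, so
    the weighted sums become plain counts.\<close>
  have red: "(\<Sum>p\<in>{p \<in> ball \<rho> 1. k p = 0}. winding_number ?c p * zorder k p) = of_int (\<Sum>p | p \<in> ball \<rho> r \<and> k p = 0. zorder k p)"
    if fin: "finite {p \<in> ball \<rho> 1. k p = 0}" and nz: "\<And>s. dist \<rho> s = r \<Longrightarrow> k s \<noteq> 0" for k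
  proof -
    have "(\<Sum>p\<in>{p \<in> ball \<rho> 1. k p = 0}. winding_number ?c p * zorder k p) = 
       (\<Sum>p | p \<in> ball \<rho> r \<and> k p = 0. winding_number ?c p * zorder k p)"
    proof (rule sum.mono_neutral_right[OF fin])
      show "{p. p \<in> ball \<rho> r \<and> k p = 0} \<subseteq> {p \<in> ball \<rho> 1. k p = 0}" using r by auto
      show "\<forall>p\<in>{p \<in> ball \<rho> 1. k p = 0} - {p. p \<in> ball \<rho> r \<and> k p = 0}. winding_number ?c p * zorder k p = 0"
      proof
        fix p assume p: "p \<in> {p \<in> ball \<rho> 1. k p = 0} - {p. p \<in> ball \<rho> r \<and> k p = 0}"
        hence "dist \<rho> p \<noteq> r" using nz by auto
        hence "p \<notin> cball \<rho> r" using p by auto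
        thus "winding_number ?c p * zorder k p = 0" by (simp add: wind0)
      qed
    qed
    also have "\<dots> = (\<Sum>p | p \<in> ball \<rho> r \<and> k p = 0. of_int (zorder k p))"
      by (intro sum.cong refl) (simp add: winding_number_circlepath dist_norm norm_minus_commute)
    finally show ?thesis by simp
  qed
  have "(\<Sum>p | p \<in> ball \<rho> r \<and> ?h p = 0. zorder ?h p) = (\<Sum>p | p \<in> ball \<rho> r \<and> ?f p = 0. zorder ?f p)"
    using eq red[OF fin_f fw] red[OF fin_h hw] by (simp only: of_int_eq_iff)
  moreover have "(\<Sum>p | p \<in> ball \<rho> r \<and> ?h p = 0. zorder ?h p) = num_zeros_in ?f ((\<lambda>s. 1 - cnj s) ` ball \<rho> r)"
    using wP fw[OF w] bP r by (intro num_zeros_in_reflect[OF f _ _ fe_factor_holomorphic fe_factor_nonzero]) auto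
  moreover have "zeros_of ?f \<inter> ball \<rho> r = {p. p \<in> ball \<rho> r \<and> ?f p = 0}"
    using f[of UNIV] by (auto simp: zeros_of_def analytic_on_open[symmetric] intro: analytic_on_subset)
  ultimately show ?thesis by (simp add: reflect_ball num_zeros_in_def)
qed

subsection \<open>The case \<open>l < 1\<close>\<close>

lemma zeros_of_lerch:
  assumes "0 < l" "l < 1"
  shows "zeros_of (lerch l l) = {s. lerch l l s = 0}"
proof -
  have "lerch l l analytic_on UNIV"
    using assms by (simp add: analytic_on_open lerch_holomorphic)
  hence "lerch l l analytic_on {s}" for s by (rule analytic_on_subset) auto
  thus ?thesis by (auto simp: zeros_of_def)
qed

text \<open>Zeros are counted from the centre 2 + i Im rho, where the series is at least 1 - l in
  modulus. Radius 5 covers the unit disc about rho. Even 2 ^ card is polynomially bounded; the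
  weaker linear form suffices.\<close>

lemma card_lerch_zeros_le:
  assumes l: "0 < l" "l < 1"
  obtains K where "K \<ge> 1" "\<And>\<rho> Z. \<bar>Re \<rho>\<bar> \<le> 2 \<Longrightarrow> Im \<rho> \<ge> 20 \<Longrightarrow> Z \<subseteq> {s \<in> cball \<rho> 1. lerch l l s = 0} \<Longrightarrow> finite Z \<Longrightarrow>
     real (card Z) + 1 \<le> K * Im \<rho> powr 21"
proof -
  \<comment> \<open>The disc of radius 15 about abscissa 2 has real parts between -13 and 17, within
    the strip of half-width 20; this is the origin of the exponent 21.\<close>
  obtain K0 where K0: "K0 > 0" "\<And>s. \<bar>Re s\<bar> \<le> 20 \<Longrightarrow> \<bar>Im s\<bar> \<ge> 1 \<Longrightarrow> norm (lerch l l s) \<le> K0 * \<bar>Im s\<bar> powr (20 + 1)"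
    using lerch_growth[of l l 20] l by auto
  define K where "K = max 1 (K0 * 2 powr 21 / (1 - l))"
  show ?thesis
  proof (rule that[of K])
    fix \<rho> Z assume \<rho>: "\<bar>Re \<rho>\<bar> \<le> 2" "Im \<rho> \<ge> 20" and Z: "Z \<subseteq> {s \<in> cball \<rho> 1. lerch l l s = 0}" "finite Z"
    define c where "c = Complex 2 (Im \<rho>)"
    have "dist c \<rho> \<le> 4"
    proof -
      have "norm (c - \<rho>) \<le> \<bar>Re (c - \<rho>)\<bar> + \<bar>Im (c - \<rho>)\<bar>" by (rule cmod_le)
      also have "\<dots> \<le> 4" using \<rho> by (simp add: c_def)
      finally show ?thesis by (simp add: dist_norm)
    qed
    have "2 ^ card Z * norm (lerch l l c) \<le> K0 * (2 * Im \<rho>) powr 21"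
    proof (rule card_zeros_le[where r = 5 and f = "lerch l l" and c = c])
      show "lerch l l w = 0 \<and> dist c w \<le> 5" if "w \<in> Z" for w
      proof -
        have "dist \<rho> w \<le> 1" "lerch l l w = 0" using that Z by auto
        thus ?thesis using \<open>dist c \<rho> \<le> 4\<close> dist_triangle[of c w \<rho>] by linarith
      qed
      fix z assume "dist c z \<le> 3 * 5"
      hence "norm (c - z) \<le> 15" by (simp add: dist_norm)
      hence "\<bar>Re (c - z)\<bar> \<le> 15" "\<bar>Im (c - z)\<bar> \<le> 15"
        using abs_Re_le_cmod[of "c - z"] abs_Im_le_cmod[of "c - z"] by linarith+
      hence z: "\<bar>Re z\<bar> \<le> 20" "\<bar>Im z\<bar> \<ge> 1" "\<bar>Im z\<bar> \<le> 2 * Im \<rho>" using \<rho> by (auto simp: c_def)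
      have "norm (lerch l l z) \<le> K0 * \<bar>Im z\<bar> powr (20 + 1)" using z by (intro K0) auto
      also have "\<dots> \<le> K0 * (2 * Im \<rho>) powr (20 + 1)"
        using z K0 by (intro mult_left_mono powr_mono2) auto
      finally show "norm (lerch l l z) \<le> K0 * (2 * Im \<rho>) powr 21" by simp
    qed (use l Z lerch_holomorphic in auto)
    moreover have "norm (lerch l l c) \<ge> 1 - l"
    proof -
      have "norm (lerch_series l l c) \<ge> 1 - l / (Re c - 1)" using l by (intro norm_lerch_series_ge) (auto simp: c_def)
      thus ?thesis using l by (simp add: lerch_eq_series c_def)
    qed
    hence "2 ^ card Z * (1 - l) \<le> 2 ^ card Z * norm (lerch l l c)" by (intro mult_left_mono) auto
    ultimately have "2 ^ card Z * (1 - l) \<le> K0 * (2 * Im \<rho>) powr 21" by linarith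
    hence "2 ^ card Z \<le> K0 * 2 powr 21 / (1 - l) * Im \<rho> powr 21"
      using l \<rho> by (simp add: field_simps powr_mult)
    also have "\<dots> \<le> K * Im \<rho> powr 21" by (intro mult_right_mono) (auto simp: K_def)
    also have "(2::real) ^ card Z \<ge> real (card Z) + 1"
      using Bernoulli_inequality[of 1 "card Z"] by (simp add: add.commute)
    finally show "real (card Z) + 1 \<le> K * Im \<rho> powr 21" by simp
  qed (auto simp: K_def)
qed

lemma infdist_zeros_ge:
  assumes "Z \<noteq> {}" "\<And>z. z \<in> Z \<Longrightarrow> \<delta> \<le> dist s z"
  shows "\<delta> \<le> infdist s Z"
  using assms by (auto simp: infdist_notempty intro: cINF_greatest)

lemma abs_ln_between:
  assumes "0 < \<delta>" "\<delta> \<le> d" "d \<le> (1::real)"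
  shows "\<bar>ln d\<bar> \<le> - ln \<delta>"
proof -
  have "ln \<delta> \<le> ln d" "ln d \<le> 0" using assms by auto
  thus ?thesis by linarith
qed

lemma lerch_zero_symmetry:
  assumes l: "0 < l" "l < 1" and C: "C > 0" "lerch_lower_bound_const l l (-1) C"
    and A: "A > 0" "A * C < pi"
  shows "\<exists>\<gamma>\<^sub>0>0. \<forall>\<rho>\<in>nontrivial_zeros l. Im \<rho> \<ge> \<gamma>\<^sub>0 \<longrightarrow>
    (\<exists>r. exp (- A * Im \<rho> / ln (Im \<rho>)) \<le> r \<and>
         r \<le> exp (- A * Im \<rho> / ln (Im \<rho>)) * (ln (Im \<rho>))\<^sup>2 \<and>
         num_zeros_in (lerch l l) (ball \<rho> r) = num_zeros_in (lerch l l) (ball (1 - cnj \<rho>) r))"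
proof -
  let ?Z = "zeros_of (lerch l l)"
  define R where "R = (\<lambda>\<gamma>. exp (- A * \<gamma> / ln \<gamma>))"
  obtain t0 where t0: "t0 > 1" "\<And>s. Re s \<ge> -1 \<Longrightarrow> Im s \<ge> t0 \<Longrightarrow> lerch l l s \<noteq> 0 \<Longrightarrow>
        1 / cmod (lerch l l s) < exp (C * (\<bar>ln (infdist s ?Z)\<bar> + 1) * ln (Im s))"
    using C(2) unfolding lerch_lower_bound_const_def by metis
  obtain K1 where K1: "K1 \<ge> 1" "\<And>\<rho> Z. \<bar>Re \<rho>\<bar> \<le> 2 \<Longrightarrow> Im \<rho> \<ge> 20 \<Longrightarrow> Z \<subseteq> {s \<in> cball \<rho> 1. lerch l l s = 0} \<Longrightarrow> finite Z \<Longrightarrow>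
     real (card Z) + 1 \<le> K1 * Im \<rho> powr 21"
    using card_lerch_zeros_le[OF l] by blast
  obtain K2 where K2: "K2 > 0" "\<And>s. \<bar>Re s\<bar> \<le> 3 \<Longrightarrow> Im s \<ge> 1 \<Longrightarrow> norm (fe_error l s) \<le> K2 * Im s powr (3 + 2) * exp (- pi * Im s)"
    using fe_error_bound[of l 3] l by auto
  obtain K3 N where K3: "K3 > 0" "\<And>s. \<bar>Re s\<bar> \<le> 3 \<Longrightarrow> Im s \<ge> 1 \<Longrightarrow> norm (fe_factor l s) \<le> K3 * Im s ^ N"
    using fe_factor_bound[of 3] by auto
  \<comment> \<open>Chosen so that 2 - \<open>\<epsilon>\<close> exceeds 1 + l; beyond that abscissa
    the Dirichlet series is at least \<open>c1 > 0\<close> in modulus.\<close>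
  define \<epsilon> where "\<epsilon> = (1 - l) / 2"
  have \<epsilon>: "0 < \<epsilon>" "\<epsilon> < 1" using l by (auto simp: \<epsilon>_def)
  define c1 where "c1 = 1 - l / (1 - \<epsilon>)"
  have c1: "c1 > 0" using l by (simp add: c1_def \<epsilon>_def field_simps)
  \<comment> \<open>Majorant of the exponent in the lower-bound property on the chosen circle: A
    gamma / ln gamma comes from the radius, ln (2 K1) + 21 ln gamma from the number of zeros to be
    avoided.\<close>
  define Q where "Q = (\<lambda>\<gamma>. C * (A * \<gamma> / ln \<gamma> + (ln (2 * K1) + 21 * ln \<gamma>) + 1) * ln (\<gamma> + 1))"
  have ev: "\<forall>\<^sub>F \<gamma> in at_top. \<gamma> \<ge> 20 \<and> \<gamma> \<ge> t0 + 1 \<and> ln \<gamma> \<ge> 2 \<and> 2 * R \<gamma> \<le> 1 / 2 \<and> 2 * R \<gamma> \<le> \<epsilon>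
     \<and> K2 * \<gamma> powr 5 * exp (- pi * \<gamma>) < c1
     \<and> Q \<gamma> + ln (K2 * K3) + (5 + real N) * ln (\<gamma> + 1) - pi * (\<gamma> - 1) < 0"
  proof (intro eventually_conj)
    have R0: "(R \<longlongrightarrow> 0) at_top" unfolding R_def using A by real_asymp
    from order_tendstoD(2)[OF this, of "1/4"] show "\<forall>\<^sub>F \<gamma> in at_top. 2 * R \<gamma> \<le> 1 / 2"
      by (auto elim!: eventually_mono)
    from order_tendstoD(2)[OF R0, of "\<epsilon>/2"] \<epsilon> show "\<forall>\<^sub>F \<gamma> in at_top. 2 * R \<gamma> \<le> \<epsilon>"
      by (auto elim!: eventually_mono)
    have "((\<lambda>\<gamma>::real. K2 * \<gamma> powr 5 * exp (- pi * \<gamma>)) \<longlongrightarrow> 0) at_top"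
      by real_asymp
    from order_tendstoD(2)[OF this c1] show "\<forall>\<^sub>F \<gamma> in at_top. K2 * \<gamma> powr 5 * exp (- pi * \<gamma>) < c1" .
    \<comment> \<open>Logarithms disappear after division by gamma, and ln (gamma + 1) / ln gamma
      tends to 1. The sign of the limit is where \<open>A * C < pi\<close> enters.\<close>
    have "((\<lambda>\<gamma>. (Q \<gamma> + ln (K2 * K3) + (5 + real N) * ln (\<gamma> + 1) - pi * (\<gamma> - 1)) / \<gamma>) \<longlongrightarrow> C * A - pi) at_top"
      unfolding Q_def by real_asymp
    moreover have "C * A - pi < 0" using A by (simp add: mult.commute)
    ultimately have "\<forall>\<^sub>F \<gamma> in at_top. (Q \<gamma> + ln (K2 * K3) + (5 + real N) * ln (\<gamma> + 1) - pi * (\<gamma> - 1)) / \<gamma> < 0"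
      by (rule order_tendstoD(2))
    thus "\<forall>\<^sub>F \<gamma> in at_top. Q \<gamma> + ln (K2 * K3) + (5 + real N) * ln (\<gamma> + 1) - pi * (\<gamma> - 1) < 0"
      using eventually_gt_at_top[of 0] by eventually_elim (simp add: divide_less_0_iff)
    show "\<forall>\<^sub>F \<gamma>::real in at_top. ln \<gamma> \<ge> 2" by real_asymp
  qed (auto intro: eventually_ge_at_top)
  then obtain \<gamma>0 where \<gamma>0: "\<And>\<gamma>. \<gamma> \<ge> \<gamma>0 \<Longrightarrow> \<gamma> \<ge> 20 \<and> \<gamma> \<ge> t0 + 1 \<and> ln \<gamma> \<ge> 2 \<and> 2 * R \<gamma> \<le> 1 / 2 \<and> 2 * R \<gamma> \<le> \<epsilon>
     \<and> K2 * \<gamma> powr 5 * exp (- pi * \<gamma>) < c1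
     \<and> Q \<gamma> + ln (K2 * K3) + (5 + real N) * ln (\<gamma> + 1) - pi * (\<gamma> - 1) < 0"
    unfolding eventually_at_top_linorder by blast
  have main: "\<exists>r. R (Im \<rho>) \<le> r \<and> r \<le> R (Im \<rho>) * (ln (Im \<rho>))\<^sup>2 \<and>
         num_zeros_in (lerch l l) (ball \<rho> r) = num_zeros_in (lerch l l) (ball (1 - cnj \<rho>) r)"
    if \<rho>: "\<rho> \<in> nontrivial_zeros l" "Im \<rho> \<ge> \<gamma>0" for \<rho>
  proof -
    define \<gamma> where "\<gamma> = Im \<rho>"
    have \<gamma>: "\<gamma> \<ge> 20" "\<gamma> \<ge> t0 + 1" "ln \<gamma> \<ge> 2" "2 * R \<gamma> \<le> 1 / 2" "2 * R \<gamma> \<le> \<epsilon>"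
       "K2 * \<gamma> powr 5 * exp (- pi * \<gamma>) < c1" "Q \<gamma> + ln (K2 * K3) + (5 + real N) * ln (\<gamma> + 1) - pi * (\<gamma> - 1) < 0"
      using \<gamma>0[OF \<rho>(2)] by (auto simp: \<gamma>_def)
    have \<rho>0: "lerch l l \<rho> = 0" "-1 \<le> Re \<rho>" "Re \<rho> < 2" "\<rho> \<in> ?Z"
      using \<rho> l by (auto simp: nontrivial_zeros_def zeros_of_def)
    text \<open>Near the left edge of the strip the reflected value has real part at least
      \<open>1 + l + \<epsilon>\<close>, where the Dirichlet series is bounded away from \<open>0\<close>; so high zeros stay
      away from the edge, and the discs stay inside the range of the lower bound.\<close>
    have Re_ge: "Re \<rho> \<ge> -1 + \<epsilon>"
    proof (rule ccontr)
      assume "\<not> Re \<rho> \<ge> -1 + \<epsilon>"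
      hence Re: "Re (1 - cnj \<rho>) > 2 - \<epsilon>" by simp
      have "0 = fe_factor l \<rho> * (reflect (lerch l l) \<rho> + fe_error l \<rho>)"
        using lerch_functional_equation[OF l, of \<rho>] \<rho>0 \<gamma> by (simp add: \<gamma>_def)
      hence "reflect (lerch l l) \<rho> = - fe_error l \<rho>"
        using fe_factor_nonzero[of \<rho> l] \<gamma> by (simp add: \<gamma>_def eq_neg_iff_add_eq_0)
      hence "norm (lerch l l (1 - cnj \<rho>)) = norm (fe_error l \<rho>)"
        by (metis complex_mod_cnj norm_minus_cancel reflect_def)
      also have "\<dots> \<le> K2 * \<gamma> powr (3 + 2) * exp (- pi * \<gamma>)"
        unfolding \<gamma>_def using \<rho>0 \<gamma> by (intro K2) (auto simp: \<gamma>_def)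
      also have "\<dots> < c1" using \<gamma> by simp
      finally have 1: "norm (lerch l l (1 - cnj \<rho>)) < c1" .
      have "2 - \<epsilon> > 1 + l" using l by (simp add: \<epsilon>_def field_simps)
      hence "norm (lerch_series l l (1 - cnj \<rho>)) \<ge> 1 - l / (Re (1 - cnj \<rho>) - 1)"
        using l Re by (intro norm_lerch_series_ge) auto
      moreover have "l / (Re (1 - cnj \<rho>) - 1) \<le> l / (1 - \<epsilon>)"
        using l Re \<epsilon> by (intro divide_left_mono mult_pos_pos) auto
      moreover have "lerch l l (1 - cnj \<rho>) = lerch_series l l (1 - cnj \<rho>)"
        using l Re \<epsilon> by (intro lerch_eq_series) auto
      ultimately show False using 1 by (simp add: c1_def)
    qed
    define Z where "Z = {s \<in> cball \<rho> 1. lerch l l s = 0}"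
    have finZ: "finite Z"
      unfolding Z_def
    proof (rule finite_zeros_compact)
      show "lerch l l holomorphic_on UNIV" using l by (intro lerch_holomorphic) auto
      have "norm (lerch_series l l 2) \<ge> 1 - l / (Re 2 - 1)" using l by (intro norm_lerch_series_ge) auto
      thus "lerch l l 2 \<noteq> 0" using l by (auto simp: lerch_eq_series)
    qed auto
    \<comment> \<open>Zeros at equal distance from \<open>\<rho>\<close> obstruct the same radius,
      so the set of distances is what counts.\<close>
    define n where "n = card (dist \<rho> ` Z)"
    have "n \<le> card Z" unfolding n_def using finZ by (rule card_image_le)
    moreover have "real (card Z) + 1 \<le> K1 * \<gamma> powr 21"
      unfolding \<gamma>_def using \<rho>0 \<gamma> finZ by (intro K1) (auto simp: Z_def \<gamma>_def)
    ultimately have n: "real n + 1 \<le> K1 * \<gamma> powr 21" by linarith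
    have R: "R \<gamma> > 0" by (simp add: R_def)
    obtain r where r: "R \<gamma> \<le> r" "r \<le> 2 * R \<gamma>" "\<And>d. d \<in> dist \<rho> ` Z \<Longrightarrow> \<bar>r - d\<bar> \<ge> R \<gamma> / (2 * (real n + 1))"
      using exists_radius_avoiding[of "dist \<rho> ` Z" n "R \<gamma>"] finZ R n_def by blast
    \<comment> \<open>Half the spacing of the candidate radii; it becomes the guaranteed distance of
      the circle from every zero.\<close>
    define \<delta> where "\<delta> = R \<gamma> / (2 * (real n + 1))"
    have \<delta>: "\<delta> > 0" "\<delta> \<le> 1 / 2"
    proof -
      show "\<delta> > 0" using R by (simp add: \<delta>_def)
      have "\<delta> \<le> R \<gamma> / 1" unfolding \<delta>_def using R by (intro divide_left_mono) auto
      thus "\<delta> \<le> 1 / 2" using \<gamma> R by simp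
    qed
    have ln_\<delta>: "- ln \<delta> \<le> A * \<gamma> / ln \<gamma> + (ln (2 * K1) + 21 * ln \<gamma>)"
    proof -
      have "ln \<delta> = ln (R \<gamma>) - ln (2 * (real n + 1))" using R by (simp add: \<delta>_def ln_div)
      moreover have "ln (R \<gamma>) = - A * \<gamma> / ln \<gamma>" by (simp add: R_def)
      moreover have "ln (2 * (real n + 1)) \<le> ln ((2 * K1) * \<gamma> powr 21)"
      proof (rule ln_mono)
        show "2 * (real n + 1) \<le> (2 * K1) * \<gamma> powr 21" unfolding mult.assoc by (rule mult_left_mono[OF n]) simp
      qed auto
      moreover have "ln ((2 * K1) * \<gamma> powr 21) = ln (2 * K1) + 21 * ln \<gamma>"
      proof -
        have "ln ((2 * K1) * \<gamma> powr 21) = ln (2 * K1) + ln (\<gamma> powr 21)"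
          using K1 \<gamma> by (subst ln_mult_pos) auto
        also have "ln (\<gamma> powr 21) = 21 * ln \<gamma>" by (rule ln_powr)
        finally show ?thesis .
      qed
      ultimately show ?thesis by simp
    qed
    have r1: "0 < r" "r \<le> 1 / 2" "r \<le> \<epsilon>" using r R \<gamma> by auto
    have "num_zeros_in (lerch l l) (ball \<rho> r) = num_zeros_in (lerch l l) (ball (1 - cnj \<rho>) r)"
    proof (rule lerch_disc_comparison[OF l])
      fix s assume s: "dist \<rho> s = r"
      have "\<bar>Re (\<rho> - s)\<bar> \<le> r" "\<bar>Im (\<rho> - s)\<bar> \<le> r"
        using s abs_Re_le_cmod[of "\<rho> - s"] abs_Im_le_cmod[of "\<rho> - s"] by (auto simp: dist_norm)
      hence s_Re: "-1 \<le> Re s" "\<bar>Re s\<bar> \<le> 3" and s_Im: "\<gamma> - 1 \<le> Im s" "Im s \<le> \<gamma> + 1"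
        using Re_ge \<rho>0 r1 by (auto simp: \<gamma>_def)
      \<comment> \<open>The choice of \<open>r\<close> handles zeros within distance 1 of
        \<open>\<rho>\<close>; any other zero is at least 1 - r >= 1 / 2 >= \<open>\<delta>\<close>
        away.\<close>
      have far: "\<delta> \<le> dist s z" if "z \<in> ?Z" for z
      proof (cases "dist \<rho> z \<le> 1")
        case True
        hence "z \<in> Z" using that by (auto simp: Z_def zeros_of_def)
        hence "\<delta> \<le> \<bar>r - dist \<rho> z\<bar>" using r(3)[of "dist \<rho> z"] by (simp add: \<delta>_def)
        also have "\<dots> \<le> dist s z"
          using dist_triangle[of \<rho> z s] dist_triangle[of \<rho> s z] s by (simp add: dist_commute abs_le_iff)
        finally show ?thesis .
      next
        case False
        thus ?thesis using dist_triangle[of \<rho> z s] s r1 \<delta> by linarith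
      qed
      have inf: "\<delta> \<le> infdist s ?Z" using \<rho>0 far by (intro infdist_zeros_ge) auto
      \<comment> \<open>The zero \<open>\<rho>\<close> itself lies at distance r <= 1, so the
        logarithm is not positive and its modulus is controlled by \<open>\<delta>\<close>.\<close>
      have "infdist s ?Z \<le> dist s \<rho>" using \<rho>0 by (intro infdist_le)
      hence "infdist s ?Z \<le> 1" using s r1 by (simp add: dist_commute)
      with abs_ln_between[OF \<delta>(1) inf] have "\<bar>ln (infdist s ?Z)\<bar> \<le> - ln \<delta>" by simp
      hence ln_d: "\<bar>ln (infdist s ?Z)\<bar> + 1 \<le> A * \<gamma> / ln \<gamma> + (ln (2 * K1) + 21 * ln \<gamma>) + 1"
        using ln_\<delta> by linarith
      have nz: "lerch l l s \<noteq> 0" using far[of s] \<delta> zeros_of_lerch[OF l] by auto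
      have "C * (\<bar>ln (infdist s ?Z)\<bar> + 1) * ln (Im s) \<le> Q \<gamma>"
        unfolding Q_def
      proof (rule mult_mono)
        show "C * (\<bar>ln (infdist s ?Z)\<bar> + 1) \<le> C * (A * \<gamma> / ln \<gamma> + (ln (2 * K1) + 21 * ln \<gamma>) + 1)"
          using ln_d C by (intro mult_left_mono) auto
        show "0 \<le> C * (A * \<gamma> / ln \<gamma> + (ln (2 * K1) + 21 * ln \<gamma>) + 1)"
          using ln_d C by (intro mult_nonneg_nonneg) auto
      qed (use s_Im \<gamma> in auto)
      moreover have "1 / norm (lerch l l s) < exp (C * (\<bar>ln (infdist s ?Z)\<bar> + 1) * ln (Im s))"
        using s_Re s_Im \<gamma> nz by (intro t0) auto
      ultimately have "1 / norm (lerch l l s) < exp (Q \<gamma>)"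
        by (metis exp_le_cancel_iff order.strict_trans2)
      hence lower: "exp (- Q \<gamma>) < norm (lerch l l s)"
        using nz by (simp add: exp_minus field_simps)
      have "norm (fe_factor l s * fe_error l s) \<le> (K3 * Im s ^ N) * (K2 * Im s powr (3 + 2) * exp (- pi * Im s))"
        unfolding norm_mult using s_Re s_Im \<gamma> K3 by (intro mult_mono K2 K3) auto
      also have "\<dots> \<le> (K3 * (\<gamma> + 1) ^ N) * (K2 * (\<gamma> + 1) powr (3 + 2) * exp (- pi * (\<gamma> - 1)))"
        using s_Im \<gamma> K2 K3 by (intro mult_mono power_mono powr_mono2) auto
      also have "\<dots> = exp (ln (K2 * K3) + (5 + real N) * ln (\<gamma> + 1) - pi * (\<gamma> - 1))"
      proof -
        have "(\<gamma> + 1) ^ N = exp (real N * ln (\<gamma> + 1))" using \<gamma> by (simp add: exp_of_nat_mult)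
        moreover have "(\<gamma> + 1) powr (3 + 2) = exp (5 * ln (\<gamma> + 1))" using \<gamma> by (simp add: powr_def)
        moreover have "K2 * K3 = exp (ln (K2 * K3))" using K2 K3 by simp
        ultimately have "(K3 * (\<gamma> + 1) ^ N) * (K2 * (\<gamma> + 1) powr (3 + 2) * exp (- pi * (\<gamma> - 1))) = 
            exp (ln (K2 * K3)) * exp (real N * ln (\<gamma> + 1)) * exp (5 * ln (\<gamma> + 1)) * exp (- pi * (\<gamma> - 1))"
          by (simp only: mult_ac)
        thus ?thesis by (simp only: exp_add[symmetric]) (simp add: algebra_simps)
      qed
      also have "\<dots> < exp (- Q \<gamma>)" using \<gamma>(7) by simp
      finally show "norm (fe_factor l s * fe_error l s) < norm (lerch l l s)" using lower by simp
    qed (use r1 \<gamma> in \<open>auto simp: \<gamma>_def\<close>)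
    moreover have "r \<le> R \<gamma> * (ln \<gamma>)\<^sup>2"
    proof -
      \<comment> \<open>Of the admissible range of radii, only the factor 2 from the choice of
        \<open>r\<close> has to be accommodated.\<close>
      have "2 \<le> (ln \<gamma>)\<^sup>2" using power_mono[of 2 "ln \<gamma>" 2] \<gamma> by simp
      hence "R \<gamma> * 2 \<le> R \<gamma> * (ln \<gamma>)\<^sup>2" using R by (intro mult_left_mono) auto
      thus ?thesis using r by linarith
    qed
    ultimately show ?thesis using r(1) unfolding \<gamma>_def by blast
  qed
  show ?thesis
    using main by (intro exI[of _ "max 1 \<gamma>0"]) (auto simp: R_def)
qed

subsection \<open>The case \<open>l = 1\<close>\<close>

lemma integrable_powr_vertical_line:
  assumes b: "b > 0" and s: "Re s > 1"
  shows "integrable lborel (\<lambda>y. Complex b y powr (-s))"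
proof (rule Bochner_Integration.integrable_bound)
  have "integrable lborel (\<lambda>y. (b + \<bar>y\<bar>) powr (- Re s) * (exp (pi / 2 * \<bar>Im s\<bar>) / 2 powr (- Re s)))"
    using integrable_powr_abs[OF b s] by simp
  thus "integrable lborel (\<lambda>y. ((b + \<bar>y\<bar>) / 2) powr (- Re s) * exp (pi / 2 * \<bar>Im s\<bar>))"
    using b by (simp add: powr_divide)
  show "AE y in lborel. norm (Complex b y powr (-s)) \<le> norm (((b + \<bar>y\<bar>) / 2) powr (- Re s) * exp (pi / 2 * \<bar>Im s\<bar>))"
  proof (rule AE_I2)
    fix y
    have "norm (Complex b y powr (-s)) \<le> norm (Complex b y) powr (- Re s) * exp (pi / 2 * \<bar>Im s\<bar>)"
      using b by (intro norm_powr_le_half_plane) auto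
    also have "\<dots> \<le> ((b + \<bar>y\<bar>) / 2) powr (- Re s) * exp (pi / 2 * \<bar>Im s\<bar>)"
      using b s norm_Complex_ge[of b y] by (intro mult_right_mono powr_mono2') auto
    finally show "norm (Complex b y powr (-s)) \<le> norm (((b + \<bar>y\<bar>) / 2) powr (- Re s) * exp (pi / 2 * \<bar>Im s\<bar>))"
      by simp
  qed
qed measurable

text \<open>The antiderivative vanishes at minus infinity because Re s > 1. Its value at 0 is the
  term that will carry the pole at s = 1.\<close>

lemma integral_powr_lower_ray:
  assumes b: "b > 0" and s: "Re s > 1"
  shows "(LINT y|lborel. indicator {..<0} y *\<^sub>R Complex b y powr (-s)) = \<i> * (of_real b powr (1 - s) / (s - 1))"
proof -
  define F where "F = (\<lambda>y. Complex b y powr (1 - s) / (\<i> * (1 - s)))"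
  have s1: "s \<noteq> 1" using s by auto
  have nonpos: "Complex b y \<notin> \<real>\<^sub>\<le>\<^sub>0" for y using b by (auto simp: complex_nonpos_Reals_iff)
  have cont: "isCont (Complex b) y" for y
    unfolding Complex_eq[abs_def] by (intro continuous_intros)
  have int: "integrable lborel (\<lambda>y. Complex b y powr (-s))"
    using b s by (rule integrable_powr_vertical_line)
  have "(LBINT y=-\<infinity>..ereal 0. Complex b y powr (-s)) = of_real b powr (1 - s) / (\<i> * (1 - s)) - 0"
  proof (rule interval_integral_FTC_integrable[where F = F])
    show "(F has_vector_derivative Complex b y powr (-s)) (at y)" for y
    proof -
      have "(Complex b has_vector_derivative \<i>) (at y)"
        unfolding Complex_eq[abs_def] by (auto intro!: derivative_eq_intros)
      moreover have "((\<lambda>w. w powr (1 - s) / (\<i> * (1 - s))) has_field_derivative Complex b y powr (-s) / \<i>) (at (Complex b y))"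
      proof -
        have "((\<lambda>w. w powr (1 - s)) has_field_derivative (1 - s) * Complex b y powr (1 - s - 1)) (at (Complex b y))"
          using nonpos[of y] by (rule has_field_derivative_powr)
        from DERIV_cdivide[OF this, of "\<i> * (1 - s)"] show ?thesis
          using s1 by simp
      qed
      ultimately have "((\<lambda>w. w powr (1 - s) / (\<i> * (1 - s))) \<circ> Complex b has_vector_derivative \<i> * (Complex b y powr (-s) / \<i>)) (at y)"
        by (rule field_vector_diff_chain_at)
      thus ?thesis by (simp add: F_def o_def)
    qed
    show "isCont (\<lambda>y. Complex b y powr (-s)) y" for y
      using nonpos[of y] b cont[of y] by (intro continuous_intros) auto
    show "set_integrable lborel (einterval (-\<infinity>) (ereal 0)) (\<lambda>y. Complex b y powr (-s))"
      unfolding set_integrable_def using int by (intro integrable_mult_indicator) auto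
    have "(F \<longlongrightarrow> 0) at_bot"
    proof (rule Lim_null_comparison)
      show "\<forall>\<^sub>F y in at_bot. norm (F y) \<le> (- y) powr (- (Re s - 1)) * (exp (pi / 2 * \<bar>Im s\<bar>) / norm (1 - s))"
        using eventually_le_at_bot[of "-1"]
      proof eventually_elim
        case (elim y)
        have "- y \<le> norm (Complex b y)" using abs_Im_le_cmod[of "Complex b y"] by simp
        have "norm (Complex b y powr (- (s - 1))) \<le> norm (Complex b y) powr (- Re (s - 1)) * exp (pi / 2 * \<bar>Im (s - 1)\<bar>)"
          using b by (intro norm_powr_le_half_plane) auto
        also have "\<dots> \<le> (- y) powr (- Re (s - 1)) * exp (pi / 2 * \<bar>Im (s - 1)\<bar>)"
          using elim s \<open>- y \<le> norm (Complex b y)\<close> by (intro mult_right_mono powr_mono2') auto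
        finally have "norm (Complex b y powr (1 - s)) / norm (1 - s) \<le> (- y) powr (- (Re s - 1)) * exp (pi / 2 * \<bar>Im s\<bar>) / norm (1 - s)"
          by (intro divide_right_mono) auto
        thus ?case by (simp add: F_def norm_divide norm_mult)
      qed
      have "((\<lambda>y. (- y) powr (- (Re s - 1))) \<longlongrightarrow> 0) at_bot"
        using s by real_asymp
      thus "((\<lambda>y. (- y) powr (- (Re s - 1)) * (exp (pi / 2 * \<bar>Im s\<bar>) / norm (1 - s))) \<longlongrightarrow> 0) at_bot"
        by (rule tendsto_mult_left_zero)
    qed
    thus "((F \<circ> real_of_ereal) \<longlongrightarrow> 0) (at_right (-\<infinity>))" by (simp add: ereal_tendsto_simps)
    have "isCont F 0"
      unfolding F_def using nonpos[of 0] s1 b cont[of 0] by (intro continuous_intros) auto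
    hence "(F \<longlongrightarrow> F 0) (at_left 0)" by (simp add: isCont_def filterlim_at_split)
    moreover have "F 0 = of_real b powr (1 - s) / (\<i> * (1 - s))"
      by (simp add: F_def complex_of_real_def)
    ultimately show "((F \<circ> real_of_ereal) \<longlongrightarrow> of_real b powr (1 - s) / (\<i> * (1 - s))) (at_left (ereal 0))"
      by (simp add: ereal_tendsto_simps)
  qed auto
  hence "(LINT y|lborel. indicator {..<0} y *\<^sub>R Complex b y powr (-s)) = of_real b powr (1 - s) / (\<i> * (1 - s))"
    by (simp add: interval_lebesgue_integral_def set_lebesgue_integral_def einterval_eq_Iic)
  also have "\<dots> = \<i> * (of_real b powr (1 - s) / (s - 1))"
    using s1 by (simp add: field_simps)
  finally show ?thesis .
qed

text \<open>For \<open>l = 1\<close> the kernel tends to \<open>-1\<close> at \<open>-\<i>\<infinity>\<close>; removing that limit leaves an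
  entire function plus an elementary term that carries the pole.\<close>

definition zeta_kernel :: "real \<Rightarrow> complex" where
  "zeta_kernel y = lerch_kernel 1 (Complex (- 1 / 2) y) + indicator {..<0} y"

definition zeta_entire :: "complex \<Rightarrow> complex" where
  "zeta_entire s = (LINT y|lborel. exp (s * (- Ln (Complex (1 / 2) y))) * zeta_kernel y)"

text \<open>The base 1 / 2 is a + c with a = 1 and c = - 1 / 2. The value at 1 follows the
  convention of \<open>is_lerch_continuation\<close> for a pole.\<close>

definition zeta_cont :: "complex \<Rightarrow> complex" where
  "zeta_cont s = (if s = 1 then 0 else \<i> * zeta_entire s + of_real (1 / 2) powr (1 - s) / (s - 1))"

lemma measurable_zeta_kernel [measurable]: "zeta_kernel \<in> borel_measurable borel"
  unfolding zeta_kernel_def[abs_def] by measurable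

text \<open>On Re z = - 1 / 2 the number exp (2 pi i z) is a negative real - q, so the kernel is - q
  / (1 + q), exponentially close to 0 above and to -1 below.\<close>

lemma norm_zeta_kernel_le: "norm (zeta_kernel y) \<le> exp (- (2 * pi) * \<bar>y\<bar>)"
proof -
  define q where "q = exp (- 2 * pi * y)"
  have q: "q > 0" by (simp add: q_def)
  have e: "exp (2 * pi * \<i> * Complex (- 1 / 2) y) = - of_real q"
    by (simp add: q_def complex_eq_iff Re_exp Im_exp)
  have K: "lerch_kernel 1 (Complex (- 1 / 2) y) = of_real (- q / (1 + q))"
  proof -
    have "lerch_kernel 1 (Complex (- 1 / 2) y) = - of_real q / (1 - - of_real q)"
      unfolding e[symmetric] by (simp add: lerch_kernel_def)
    thus ?thesis by simp
  qed
  show ?thesis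
  proof (cases "y < 0")
    case True
    have "zeta_kernel y = of_real (- q / (1 + q)) + 1"
      unfolding zeta_kernel_def K using True by simp
    also have "\<dots> = of_real (- q / (1 + q) + 1)" by (simp only: of_real_add of_real_1)
    also have "- q / (1 + q) + 1 = 1 / (1 + q)" using q by (simp add: divide_simps)
    finally have "zeta_kernel y = of_real (1 / (1 + q))" .
    hence "norm (zeta_kernel y) = 1 / (1 + q)" using q by (simp only: norm_of_real) simp
    also have "\<dots> \<le> 1 / q" using q by (intro divide_left_mono) auto
    also have "\<dots> = exp (- (2 * pi) * \<bar>y\<bar>)" using True by (simp add: q_def exp_minus field_simps)
    finally show ?thesis .
  next
    case False
    have "norm (zeta_kernel y) = q / (1 + q)"
    proof -
      have "zeta_kernel y = of_real (- q / (1 + q))"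
        unfolding zeta_kernel_def K using False by simp
      thus ?thesis using q by (simp only: norm_of_real) simp
    qed
    also have "\<dots> \<le> q / 1" using q by (intro divide_left_mono) auto
    finally show ?thesis using False by (simp add: q_def)
  qed
qed

lemma zeta_entire_holomorphic: "zeta_entire holomorphic_on UNIV"
  unfolding zeta_entire_def[abs_def]
proof (rule holomorphic_integral_exp)
  fix B :: real
  let ?b = "1 / 2 :: real"
  obtain K where K: "K > 0" "\<And>x. x \<ge> 0 \<Longrightarrow> (1 + x) powr \<bar>B\<bar> \<le> K * exp (pi * x)"
    using one_plus_powr_le_exp[of "\<bar>B\<bar>" pi] by auto
  define E where "E = exp (\<bar>B\<bar> * (\<bar>ln ?b\<bar> + ln (1 + ?b) + pi / 2))"
  show "integrable lborel (\<lambda>y. exp (B * norm (- Ln (Complex ?b y))) * norm (zeta_kernel y))"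
  proof (rule Bochner_Integration.integrable_bound)
    show "integrable lborel (\<lambda>y. E * K * exp (- pi * \<bar>y\<bar>))"
      by (intro integrable_mult_right integrable_exp_neg_abs) auto
    show "AE y in lborel. norm (exp (B * norm (- Ln (Complex ?b y))) * norm (zeta_kernel y)) \<le> norm (E * K * exp (- pi * \<bar>y\<bar>))"
    proof (rule AE_I2)
      fix y :: real
      have "B * norm (- Ln (Complex ?b y)) \<le> \<bar>B\<bar> * norm (Ln (Complex ?b y))"
        by (simp add: mult_right_mono)
      also have "\<dots> \<le> \<bar>B\<bar> * (\<bar>ln ?b\<bar> + ln (1 + ?b) + pi / 2 + ln (1 + \<bar>y\<bar>))"
        by (intro mult_left_mono norm_Ln_Complex_le) auto
      finally have "exp (B * norm (- Ln (Complex ?b y))) \<le> exp (\<bar>B\<bar> * (\<bar>ln ?b\<bar> + ln (1 + ?b) + pi / 2 + ln (1 + \<bar>y\<bar>)))"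
        unfolding exp_le_cancel_iff .
      also have "\<dots> = E * (1 + \<bar>y\<bar>) powr \<bar>B\<bar>"
        unfolding E_def by (simp only: distrib_left exp_add) (simp add: powr_def)
      also have "\<dots> \<le> E * (K * exp (pi * \<bar>y\<bar>))"
        using K(2)[of "\<bar>y\<bar>"] by (intro mult_left_mono) (auto simp: E_def)
      finally have "exp (B * norm (- Ln (Complex ?b y))) * norm (zeta_kernel y) \<le> E * (K * exp (pi * \<bar>y\<bar>)) * exp (- (2 * pi) * \<bar>y\<bar>)"
        using K by (intro mult_mono norm_zeta_kernel_le) (auto simp: E_def)
      also have "\<dots> = E * K * (exp (pi * \<bar>y\<bar>) * exp (- (2 * pi) * \<bar>y\<bar>))" by simp
      also have "exp (pi * \<bar>y\<bar>) * exp (- (2 * pi) * \<bar>y\<bar>) = exp (- pi * \<bar>y\<bar>)"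
        by (simp flip: exp_add)
      finally show "norm (exp (B * norm (- Ln (Complex ?b y))) * norm (zeta_kernel y)) \<le> norm (E * K * exp (- pi * \<bar>y\<bar>))"
        by simp
    qed
  qed measurable
qed measurable

lemma zeta_cont_holomorphic: "zeta_cont holomorphic_on - {1}"
proof (rule holomorphic_transform)
  show "(\<lambda>s. \<i> * zeta_entire s + of_real (1 / 2) powr (1 - s) / (s - 1)) holomorphic_on - {1}"
    by (intro holomorphic_intros holomorphic_on_subset[OF zeta_entire_holomorphic]) auto
qed (auto simp: zeta_cont_def)

lemma zeta_cont_eq_series:
  assumes s: "Re s > 1"
  shows "zeta_cont s = lerch_series 1 1 s"
proof -
  let ?w = "\<lambda>y. Complex (1 / 2) y powr (-s)"
  have "lerch_series 1 1 s = lerch_int (- 1 / 2) 1 1 s"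
    using s by (intro lerch_int_eq_series[symmetric]) auto
  also have "\<dots> = \<i> * (LINT y|lborel. ?w y * lerch_kernel 1 (Complex (- 1 / 2) y))"
    by (simp add: lerch_int_def)
  also have "(LINT y|lborel. ?w y * lerch_kernel 1 (Complex (- 1 / 2) y)) = 
      (LINT y|lborel. ?w y * zeta_kernel y - indicator {..<0} y *\<^sub>R ?w y)"
    by (intro Bochner_Integration.integral_cong) (auto simp: zeta_kernel_def indicator_def algebra_simps)
  also have "\<dots> = (LINT y|lborel. ?w y * zeta_kernel y) - (LINT y|lborel. indicator {..<0} y *\<^sub>R ?w y)"
  proof (rule Bochner_Integration.integral_diff)
    have c: "-1 < (- 1 / 2 :: real)" "(- 1 / 2 :: real) < 0" "(0 :: real) < 1" "(1 :: real) \<le> 1" "(1/2 :: real) > 0" by auto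
    have 1: "integrable lborel (\<lambda>y. ?w y * lerch_kernel 1 (Complex (- 1 / 2) y))"
      by (rule integrable_lerch_integrand[OF c(1-4) s c(5)])
    show 2: "integrable lborel (\<lambda>y. indicator {..<0} y *\<^sub>R ?w y)"
      using integrable_powr_vertical_line[OF c(5) s] by (intro integrable_mult_indicator) auto
    from Bochner_Integration.integrable_add[OF 1 2]
    show "integrable lborel (\<lambda>y. ?w y * zeta_kernel y)"
      by (rule Bochner_Integration.integrable_cong[THEN iffD1, rotated -1]) (auto simp: zeta_kernel_def indicator_def algebra_simps)
  qed
  also have "(LINT y|lborel. ?w y * zeta_kernel y) = zeta_entire s"
    by (simp add: zeta_entire_def powr_Complex_eq_exp)
  also have "(LINT y|lborel. indicator {..<0} y *\<^sub>R ?w y) = \<i> * (of_real (1 / 2) powr (1 - s) / (s - 1))"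
    using s by (intro integral_powr_lower_ray) auto
  finally show ?thesis using s by (auto simp: zeta_cont_def right_diff_distrib)
qed

lemma is_lerch_continuation_zeta_cont: "is_lerch_continuation 1 1 zeta_cont"
proof -
  \<comment> \<open>The function times s - 1, made entire; its value 1 at s = 1 shows a simple
    pole.\<close>
  define g where "g = (\<lambda>s. \<i> * zeta_entire s * (s - 1) + of_real (1 / 2) powr (1 - s))"
  have g: "g holomorphic_on UNIV"
    unfolding g_def by (intro holomorphic_intros zeta_entire_holomorphic)
  have g1: "g 1 = 1" by (simp add: g_def)
  have eq: "zeta_cont s = g s / (s - 1) ^ 1" if "s \<noteq> 1" for s
    using that by (simp add: zeta_cont_def g_def field_simps)
  have "is_pole (\<lambda>s. g s / (s - 1) ^ 1) 1"
    by (rule is_pole_basic[OF g]) (auto simp: g1)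
  also have "?this \<longleftrightarrow> is_pole zeta_cont 1"
    by (intro is_pole_cong) (auto simp: eventually_at_filter eq)
  finally have "is_pole zeta_cont 1" .
  moreover have "zorder zeta_cont 1 = -1"
    by (rule zorder_eqI[of UNIV 1 g]) (use g g1 eq in \<open>auto simp: power_int_minus field_simps\<close>)
  ultimately show ?thesis
    by (simp add: is_lerch_continuation_def zeta_cont_eq_series zeta_cont_holomorphic) (simp add: zeta_cont_def)
qed

lemma lerch_1_1: "lerch 1 1 = zeta_cont"
  by (rule lerch_eqI[OF is_lerch_continuation_zeta_cont])

text \<open>The zeta series is split into even and odd integers. Their difference is the alternating
  series; the odd integers, written 2 (m + 1 / 2), give the shift 1 / 2.\<close>

lemma zeta_even_odd:
  assumes s: "Re s > 1"
  shows "lerch_series (1 / 2) 1 s = (1 - 2 powr (1 - s)) * lerch_series 1 1 s"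
    and "lerch_series 1 (1 / 2) s = (2 powr s - 1) * lerch_series 1 1 s"
proof -
  \<comment> \<open>Index \<open>m\<close> stands for the integer m + 1, so the fact called
    \<open>odd\<close> below sums over the even integers and \<open>even\<close> over the odd
    ones.\<close>
  define T where "T = (\<lambda>m. 1 / complex_of_real (real m + 1) powr s)"
  define S where "S = lerch_series 1 1 s"
  have c: "-1 < (- 1 / 4 :: real)" "(- 1 / 4 :: real) < 0" by auto
  have cis1: "cis (2 * pi * 1 * real m) = 1" for m using cis_multiple_2pi[of "real m"] by (simp add: mult_ac)
  have ser: "(\<lambda>m. cis (2 * pi * l * real m) / complex_of_real (real m + a) powr s) sums lerch_series l a s"
    if "0 < l" "l \<le> 1" "a + - 1 / 4 > 0" for l a
    using lerch_sums_lerch_int[OF c that(1,2) s that(3)] lerch_int_eq_series[OF c that(1,2) s that(3)] by simp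
  have T: "T sums S" using ser[of 1 1] unfolding T_def S_def cis1 by simp
  have two: "complex_of_real (2 * x) powr s = 2 powr s * of_real x powr s" if "x > 0" for x
    using that powr_times_real[of 2 "of_real x" s] by simp
  have p2: "(2::complex) powr s \<noteq> 0" by simp
  have odd: "(\<lambda>m. T (2 * m + 1)) sums (S / 2 powr s)"
  proof -
    have "T (2 * m + 1) = T m / 2 powr s" for m
    proof -
      have "real (2 * m + 1) + 1 = 2 * (real m + 1)" by simp
      thus ?thesis unfolding T_def by (simp only: two) (simp add: two field_simps del: of_real_add)
    qed
    thus ?thesis using sums_divide[OF T] by simp
  qed
  have pair: "(\<lambda>m. T (2 * m) + T (2 * m + 1)) sums S"
    using sums_group[OF T, of 2] by (simp add: mult.commute numeral_2_eq_2)
  have even: "(\<lambda>m. T (2 * m)) sums (S - S / 2 powr s)"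
    using sums_diff[OF pair odd] by simp
  have half: "(\<lambda>m. 2 powr s * T (2 * m)) sums lerch_series 1 (1 / 2) s"
  proof -
    have "2 powr s * T (2 * m) = cis (2 * pi * 1 * real m) / complex_of_real (real m + 1 / 2) powr s" for m
    proof -
      have "real (2 * m) + 1 = 2 * (real m + 1 / 2)" by simp
      moreover have "complex_of_real (2 * (real m + 1 / 2)) powr s = 2 powr s * of_real (real m + 1 / 2) powr s"
        by (rule two) simp
      ultimately show ?thesis unfolding T_def cis1 using p2 by (simp only:) (simp add: field_simps del: of_real_add)
    qed
    thus ?thesis using ser[of 1 "1 / 2"] by simp
  qed
  from sums_unique2[OF half sums_mult[OF even]]
  show "lerch_series 1 (1 / 2) s = (2 powr s - 1) * lerch_series 1 1 s"
    using p2 by (simp add: S_def right_diff_distrib left_diff_distrib)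
  have "(\<lambda>m. cis (2 * pi * (1 / 2) * real m) * T m) sums lerch_series (1 / 2) 1 s"
    using ser[of "1 / 2" 1] by (simp add: T_def)
  from sums_group[OF this, of 2]
  have "(\<lambda>m. T (2 * m) - T (2 * m + 1)) sums lerch_series (1 / 2) 1 s"
  proof -
    have "cis (2 * pi * (1 / 2) * real (2 * m)) = 1" for m
      using cis_multiple_2pi[of "real m"] by (simp add: mult_ac)
    moreover have "cis (2 * pi * (1 / 2) * real (2 * m + 1)) = -1" for m
    proof -
      have "cis (2 * pi * (1 / 2) * real (2 * m + 1)) = cis (2 * pi * real m) * cis pi"
        unfolding cis_mult by (rule arg_cong[of _ _ cis]) (simp add: field_simps)
      thus ?thesis using cis_multiple_2pi[of "real m"] by simp
    qed
    ultimately have "sum (\<lambda>m. cis (2 * pi * (1 / 2) * real m) * T m) {m * 2..<m * 2 + 2} = T (2 * m) - T (2 * m + 1)" for m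
    proof -
      have "{m * 2..<m * 2 + 2} = {2 * m, 2 * m + 1}" by auto
      thus ?thesis using \<open>\<And>m. cis (2 * pi * (1 / 2) * real (2 * m)) = 1\<close> \<open>\<And>m. cis (2 * pi * (1 / 2) * real (2 * m + 1)) = -1\<close>
        by (simp only:) simp
    qed
    thus ?thesis using sums_group[OF \<open>(\<lambda>m. cis (2 * pi * (1 / 2) * real m) * T m) sums lerch_series (1 / 2) 1 s\<close>, of 2] by simp
  qed
  from sums_unique2[OF this sums_diff[OF even odd]]
  show "lerch_series (1 / 2) 1 s = (1 - 2 powr (1 - s)) * lerch_series 1 1 s"
  proof -
    have "(1 - 2 / 2 powr s) * S = S - S / 2 powr s - S / 2 powr s"
      by (simp add: left_diff_distrib)
    moreover have "(2::complex) powr (1 - s) = 2 / 2 powr s" by (simp add: powr_diff)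
    moreover assume "lerch_series (1 / 2) 1 s = S - S / 2 powr s - S / 2 powr s"
    ultimately show ?thesis by (simp add: S_def)
  qed
qed

lemma lerch_half_1:
  assumes "s \<noteq> 1"
  shows "lerch (1 / 2) 1 s = (1 - 2 powr (1 - s)) * zeta_cont s"
proof (rule analytic_continuation_open[of "{s. Re s > 1}" "- {1}" "lerch (1 / 2) 1"])
  show "open {s::complex. Re s > 1}" by (rule open_halfspace_Re_gt)
  show "{s::complex. Re s > 1} \<noteq> {}" by (auto intro!: exI[of _ 2])
  show "connected (- {1::complex})" by (intro connected_punctured_universe) auto
  show "lerch (1 / 2) 1 holomorphic_on - {1}" by (intro lerch_holomorphic) auto
  show "(\<lambda>s. (1 - 2 powr (1 - s)) * zeta_cont s) holomorphic_on - {1}"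
    by (intro holomorphic_intros zeta_cont_holomorphic) auto
  show "lerch (1 / 2) 1 s = (1 - 2 powr (1 - s)) * zeta_cont s" if "s \<in> {s. Re s > 1}" for s
    using that zeta_even_odd(1)[of s] by (simp add: lerch_eq_series zeta_cont_eq_series)
qed (use assms in auto)

text \<open>Equals 2 (2 pi) powr (s - 1) Gamma (1 - s) sin (pi s / 2), the classical factor chi(s)
  in zeta(s) = chi(s) zeta(1 - s).\<close>

definition zeta_fe_factor :: "complex \<Rightarrow> complex" where
  "zeta_fe_factor s = Gamma (1 - s) * of_real (2 * pi) powr (s - 1) * 
     (exp (pi * \<i> * (1 - s) / 2) + exp (- (pi * \<i> * (1 - s) / 2)))"

lemma zeta_fe_factor_holomorphic: "zeta_fe_factor holomorphic_on {s. Im s > 0}"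
  unfolding zeta_fe_factor_def[abs_def]
  by (intro holomorphic_intros) (use one_minus_not_nonpos_Int in auto)

text \<open>Off the real axis the two exponentials have different moduli and cannot cancel.\<close>

lemma zeta_fe_factor_nonzero:
  assumes "Im s > 0"
  shows "zeta_fe_factor s \<noteq> 0"
proof -
  have "exp (pi * \<i> * (1 - s) / 2) + exp (- (pi * \<i> * (1 - s) / 2)) \<noteq> 0"
  proof
    assume "exp (pi * \<i> * (1 - s) / 2) + exp (- (pi * \<i> * (1 - s) / 2)) = 0"
    hence "norm (exp (pi * \<i> * (1 - s) / 2)) = norm (exp (- (pi * \<i> * (1 - s) / 2)))"
      by (metis add_eq_0_iff norm_minus_cancel)
    thus False using assms by simp
  qed
  thus ?thesis using one_minus_not_nonpos_Int[of s] assms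
    by (auto simp: zeta_fe_factor_def Gamma_eq_zero_iff)
qed

text \<open>At parameters (1 / 2, 1) both series of the general functional equation reduce to phase
  1 and shift 1 / 2. The left side contributes 1 - 2 powr (1 - s) and the right its negative, along
  with a further sign, so these factors cancel.\<close>

lemma zeta_functional_equation:
  assumes s: "Im s > 0"
  shows "zeta_cont s = zeta_fe_factor s * reflect zeta_cont s"
proof (rule analytic_continuation_open[of "{s. Im s > 0} \<inter> {s. Re s < -1}" "{s. Im s > 0}" zeta_cont])
  show "open ({s. Im s > 0} \<inter> {s. Re s < -1})"
    by (intro open_Int open_halfspace_Im_gt open_halfspace_Re_lt)
  show "{s. Im s > 0} \<inter> {s. Re s < -1} \<noteq> {}"
  proof -
    have "Complex (-2) 1 \<in> {s. Im s > 0} \<inter> {s. Re s < -1}" by simp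
    thus ?thesis by blast
  qed
  show "connected {s. Im s > 0}" by (intro convex_connected convex_halfspace_Im_gt)
  show z: "zeta_cont holomorphic_on {s. Im s > 0}"
    by (rule holomorphic_on_subset[OF zeta_cont_holomorphic]) auto
  show "(\<lambda>s. zeta_fe_factor s * reflect zeta_cont s) holomorphic_on {s. Im s > 0}"
    by (intro holomorphic_intros zeta_fe_factor_holomorphic reflect_holomorphic z)
  fix s assume "s \<in> {s. Im s > 0} \<inter> {s. Re s < -1}"
  hence s: "Re s < -1" "Im s > 0" by auto
  define z where "z = 1 - s"
  have z: "Re z > 1" using s by (simp add: z_def)
  have cis1: "cis (2 * pi * real m) = 1" "cis (- (2 * pi * real m)) = 1" for m
    using cis_multiple_2pi[of "real m"] cis_multiple_2pi[of "- real m"] by auto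
  have sym: "lerch_series (-1) a z = lerch_series 1 a z" for a
    by (simp add: lerch_series_def cis1)
  have r: "reflect zeta_cont s = lerch_series 1 1 z"
    using z s cnj_lerch_series[of 1 1 "1 - cnj s"] sym[of 1] by (simp add: reflect_def zeta_cont_eq_series z_def)
  have e1: "exp (pi * \<i> * z / 2 - 2 * pi * \<i> * 1 * (1 / 2)) = - exp (pi * \<i> * z / 2)"
    by (simp add: exp_diff mult.commute)
  have e2: "exp (- pi * \<i> * z / 2 + 2 * pi * \<i> * 1 * (1 - 1 / 2)) = - exp (- (pi * \<i> * z / 2))"
  proof -
    have "exp (- pi * \<i> * z / 2 + 2 * pi * \<i> * 1 * (1 - 1 / 2)) = exp (- (pi * \<i> * z / 2)) * exp (pi * \<i>)"
      unfolding exp_add[symmetric] by (rule arg_cong[of _ _ exp]) simp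
    thus ?thesis by simp
  qed
  have "lerch (1 / 2) 1 s = Gamma z * of_real (2 * pi) powr (s - 1) *
    (exp (pi * \<i> * z / 2 - 2 * pi * \<i> * 1 * (1 / 2)) * lerch_series (- 1) (1 / 2) z +
     exp (- pi * \<i> * z / 2 + 2 * pi * \<i> * 1 * (1 - 1 / 2)) * lerch_series 1 (1 / 2) z)"
    using lerch_functional_equation_left[of 1 "1 / 2" s] s by (simp add: z_def)
  also have "\<dots> = - zeta_fe_factor s * lerch_series 1 (1 / 2) z"
    unfolding e1 e2 sym zeta_fe_factor_def z_def[symmetric] by (simp add: algebra_simps)
  also have "lerch_series 1 (1 / 2) z = (2 powr z - 1) * lerch_series 1 1 z"
    using z by (rule zeta_even_odd)
  finally have "(1 - 2 powr z) * zeta_cont s = (1 - 2 powr z) * (zeta_fe_factor s * lerch_series 1 1 z)"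
  proof -
    have "s \<noteq> 1" using s by auto
    assume "lerch (1 / 2) 1 s = - zeta_fe_factor s * ((2 powr z - 1) * lerch_series 1 1 z)"
    with lerch_half_1[OF \<open>s \<noteq> 1\<close>] show ?thesis by (simp add: z_def algebra_simps)
  qed
  moreover have "1 - 2 powr z \<noteq> 0"
  proof -
    have "norm ((2::complex) powr z) = 2 powr Re z" by (subst norm_powr_real_powr) auto
    also have "\<dots> > 2 powr 0" using z by (intro powr_less_mono) auto
    finally have "norm ((2::complex) powr z) \<noteq> 1" by simp
    thus ?thesis by auto
  qed
  ultimately show "zeta_cont s = zeta_fe_factor s * reflect zeta_cont s" by (simp add: r)
qed (use s in \<open>auto intro: open_halfspace_Im_gt\<close>)

text \<open>With an exact functional equation the zeros correspond one to one with their orders, so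
  no comparison on the circle is involved and any disc in the upper half plane will do.\<close>

lemma zeta_disc_symmetry:
  assumes "ball \<rho> r \<subseteq> {s. Im s > 0}"
  shows "num_zeros_in zeta_cont (ball \<rho> r) = num_zeros_in zeta_cont (ball (1 - cnj \<rho>) r)"
proof -
  let ?P = "{s. Im s > 0}" and ?h = "\<lambda>s. zeta_fe_factor s * reflect zeta_cont s"
  have P: "open ?P" by (rule open_halfspace_Im_gt)
  have z: "zeta_cont holomorphic_on ?P"
    by (rule holomorphic_on_subset[OF zeta_cont_holomorphic]) auto
  have an: "zeta_cont analytic_on {s}" if "s \<in> ?P" for s
    using z P that by (auto simp: analytic_on_open[symmetric] intro: analytic_on_subset)
  have eq: "zeta_cont s = ?h s" if "s \<in> ?P" for s using zeta_functional_equation that by simp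
  have "num_zeros_in zeta_cont (ball \<rho> r) = (\<Sum>p | p \<in> ball \<rho> r \<and> ?h p = 0. zorder ?h p)"
    unfolding num_zeros_in_def
  proof (rule sum.cong)
    show "zeros_of zeta_cont \<inter> ball \<rho> r = {p. p \<in> ball \<rho> r \<and> ?h p = 0}"
    proof -
      have "p \<in> zeros_of zeta_cont \<longleftrightarrow> ?h p = 0" if "p \<in> ball \<rho> r" for p
      proof -
        have p: "p \<in> ?P" using that assms by auto
        show ?thesis unfolding zeros_of_def using an[OF p] eq[OF p] by simp
      qed
      thus ?thesis by blast
    qed
    fix p assume "p \<in> {p. p \<in> ball \<rho> r \<and> ?h p = 0}"
    hence "p \<in> ?P" using assms by auto
    hence "\<forall>\<^sub>F s in nhds p. s \<in> ?P" using P by (intro eventually_nhds_in_open)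
    hence "\<forall>\<^sub>F s in nhds p. zeta_cont s = ?h s" by eventually_elim (use eq in auto)
    hence "\<forall>\<^sub>F s in at p. zeta_cont s = ?h s"
      by (rule eventually_at_filter[THEN iffD2, OF eventually_mono]) auto
    thus "zorder zeta_cont p = zorder ?h p" by (intro zorder_cong) auto
  qed
  also have "\<dots> = num_zeros_in zeta_cont ((\<lambda>s. 1 - cnj s) ` ball \<rho> r)"
  proof (rule num_zeros_in_reflect[OF z _ _ zeta_fe_factor_holomorphic zeta_fe_factor_nonzero assms])
    \<comment> \<open>A point of the upper half plane where the function does not vanish: at real
      part 3 the lower bound is 1 / 2.\<close>
    have "norm (lerch_series 1 1 (Complex 3 1)) \<ge> 1 - 1 / (Re (Complex 3 1) - 1)"
      by (intro norm_lerch_series_ge) auto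
    thus "zeta_cont (Complex 3 1) \<noteq> 0" by (auto simp: zeta_cont_eq_series)
  qed auto
  finally show ?thesis by (simp add: reflect_ball)
qed

text \<open>The smallest admissible radius works. For Im rho >= e the logarithm is at least 1, so
  this radius also respects the upper limit, and being at most 1 it keeps the disc in the upper half
  plane.\<close>

lemma zeta_zero_symmetry:
  assumes A: "A > 0"
  shows "\<exists>\<gamma>\<^sub>0>0. \<forall>\<rho>\<in>nontrivial_zeros 1. Im \<rho> \<ge> \<gamma>\<^sub>0 \<longrightarrow>
    (\<exists>r. exp (- A * Im \<rho> / ln (Im \<rho>)) \<le> r \<and>
         r \<le> exp (- A * Im \<rho> / ln (Im \<rho>)) * (ln (Im \<rho>))\<^sup>2 \<and>
         num_zeros_in (lerch 1 1) (ball \<rho> r) = num_zeros_in (lerch 1 1) (ball (1 - cnj \<rho>) r))"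
proof (rule exI[of _ "exp 1"], intro conjI ballI impI)
  fix \<rho> assume \<rho>: "exp 1 \<le> Im \<rho>"
  define r where "r = exp (- A * Im \<rho> / ln (Im \<rho>))"
  have Im: "Im \<rho> > 1" using \<rho> exp_ge_add_one_self[of "1::real"] by linarith
  hence ln: "ln (Im \<rho>) \<ge> 1" using \<rho> by (subst ln_ge_iff) auto
  have "r \<le> 1" using A Im ln by (simp add: r_def)
  have "ball \<rho> r \<subseteq> {s. Im s > 0}"
  proof
    fix s assume "s \<in> ball \<rho> r"
    hence "\<bar>Im (\<rho> - s)\<bar> < 1" using abs_Im_le_cmod[of "\<rho> - s"] \<open>r \<le> 1\<close> by (simp add: dist_norm)
    thus "s \<in> {s. Im s > 0}" using Im by simp
  qed
  hence "num_zeros_in (lerch 1 1) (ball \<rho> r) = num_zeros_in (lerch 1 1) (ball (1 - cnj \<rho>) r)"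
    unfolding lerch_1_1 by (rule zeta_disc_symmetry)
  moreover have "r \<le> r * (ln (Im \<rho>))\<^sup>2"
    using ln by (simp add: r_def mult_le_cancel_left1)
  ultimately show "\<exists>r. exp (- A * Im \<rho> / ln (Im \<rho>)) \<le> r \<and>
         r \<le> exp (- A * Im \<rho> / ln (Im \<rho>)) * (ln (Im \<rho>))\<^sup>2 \<and>
         num_zeros_in (lerch 1 1) (ball \<rho> r) = num_zeros_in (lerch 1 1) (ball (1 - cnj \<rho>) r)"
    by (intro exI[of _ r]) (auto simp: r_def)
qed auto

theorem theorem3:
  fixes l C A :: real
  assumes "0 < l" and "l \<le> 1"
    and "C > 0" and "lerch_lower_bound_const l l (-1) C"
    and "A > 0" and "A * C < pi"
  shows "\<exists>\<gamma>\<^sub>0>0. \<forall>\<rho>\<in>nontrivial_zeros l. Im \<rho> \<ge> \<gamma>\<^sub>0 \<longrightarrow>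
    (\<exists>r. exp (- A * Im \<rho> / ln (Im \<rho>)) \<le> r \<and>
         r \<le> exp (- A * Im \<rho> / ln (Im \<rho>)) * (ln (Im \<rho>))\<^sup>2 \<and>
         num_zeros_in (lerch l l) (ball \<rho> r) = num_zeros_in (lerch l l) (ball (1 - cnj \<rho>) r))"
proof (cases "l = 1")
  case True
  thus ?thesis using zeta_zero_symmetry[OF \<open>A > 0\<close>] by simp
next
  case False
  thus ?thesis using assms by (intro lerch_zero_symmetry) auto
qed

end
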